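(* Let $q,c\in\mathbb{C}$ with $0<|q|<1$, and let $g$ be a non-constant meromorphic function on $\mathbb{C}$ of zero order. Then $$\sum_{a\in\mathbb{C}\cup\{\infty\}}\left(\delta(a,g)+\theta_{q,c}(a,g)\right)\le\sum_{a\in\mathbb{C}\cup\{\infty\}}\Theta_{q,c}(a,g)\le2.$$
   Context: For $q\in\mathbb{C}\setminus\{0,1\}$, $c\in\mathbb{C}$ and $g$ meromorphic on $\mathbb{C}$, the Hahn difference operator is $\mathcal{D}_{q,c}g(z)=\frac{g(qz+c)-g(z)}{(q-1)z+c}$. $T(r,\cdot)$ is the Nevanlinna characteristic function, and $N(r,g=a)$ is the integrated counting function of $a$-points of $g$ (with multiplicity), i.e. $N(r,\frac1{g-a})$ for $a\in\mathbb{C}$ and $N(r,g)$ for $a=\infty$. The order of $g$ is $\rho(g)=\limsup_{r\to\infty}\frac{\log^{+}T(r,g)}{\log r}$. For $a\in\mathbb{C}$, $\hat n_{q,c}(r,g=a)$ is the sum, over all points $z_0$ with $|z_0|\le r$ and $g(z_0)=a$, of the integers $n-m$, where $n$ is the multiplicity of $z_0$ as a zero of $g-a$, $m=\min\{n,m'\}$, and $m'$ is the multiplicity of $z_0$ as a zero of $\mathcal{D}_{q,c}g$ ($m'=0$ if it is not a zero). Similarly, $\hat n_{q,c}(r,g=\infty)$ is the sum, over all poles $z_0$ of $g$ with $|z_0|\le r$, of $n-m$, where $n$ is the multiplicity of the pole, $m=\min\{n,m'\}$, and $m'$ is the multiplicity of $z_0$ as a zero of $\mathcal{D}_{q,c}\left(\frac1g\right)=-\frac{\mathcal{D}_{q,c}g(z)}{g(qz+c)g(z)}$.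 For $a\in\mathbb{C}\cup\{\infty\}$, $$\hat N_{q,c}(r,g=a)=\int_0^r\frac{\hat n_{q,c}(t,g=a)-\hat n_{q,c}(0,g=a)}{t}\,dt+\hat n_{q,c}(0,g=a)\log r.$$ For $a\in\mathbb{C}\cup\{\infty\}$, define $$\delta(a,g)=1-\limsup_{r\to\infty}\frac{N(r,g=a)}{T(r,g)},\qquad \theta_{q,c}(a,g)=\liminf_{r\to\infty}\frac{N(r,g=a)-\hat N_{q,c}(r,g=a)}{T(r,g)},$$ $$\Theta_{q,c}(a,g)=1-\limsup_{r\to\infty}\frac{\hat N_{q,c}(r,g=a)}{T(r,g)}.$$ *)

theory Defs
  imports "HOL-Complex_Analysis.Complex_Analysis"
begin

text \<open>
  A meromorphic function on the plane is represented by a function that is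
  \<^const>\<open>nicely_meromorphic_on\<close> \<^term>\<open>UNIV\<close>: removable singularities are filled in, and the value
  at a pole is the dummy \<open>0\<close> (so being an \<open>a\<close>-point must exclude poles explicitly).
  \<^const>\<open>zorder\<close> only depends on the function on a punctured neighbourhood, hence the pointwise
  quotients and differences below may take arbitrary values at isolated points without affecting
  multiplicities.
\<close>

text \<open>The extended plane: \<open>Some a\<close> is the finite value \<open>a\<close>, \<open>None\<close> is the point at infinity.\<close>

type_synonym ext_complex = "complex option"

definition hahn_diff :: "complex \<Rightarrow> complex \<Rightarrow> (complex \<Rightarrow> complex) \<Rightarrow> complex \<Rightarrow> complex" where
  "hahn_diff q c g z = (g (q * z + c) - g z) / ((q - 1) * z + c)"

text \<open>The clipping by \<^const>\<open>nat\<close> yields \<open>0\<close> at points that are not zeros.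
  Not meaningful if \<open>f\<close> vanishes identically near \<open>z\<close>.\<close>

definition zero_mult :: "(complex \<Rightarrow> complex) \<Rightarrow> complex \<Rightarrow> nat" where
  "zero_mult f z = nat (zorder f z)"

definition pole_mult :: "(complex \<Rightarrow> complex) \<Rightarrow> complex \<Rightarrow> nat" where
  "pole_mult f z = nat (- zorder f z)"

fun value_points :: "(complex \<Rightarrow> complex) \<Rightarrow> ext_complex \<Rightarrow> complex set" where
  "value_points g (Some a) = {z. \<not> is_pole g z \<and> g z = a}"
| "value_points g None = {z. is_pole g z}"

fun value_mult :: "(complex \<Rightarrow> complex) \<Rightarrow> ext_complex \<Rightarrow> complex \<Rightarrow> nat" where
  "value_mult g (Some a) z = zero_mult (\<lambda>w. g w - a) z"
| "value_mult g None z = pole_mult g z"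

text \<open>The multiplicity called \<open>m'\<close> in the definition of the reduced counting function.\<close>

fun hahn_mult :: "complex \<Rightarrow> complex \<Rightarrow> (complex \<Rightarrow> complex) \<Rightarrow> ext_complex \<Rightarrow> complex \<Rightarrow> nat" where
  "hahn_mult q c g (Some a) z = zero_mult (hahn_diff q c g) z"
| "hahn_mult q c g None z = zero_mult (hahn_diff q c (\<lambda>w. 1 / g w)) z"

definition count_n :: "(complex \<Rightarrow> complex) \<Rightarrow> ext_complex \<Rightarrow> real \<Rightarrow> nat" where
  "count_n g a r = (\<Sum>z\<in>{z \<in> value_points g a. cmod z \<le> r}. value_mult g a z)"

definition hahn_count_n ::
    "complex \<Rightarrow> complex \<Rightarrow> (complex \<Rightarrow> complex) \<Rightarrow> ext_complex \<Rightarrow> real \<Rightarrow> nat" where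
  "hahn_count_n q c g a r =
     (\<Sum>z\<in>{z \<in> value_points g a. cmod z \<le> r}.
        value_mult g a z - min (value_mult g a z) (hahn_mult q c g a z))"

definition integrated_count :: "(real \<Rightarrow> nat) \<Rightarrow> real \<Rightarrow> real" where
  "integrated_count n r =
     integral {0..r} (\<lambda>t. (real (n t) - real (n 0)) / t) + real (n 0) * ln r"

definition count_N :: "(complex \<Rightarrow> complex) \<Rightarrow> ext_complex \<Rightarrow> real \<Rightarrow> real" where
  "count_N g a r = integrated_count (count_n g a) r"

definition hahn_count_N ::
    "complex \<Rightarrow> complex \<Rightarrow> (complex \<Rightarrow> complex) \<Rightarrow> ext_complex \<Rightarrow> real \<Rightarrow> real" where
  "hahn_count_N q c g a r = integrated_count (hahn_count_n q c g a) r"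

text \<open>Since \<^term>\<open>ln (0::real) = 0\<close>, this also gives the right value \<open>0\<close> at \<open>0\<close>.\<close>

definition ln_plus :: "real \<Rightarrow> real" where
  "ln_plus x = max 0 (ln x)"

definition proximity :: "(complex \<Rightarrow> complex) \<Rightarrow> real \<Rightarrow> real" where
  "proximity g r =
     integral {0..2 * pi} (\<lambda>t. ln_plus (cmod (g (of_real r * cis t)))) / (2 * pi)"

definition nev_char :: "(complex \<Rightarrow> complex) \<Rightarrow> real \<Rightarrow> real" where
  "nev_char g r = proximity g r + count_N g None r"

definition nev_order :: "(complex \<Rightarrow> complex) \<Rightarrow> ereal" where
  "nev_order g = Limsup at_top (\<lambda>r::real. ereal (ln_plus (nev_char g r) / ln r))"

definition deficiency :: "ext_complex \<Rightarrow> (complex \<Rightarrow> complex) \<Rightarrow> ereal" where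
  "deficiency a g = 1 - Limsup at_top (\<lambda>r::real. ereal (count_N g a r / nev_char g r))"

definition hahn_ramification ::
    "complex \<Rightarrow> complex \<Rightarrow> ext_complex \<Rightarrow> (complex \<Rightarrow> complex) \<Rightarrow> ereal" where
  "hahn_ramification q c a g =
     Liminf at_top (\<lambda>r::real. ereal ((count_N g a r - hahn_count_N q c g a r) / nev_char g r))"

definition hahn_total_deficiency ::
    "complex \<Rightarrow> complex \<Rightarrow> ext_complex \<Rightarrow> (complex \<Rightarrow> complex) \<Rightarrow> ereal" where
  "hahn_total_deficiency q c a g =
     1 - Limsup at_top (\<lambda>r::real. ereal (hahn_count_N q c g a r / nev_char g r))"

end

theory Submission
  imports Defs
begin

text \<open>
  The deficiencies are defined by upper limits, so the second main theorem is only needed on an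
  unbounded set of radii. A function of order zero satisfies T(Kr) \<open>\<le>\<close> 2T(r) and
  T(K\<open>\<^sup>2\<close>r) \<open>\<le>\<close> 2T(r) for arbitrarily large r, however large K is. For such r, write f = g - a on
  the disc of radius R = Kr as a zero-free function exp H times a product over its n(R) zeros and
  poles there. The Schwarz integral bounds H(qz + c) - H(z) on the circle of radius r by a multiple of
  1/K times the mean of the modulus of Re H over the circle of radius R, each zero or pole contributes
  O(1), and n(R) log K is at most N(KR). Hence the proximity function of f(qz + c)/f(z) is at most
  \<open>\<epsilon>\<close>T(r) + O(1) once K is large, which takes the place of the lemma on the logarithmic derivative.
  The usual summation over the target values, Jensen's formula for the Hahn difference and a comparison
  of multiplicities at every point then give the second main theorem.
\<close>

subsection \<open>Means over circles\<close>

text \<open>The factor K is fixed from \<epsilon> alone, before any target value is named, so that a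
  single unbounded set of radii serves all values at once. Two growth conditions are imposed on
  these radii because the estimate reaches out twice: proximity functions are taken at radius Kr,
  while the zeros and poles in that disc are counted through radius K^2 r. The contraction
  \<open>cmod q < 1\<close> enters in three ways. Large discs are mapped into themselves, so g(qz +
  c) is never examined farther out than g. The poles of g(qz + c) are counted by N(r, g) up to a
  bounded error. And there is a fixed point c/(1 - q), where a power of q would have to equal 1 if
  the Hahn difference vanished identically. The bound 2 is a count: n finite values yield n T on the
  left, one T is given back as m(r, g) + N(r, g), and n + 1 reduced counting functions remain once
  infinity is included.\<close>

definition circle_mean :: "real \<Rightarrow> (complex \<Rightarrow> real) \<Rightarrow> real" where
  "circle_mean r u = integral {0..2 * pi} (\<lambda>t. u (of_real r * cis t)) / (2 * pi)"

text \<open>Absolute integrability, not merely gauge integrability, because the class has to be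
  closed under absolute values and positive parts: \<open>ln_plus\<close> of a modulus is the
  positive part of a logarithm.\<close>

definition circle_integrable :: "real \<Rightarrow> (complex \<Rightarrow> real) \<Rightarrow> bool" where
  "circle_integrable r u \<longleftrightarrow> (\<lambda>t. u (of_real r * cis t)) absolutely_integrable_on {0..2 * pi}"

lemma circle_integrable_imp_integrable: "circle_integrable r u \<Longrightarrow> (\<lambda>t. u (of_real r * cis t)) integrable_on {0..2 * pi}"
  unfolding circle_integrable_def absolutely_integrable_on_def by blast

lemma circle_integrable_continuous:
  assumes "r \<ge> 0" "continuous_on (sphere 0 r) u"
  shows "circle_integrable r u"
  unfolding circle_integrable_def
proof (rule absolutely_integrable_continuous_real)
  have "continuous_on {0..2 * pi} (u \<circ> (\<lambda>t. of_real r * cis t))"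
  proof (rule continuous_on_compose)
    show "continuous_on {0..2 * pi} (\<lambda>t. complex_of_real r * cis t)"
      by (intro continuous_intros)
    show "continuous_on ((\<lambda>t. complex_of_real r * cis t) ` {0..2 * pi}) u"
      by (rule continuous_on_subset[OF assms(2)]) (use assms(1) in \<open>auto simp: norm_mult\<close>)
  qed
  then show "continuous_on {0..2 * pi} (\<lambda>t. u (of_real r * cis t))" by (simp add: o_def)
qed

lemma circle_integrable_const [simp, intro]: "circle_integrable r (\<lambda>_. c)"
  unfolding circle_integrable_def by (rule absolutely_integrable_continuous_real) auto

lemma circle_integrable_add [intro]: "circle_integrable r u \<Longrightarrow> circle_integrable r v \<Longrightarrow> circle_integrable r (\<lambda>z. u z + v z)"
  unfolding circle_integrable_def by (rule set_integral_add)

lemma circle_integrable_cmult [intro]: "circle_integrable r u \<Longrightarrow> circle_integrable r (\<lambda>z. c * u z)"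
  unfolding circle_integrable_def by (rule set_integrable_mult_right) auto

lemma circle_integrable_diff [intro]: "circle_integrable r u \<Longrightarrow> circle_integrable r v \<Longrightarrow> circle_integrable r (\<lambda>z. u z - v z)"
  unfolding circle_integrable_def by (rule set_integral_diff)

lemma circle_integrable_sum: "(\<And>a. a \<in> A \<Longrightarrow> circle_integrable r (u a)) \<Longrightarrow> circle_integrable r (\<lambda>z. \<Sum>a\<in>A. u a z)"
  by (induction A rule: infinite_finite_induct) auto

lemma circle_integrable_abs [intro]: "circle_integrable r u \<Longrightarrow> circle_integrable r (\<lambda>z. \<bar>u z\<bar>)"
  unfolding circle_integrable_def using set_integrable_abs[of lebesgue] by blast

lemma circle_integrable_max0 [intro]: "circle_integrable r u \<Longrightarrow> circle_integrable r (\<lambda>z. max 0 (u z))"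
proof -
  assume u: "circle_integrable r u"
  have "(\<lambda>z. max 0 (u z)) = (\<lambda>z. (1/2) * (u z + \<bar>u z\<bar>))" by (auto simp: fun_eq_iff max_def)
  then show ?thesis using circle_integrable_cmult[OF circle_integrable_add[OF u circle_integrable_abs[OF u]], of "1/2"] by metis
qed

lemma circle_mean_const [simp]: "circle_mean r (\<lambda>_. c) = c"
  by (simp add: circle_mean_def)

lemma circle_mean_add: "circle_integrable r u \<Longrightarrow> circle_integrable r v \<Longrightarrow> circle_mean r (\<lambda>z. u z + v z) = circle_mean r u + circle_mean r v"
  unfolding circle_mean_def by (subst integral_add) (auto dest: circle_integrable_imp_integrable simp: add_divide_distrib)

lemma circle_mean_diff: "circle_integrable r u \<Longrightarrow> circle_integrable r v \<Longrightarrow> circle_mean r (\<lambda>z. u z - v z) = circle_mean r u - circle_mean r v"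
  unfolding circle_mean_def by (subst integral_diff) (auto dest: circle_integrable_imp_integrable simp: diff_divide_distrib)

lemma circle_mean_cmult: "circle_mean r (\<lambda>z. c * u z) = c * circle_mean r u"
  unfolding circle_mean_def by (simp add: integral_mult_right)

lemma circle_mean_sum:
  "(\<And>a. a \<in> A \<Longrightarrow> circle_integrable r (u a)) \<Longrightarrow> circle_mean r (\<lambda>z. \<Sum>a\<in>A. u a z) = (\<Sum>a\<in>A. circle_mean r (u a))"
  by (induction A rule: infinite_finite_induct) (auto simp: circle_mean_add circle_integrable_sum)

text \<open>Finitely many points on a circle become a negligible set of angles; this is why
  estimates on circles may ignore zeros and poles. Injectivity holds on the half-open interval only,
  so the angle \<open>2*pi\<close> is put back by hand.\<close>

lemma finite_circle_preimage:
  assumes "r > 0" "finite S"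
  shows "finite {t \<in> {0..2 * pi}. complex_of_real r * cis t \<in> S}"
proof -
  have inj: "inj_on (\<lambda>t. complex_of_real r * cis t) {0..<2*pi}"
  proof (rule inj_onI)
    fix x y assume xy: "x \<in> {0..<2*pi}" "y \<in> {0..<2*pi}"
      and "complex_of_real r * cis x = complex_of_real r * cis y"
    then have "cis x = cis y" using assms by simp
    then have "sin x = sin y" "cos x = cos y" by (auto simp: complex_eq_iff)
    then obtain n::int where "x = y + 2 * pi * n" using sin_cos_eq_iff[of x y] by auto
    with xy show "x = y"
    proof -
      have "\<bar>2 * pi * n\<bar> < 2 * pi" using xy \<open>x = y + 2 * pi * n\<close> by auto
      then have "\<bar>real_of_int n\<bar> < 1" by (simp add: abs_mult)
      then have "n = 0" by linarith
      then show ?thesis using \<open>x = y + 2 * pi * n\<close> by simp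
    qed
  qed
  have "finite ((\<lambda>t. complex_of_real r * cis t) -` S \<inter> {0..<2*pi})"
    by (rule finite_vimage_IntI[OF assms(2) inj])
  then have "finite (insert (2*pi) ((\<lambda>t. complex_of_real r * cis t) -` S \<inter> {0..<2*pi}))" by simp
  then show ?thesis by (rule finite_subset[rotated]) auto
qed

lemma circle_integrable_spike:
  assumes "circle_integrable r u" "r > 0" "finite S" "\<And>z. cmod z = r \<Longrightarrow> z \<notin> S \<Longrightarrow> v z = u z"
  shows "circle_integrable r v"
  unfolding circle_integrable_def
proof (rule absolutely_integrable_spike[OF assms(1)[unfolded circle_integrable_def]])
  show "negligible {t \<in> {0..2 * pi}. complex_of_real r * cis t \<in> S}"
    by (intro negligible_finite finite_circle_preimage assms)
qed (use assms in \<open>auto simp: norm_mult\<close>)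

lemma circle_mean_spike:
  assumes "r > 0" "finite S" "\<And>z. cmod z = r \<Longrightarrow> z \<notin> S \<Longrightarrow> v z = u z"
  shows "circle_mean r v = circle_mean r u"
proof -
  have "integral {0..2 * pi} (\<lambda>t. v (of_real r * cis t)) = integral {0..2 * pi} (\<lambda>t. u (of_real r * cis t))"
  proof (rule integral_spike)
    show "negligible {t \<in> {0..2 * pi}. complex_of_real r * cis t \<in> S}"
      by (intro negligible_finite finite_circle_preimage assms)
  qed (use assms in \<open>auto simp: norm_mult\<close>)
  then show ?thesis by (simp add: circle_mean_def)
qed

lemma circle_mean_mono:
  assumes "circle_integrable r u" "circle_integrable r v" "r > 0" "finite S"
    "\<And>z. cmod z = r \<Longrightarrow> z \<notin> S \<Longrightarrow> u z \<le> v z"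
  shows "circle_mean r u \<le> circle_mean r v"
proof -
  define u' where "u' = (\<lambda>z. if z \<in> S then v z else u z)"
  have u': "circle_integrable r u'" by (rule circle_integrable_spike[OF assms(1,3,4)]) (auto simp: u'_def)
  have "circle_mean r u = circle_mean r u'" by (rule circle_mean_spike[OF assms(3,4)]) (auto simp: u'_def)
  also have "\<dots> \<le> circle_mean r v"
    unfolding circle_mean_def using u' assms
    by (intro divide_right_mono integral_le circle_integrable_imp_integrable) (auto simp: u'_def norm_mult)
  finally show ?thesis .
qed

lemma circle_mean_nonneg: "(\<And>z. 0 \<le> u z) \<Longrightarrow> 0 \<le> circle_mean r u"
  unfolding circle_mean_def by (cases "(\<lambda>t. u (complex_of_real r * cis t)) integrable_on {0..2*pi}")
    (auto intro!: divide_nonneg_nonneg integral_nonneg simp: not_integrable_integral)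

subsection \<open>Holomorphic functions on circles\<close>

text \<open>With dw = i w dt the Cauchy kernel becomes w/(w - z); in this form it can be matched
  with its conjugate counterpart in the Schwarz integral.\<close>

lemma cauchy_circle_integral:
  assumes "G holomorphic_on cball 0 R" "cmod z < R"
  shows "((\<lambda>t. G (of_real R * cis t) * (of_real R * cis t) / (of_real R * cis t - z))
           has_integral (2 * of_real pi * G z)) {0..2 * pi}"
proof -
  have R: "R > 0" using assms(2) by (smt (verit) norm_ge_zero)
  have "((\<lambda>u. G u/(u-z)) has_contour_integral (2 * of_real pi * \<i> * G z)) (circlepath 0 R)"
    by (rule Cauchy_integral_circlepath_simple) (use assms in auto)
  then have "((\<lambda>t. G (0 + of_real R * cis t) / (0 + of_real R * cis t - z) * of_real R * \<i> * cis t)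
     has_integral (2 * of_real pi * \<i> * G z)) {0..2*pi}"
    unfolding circlepath_def by (subst (asm) has_contour_integral_part_circlepath_iff) auto
  from has_integral_mult_left[OF this, of "-\<i>"] 
  have "((\<lambda>t. G (of_real R * cis t) / (of_real R * cis t - z) * of_real R * \<i> * cis t * (-\<i>))
     has_integral (2 * of_real pi * \<i> * G z * (-\<i>))) {0..2*pi}"
    by simp
  then show ?thesis
    by (rule has_integral_eq_rhs[OF has_integral_eq, rotated]) (auto simp: field_simps)
qed

lemma circle_mean_Re_holomorphic:
  assumes "H holomorphic_on cball 0 R" "R > 0"
  shows "circle_mean R (\<lambda>z. Re (H z)) = Re (H 0)" "circle_integrable R (\<lambda>z. Re (H z))"
proof -
  show c: "circle_integrable R (\<lambda>z. Re (H z))"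
    by (rule circle_integrable_continuous) (use assms in \<open>auto intro!: continuous_intros holomorphic_on_imp_continuous_on intro: holomorphic_on_subset\<close>)
  have "((\<lambda>t. H (of_real R * cis t)) has_integral (2 * of_real pi * H 0)) {0..2 * pi}"
    using cauchy_circle_integral[of H R 0] assms by simp
  from has_integral_Re[OF this] show "circle_mean R (\<lambda>z. Re (H z)) = Re (H 0)"
    unfolding circle_mean_def by (simp add: integral_unique)
qed

text \<open>A zero-free function on a disc has a holomorphic logarithm H, so its log modulus is the
  real part of H and obeys the mean value property. The room between R and R' makes H holomorphic on
  the closed disc.\<close>

lemma circle_mean_ln_nonvanishing:
  assumes "h holomorphic_on ball 0 R'" "\<And>z. z \<in> ball 0 R' \<Longrightarrow> h z \<noteq> 0" "0 < R" "R < R'"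
  shows "circle_mean R (\<lambda>z. ln (cmod (h z))) = ln (cmod (h 0))" "circle_integrable R (\<lambda>z. ln (cmod (h z)))"
    "\<exists>H. H holomorphic_on cball 0 R \<and> (\<forall>z\<in>cball 0 R. h z = exp (H z) \<and> ln (cmod (h z)) = Re (H z))"
proof -
  obtain H where H: "H holomorphic_on ball 0 R'" "\<And>z. z \<in> ball 0 R' \<Longrightarrow> h z = exp (H z)"
    using contractible_imp_holomorphic_log[OF assms(1)] convex_imp_contractible[OF convex_ball] assms(2) by metis
  have sub: "cball 0 R \<subseteq> ball (0::complex) R'" using assms by auto
  have H': "H holomorphic_on cball 0 R" by (rule holomorphic_on_subset[OF H(1) sub])
  have ln: "ln (cmod (h z)) = Re (H z)" if "z \<in> cball 0 R" for z
    using H(2)[of z] sub that by (auto simp: norm_exp_eq_Re)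
  have "circle_mean R (\<lambda>z. ln (cmod (h z))) = circle_mean R (\<lambda>z. Re (H z))"
    by (rule circle_mean_spike[where S="{}"]) (use ln assms in auto)
  also have "\<dots> = Re (H 0)" by (rule circle_mean_Re_holomorphic[OF H' assms(3)])
  also have "\<dots> = ln (cmod (h 0))" using ln[of 0] assms by auto
  finally show "circle_mean R (\<lambda>z. ln (cmod (h z))) = ln (cmod (h 0))" .
  show "circle_integrable R (\<lambda>z. ln (cmod (h z)))"
    by (rule circle_integrable_spike[OF circle_mean_Re_holomorphic(2)[OF H' assms(3)], where S="{}"]) (use ln assms in auto)
  show "\<exists>H. H holomorphic_on cball 0 R \<and> (\<forall>z\<in>cball 0 R. h z = exp (H z) \<and> ln (cmod (h z)) = Re (H z))"
    using H' ln H(2) sub by blast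
qed

text \<open>If a lies outside the circle, z - a is zero-free on a larger disc. If it lies inside, z
  - a is replaced by R^2 - cnj a z, which on the circle has R times the modulus of z - a, while its
  zero is the reflected point R^2/cnj a outside.\<close>

lemma circle_mean_ln_diff_aux:
  assumes "R > 0" "cmod a \<noteq> R"
  shows "circle_integrable R (\<lambda>z. ln (cmod (z - a))) \<and> circle_mean R (\<lambda>z. ln (cmod (z - a))) = ln (max R (cmod a))"
proof (cases "cmod a < R")
  case False
  then have "cmod a > R" using assms by simp
  then show ?thesis
    using circle_mean_ln_nonvanishing(1,2)[of "\<lambda>z. z - a" "cmod a" R] assms
    by (force intro!: holomorphic_intros simp: max_def)
next
  case True
  define h where "h = (\<lambda>w. of_real (R^2) - cnj a * w)"
  \<comment> \<open>The modulus of the reflected zero; for a = 0 the replacement is constant and any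
    larger radius will do.\<close>
  define R' where "R' = (if a = 0 then R + 1 else R^2 / cmod a)"
  have "R^2 > cmod a * R" using True assms by (simp add: power2_eq_square)
  then have RR: "R < R'" using assms unfolding R'_def by (auto simp: field_simps)
  have nz: "h z \<noteq> 0" if "z \<in> ball 0 R'" for z
  proof
    assume "h z = 0"
    then have "cmod (complex_of_real (R^2)) = cmod (cnj a * z)" unfolding h_def by simp
    then have "R^2 = cmod a * cmod z" by (simp add: norm_mult norm_power)
    then show False using that assms by (auto simp: R'_def field_simps split: if_splits)
  qed
  have hol: "h holomorphic_on ball 0 R'" unfolding h_def by (intro holomorphic_intros)
  note L = circle_mean_ln_nonvanishing(1,2)[OF hol nz assms(1) RR]
  have eq: "ln (cmod (z - a)) = ln (cmod (h z)) - ln R" if "cmod z = R" for z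
  proof -
    have "h z = z * cnj (z - a)"
      using that complex_norm_square[of z] by (auto simp: h_def algebra_simps)
    then have "cmod (h z) = R * cmod (z - a)" using that by (metis complex_mod_cnj norm_mult)
    moreover have "z \<noteq> a" using that True by auto
    ultimately show ?thesis using assms by (simp add: ln_mult)
  qed
  have "circle_integrable R (\<lambda>z. ln (cmod (h z)) - ln R)" using L(2) by auto
  moreover have "circle_mean R (\<lambda>z. ln (cmod (h z)) - ln R) = ln R"
    using L assms by (subst circle_mean_diff) (auto simp: h_def norm_power ln_realpow)
  moreover have "circle_mean R (\<lambda>z. ln (cmod (z - a))) = circle_mean R (\<lambda>z. ln (cmod (h z)) - ln R)"
    by (rule circle_mean_spike[where S="{}"]) (use eq assms in auto)
  ultimately show ?thesis
    using circle_integrable_spike[of R "\<lambda>z. ln (cmod (h z)) - ln R" "{}" "\<lambda>z. ln (cmod (z - a))"] True eq assms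
    by auto
qed

lemma circle_mean_ln_diff:
  assumes "R > 0"
  shows "circle_integrable R (\<lambda>z. ln (cmod (z - a)))" "circle_mean R (\<lambda>z. ln (cmod (z - a))) = ln (max R (cmod a))"
proof -
  have "circle_integrable R (\<lambda>z. ln (cmod (z - a))) \<and> circle_mean R (\<lambda>z. ln (cmod (z - a))) = ln (max R (cmod a))"
  proof (cases "cmod a = R")
    case False
    then show ?thesis using circle_mean_ln_diff_aux assms by blast
  next
    case True
    txt \<open>On the circle, the logarithms for the points (1 + 1/n)a decrease to the one for a, so
      monotone convergence yields integrability and the value at the same time.\<close>
    define s where "s = (\<lambda>n::nat. 1 + 1 / real (Suc n))"
    have s1: "s n > 1" for n by (simp add: s_def)
    have sdec: "s (Suc n) \<le> s n" for n by (simp add: s_def field_simps)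
    have slim: "s \<longlonglongrightarrow> 1"
      unfolding s_def using LIMSEQ_inverse_real_of_nat_add[of 1] by (simp add: inverse_eq_divide)
    define T where "T = {t \<in> {0..2 * pi}. complex_of_real R * cis t \<in> {a}}"
    have T: "finite T" unfolding T_def by (rule finite_circle_preimage[OF assms]) auto
    define f where "f = (\<lambda>n t. ln (cmod (of_real R * cis t - of_real (s n) * a)))"
    define g where "g = (\<lambda>t. ln (cmod (of_real R * cis t - a)))"
    have mod: "cmod (of_real (s n) * a) = s n * R" for n
      using s1[of n] True by (simp add: norm_mult)
    have sR: "s n * R > R" for n using s1[of n] assms by simp
    have ne: "cmod (of_real (s n) * a) \<noteq> R" for n using mod[of n] sR[of n] by linarith
    have mx: "max R (cmod (of_real (s n) * a)) = s n * R" for n using mod[of n] sR[of n] by linarith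
    have aux: "circle_integrable R (\<lambda>z. ln (cmod (z - of_real (s n) * a)))"
         "circle_mean R (\<lambda>z. ln (cmod (z - of_real (s n) * a))) = ln (s n * R)" for n
      using circle_mean_ln_diff_aux[OF assms ne[of n]] unfolding mx by blast+
    have fint: "f n integrable_on {0..2*pi}" for n
      using circle_integrable_imp_integrable[OF aux(1)] by (simp add: f_def)
    have fI: "integral {0..2*pi} (f n) = 2 * pi * ln (s n * R)" for n
      using aux(2)[of n] by (simp add: f_def circle_mean_def field_simps)
    have nT: "negligible T" using T by (rule negligible_finite)
    have sd: "negligible {x \<in> {0..2*pi} - ({0..2*pi} - T). P x}" "negligible {x \<in> ({0..2*pi} - T) - {0..2*pi}. P x}" for P
      by (rule negligible_subset[OF nT]; auto)+
    have fint': "f n integrable_on ({0..2*pi} - T)" for n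
      by (rule integrable_spike_set[OF fint sd])
    have fI': "integral ({0..2*pi} - T) (f n) = 2 * pi * ln (s n * R)" for n
      using integral_spike_set[OF sd, of "f n"] fI[of n] by simp
    \<comment> \<open>Since Re (z cnj a) \<le> R^2, the quadratic R^2 - 2 x Re (z cnj a) + x^2 R^2
      is nondecreasing for x \<ge> 1.\<close>
    have mono: "cmod (z - of_real x * a) \<le> cmod (z - of_real y * a)"
      if "1 \<le> x" "x \<le> y" "cmod z = R" for x y z
    proof -
      have cs: "\<bar>Re z * Re a + Im z * Im a\<bar> \<le> R^2"
      proof -
        have "\<bar>Re (z * cnj a)\<bar> \<le> cmod (z * cnj a)" by (rule abs_Re_le_cmod)
        then show ?thesis using that True by (simp add: norm_mult power2_eq_square)
      qed
      have ex: "(cmod (z - of_real x * a))^2 = (cmod z)^2 - 2 * x * (Re z * Re a + Im z * Im a) + x^2 * (cmod a)^2" for x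
        unfolding cmod_power2 by (simp add: algebra_simps power2_eq_square)
      have "(y - x) * (Re z * Re a + Im z * Im a) \<le> (y - x) * R^2"
        using cs that by (intro mult_left_mono) auto
      moreover have "(y - x) * (2 * R^2) \<le> (y - x) * ((x + y) * R^2)"
        using that by (intro mult_left_mono mult_right_mono) auto
      ultimately have "(cmod (z - of_real x * a))^2 \<le> (cmod (z - of_real y * a))^2"
        unfolding ex using that True by (simp add: algebra_simps power2_eq_square)
      then show ?thesis by (simp add: power2_le_iff_abs_le)
    qed
    have pos: "0 < cmod (of_real R * cis t - of_real (s n) * a)" for t n
    proof -
      have "cmod (of_real R * cis t) \<noteq> cmod (of_real (s n) * a)"
        using mod[of n] sR[of n] assms by (simp add: norm_mult)
      then show ?thesis by (metis eq_iff_diff_eq_0 zero_less_norm_iff)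
    qed
    have "g integrable_on ({0..2*pi} - T) \<and> (\<lambda>k. integral ({0..2*pi} - T) (f k)) \<longlonglongrightarrow> integral ({0..2*pi} - T) g"
    proof (rule monotone_convergence_decreasing)
      show "f k integrable_on {0..2 * pi} - T" for k by (rule fint')
      show "f (Suc k) x \<le> f k x" for k x
        unfolding f_def using pos mono[of "s (Suc k)" "s k" "of_real R * cis x"] sdec[of k] s1[of "Suc k"] assms
        by (intro ln_mono) (auto simp: norm_mult)
      show "(\<lambda>k. f k x) \<longlonglongrightarrow> g x" if "x \<in> {0..2 * pi} - T" for x
      proof -
        have nz: "complex_of_real R * cis x \<noteq> a" using that by (auto simp: T_def)
        have "(\<lambda>k. ln (cmod (of_real R * cis x - of_real (s k) * a))) \<longlonglongrightarrow> ln (cmod (of_real R * cis x - of_real 1 * a))"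
          by (intro tendsto_intros slim) (use nz in auto)
        then show ?thesis by (simp add: f_def g_def)
      qed
      have "(\<lambda>k. 2 * pi * ln (s k * R)) \<longlonglongrightarrow> 2 * pi * ln (1 * R)"
        by (intro tendsto_intros slim) (use assms in auto)
      then show "bounded (range (\<lambda>k. integral ({0..2 * pi} - T) (f k)))"
        unfolding fI' by (intro convergent_imp_bounded)
    qed
    moreover have "(\<lambda>k. integral ({0..2*pi} - T) (f k)) \<longlonglongrightarrow> 2 * pi * ln (1 * R)"
      unfolding fI' by (intro tendsto_intros slim) (use assms in auto)
    ultimately have gi: "g integrable_on ({0..2*pi} - T)" "integral ({0..2*pi} - T) g = 2 * pi * ln R"
      using LIMSEQ_unique by fastforce+
    have gi': "g integrable_on {0..2*pi}" by (rule integrable_spike_set[OF gi(1) sd(2,1)])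
    have gI: "integral {0..2*pi} g = 2 * pi * ln R" using integral_spike_set[OF sd, of g] gi(2) by simp
    \<comment> \<open>Near the angle of a the function is bounded above but not below; an upper
      bound is enough to pass from integrability to absolute integrability. The maximum with 0 takes
      care of that angle itself, where \<open>ln 0 = 0\<close>.\<close>
    have "g absolutely_integrable_on {0..2*pi}"
    proof (rule absolutely_integrable_absolutely_integrable_ubound[OF gi'])
      show "(\<lambda>_. max 0 (ln (2 * R))) absolutely_integrable_on {0..2*pi}"
        by (rule absolutely_integrable_continuous_real) auto
      show "g t \<le> max 0 (ln (2 * R))" for t
      proof (cases "complex_of_real R * cis t = a")
        case False
        have "cmod (of_real R * cis t - a) \<le> 2 * R"
          using norm_triangle_ineq4[of "of_real R * cis t" a] assms True by (simp add: norm_mult)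
        then have "g t \<le> ln (2 * R)" unfolding g_def using False by (intro ln_mono) auto
        then show ?thesis by simp
      qed (simp add: g_def)
    qed
    then show ?thesis using gI True assms by (simp add: circle_integrable_def circle_mean_def g_def)
  qed
  then show "circle_integrable R (\<lambda>z. ln (cmod (z - a)))" "circle_mean R (\<lambda>z. ln (cmod (z - a))) = ln (max R (cmod a))"
    by auto
qed

subsection \<open>Jensen's formula\<close>

text \<open>Only punctured neighbourhoods matter, so the property is indifferent to values at
  isolated points: products, quotients and differences need no renormalization, and
  \<open>zorder\<close> is meaningful everywhere.\<close>

definition nz_meromorphic :: "(complex \<Rightarrow> complex) \<Rightarrow> bool" where
  "nz_meromorphic F \<longleftrightarrow> F meromorphic_on UNIV \<and> (\<forall>z. \<forall>\<^sub>F w in at z. F w \<noteq> 0)"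

lemma nz_meromorphic_mero: "nz_meromorphic F \<Longrightarrow> F meromorphic_on A"
  unfolding nz_meromorphic_def using meromorphic_on_subset by blast

lemma nz_meromorphic_ev: "nz_meromorphic F \<Longrightarrow> \<forall>\<^sub>F w in at z. F w \<noteq> 0"
  unfolding nz_meromorphic_def by blast

lemma nz_meromorphic_freq: "nz_meromorphic F \<Longrightarrow> \<exists>\<^sub>F w in at z. F w \<noteq> 0"
  using nz_meromorphic_ev by (simp add: eventually_frequently)

text \<open>The identity theorem: a function that vanished near some point would vanish near every
  point, so one germ decides.\<close>

lemma nz_meromorphicI:
  assumes "F meromorphic_on UNIV" "\<exists>\<^sub>F w in at z0. F w \<noteq> 0"
  shows "nz_meromorphic F"
proof -
  have "eventually (\<lambda>z. F z = 0) (cosparse UNIV) \<or> eventually (\<lambda>z. F z \<noteq> 0) (cosparse UNIV)"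
    by (rule meromorphic_imp_constant_or_avoid) (use assms in auto)
  then have "(\<forall>z. \<forall>\<^sub>F w in at z. F w = 0) \<or> (\<forall>z. \<forall>\<^sub>F w in at z. F w \<noteq> 0)"
    by (simp add: eventually_cosparse_open_eq)
  moreover have "\<not> (\<forall>\<^sub>F w in at z0. F w = 0)" using assms(2) by (simp add: frequently_def)
  ultimately show ?thesis using assms(1) unfolding nz_meromorphic_def by blast
qed

lemma nz_meromorphic_mult: "nz_meromorphic F \<Longrightarrow> nz_meromorphic G \<Longrightarrow> nz_meromorphic (\<lambda>z. F z * G z)"
proof -
  assume F: "nz_meromorphic F" "nz_meromorphic G"
  have "\<forall>\<^sub>F w in at z. F w * G w \<noteq> 0" for z
    using nz_meromorphic_ev[OF F(1), of z] nz_meromorphic_ev[OF F(2), of z] by eventually_elim simp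
  then show ?thesis
    using nz_meromorphic_mero[OF F(1)] nz_meromorphic_mero[OF F(2)] unfolding nz_meromorphic_def by (intro conjI allI meromorphic_intros)
qed

lemma nz_meromorphic_inverse: "nz_meromorphic F \<Longrightarrow> nz_meromorphic (\<lambda>z. inverse (F z))"
  unfolding nz_meromorphic_def by (intro conjI meromorphic_intros) auto

lemma nz_meromorphic_divide: "nz_meromorphic F \<Longrightarrow> nz_meromorphic G \<Longrightarrow> nz_meromorphic (\<lambda>z. F z / G z)"
  using nz_meromorphic_mult[OF _ nz_meromorphic_inverse] by (simp add: divide_inverse)

lemma eventually_notin_finite: "finite X \<Longrightarrow> \<forall>\<^sub>F z in at (a::complex). z \<notin> X"
  using islimpt_finite[of X a] by (simp add: islimpt_iff_eventually)

lemma finite_cosparse_exceptions: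
  assumes "eventually P (cosparse (UNIV::complex set))"
  shows "finite {z \<in> cball 0 R. \<not> P z}"
proof -
  have "{z. \<not> P z} sparse_in UNIV" using assms by (simp add: eventually_cosparse)
  then have "finite (cball 0 R \<inter> {z. \<not> P z})"
    by (rule sparse_in_compact_finite[OF sparse_in_subset[OF _ subset_UNIV] compact_cball])
  then show ?thesis by (simp add: Int_def conj_commute)
qed

lemma finite_zorder_nonzero:
  assumes "nz_meromorphic F"
  shows "finite {z \<in> cball 0 R. zorder F z \<noteq> 0}"
proof (rule finite_cosparse_exceptions)
  have "\<forall>\<^sub>\<approx>z\<in>UNIV. \<not> is_pole F z" "\<forall>\<^sub>\<approx>z\<in>UNIV. \<not> isolated_zero F z"
    using meromorphic_on_imp_not_zero_cosparse meromorphic_on_imp_not_pole_cosparse nz_meromorphic_mero[OF assms] by auto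
  then show "\<forall>\<^sub>\<approx>z\<in>UNIV. zorder F z = 0"
    by eventually_elim
      (use not_pole_not_isolated_zero_imp_zorder_eq_0 nz_meromorphic_mero[OF assms] nz_meromorphic_freq[OF assms] in auto)
qed

lemma zorder_linear: "zorder (\<lambda>w. w - a) z = (if z = a then 1 else 0)"
proof (cases "z = a")
  case True
  then show ?thesis by (auto intro!: zorder_eqI[of UNIV _ "\<lambda>_. 1"])
next
  case False
  then show ?thesis by (auto intro!: zorder_eq_0I analytic_intros)
qed

text \<open>Divided by the product over its zeros and poles in the closed disc, F has order zero
  throughout that disc, and the remaining zeros and poles, being locally finite, keep a distance
  from it. Hence h is zero-free on a strictly larger disc, as a logarithm holomorphic up to the
  boundary requires. The finite set X absorbs points where the value of F need not agree with its
  germ.\<close>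

lemma nz_meromorphic_factorization:
  assumes F: "nz_meromorphic F" and "R > 0"
  defines "Z \<equiv> {a \<in> cball 0 R. zorder F a \<noteq> 0}"
  obtains h R' X where "R < R'" "h holomorphic_on ball 0 R'" "\<And>z. z \<in> ball 0 R' \<Longrightarrow> h z \<noteq> 0"
    "finite X" "Z \<subseteq> X"
    "\<And>z. z \<in> ball 0 R' \<Longrightarrow> z \<notin> X \<Longrightarrow> F z = h z * (\<Prod>a\<in>Z. (z - a) powi zorder F a)"
proof -
  have Z: "finite Z" unfolding Z_def by (rule finite_zorder_nonzero[OF F])
  define P where "P = (\<lambda>z. \<Prod>a\<in>Z. (z - a) powi zorder F a)"
  have lin: "(\<lambda>z. z - a) meromorphic_on UNIV" for a by (intro meromorphic_intros)
  have Pm: "P meromorphic_on UNIV" unfolding P_def by (intro meromorphic_intros)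
  have Pn: "P z \<noteq> 0" if "z \<notin> Z" for z using that Z by (auto simp: P_def)
  have Pev: "\<forall>\<^sub>F w in at z. P w \<noteq> 0" for z
  proof -
    have "\<forall>\<^sub>F w in at z. w \<notin> Z" by (rule eventually_notin_finite[OF Z])
    then show ?thesis by eventually_elim (use Pn in auto)
  qed
  have Pnz: "nz_meromorphic P" using Pm Pev by (auto simp: nz_meromorphic_def)
  have zP: "zorder P z = (if z \<in> Z then zorder F z else 0)" for z
  proof -
    have "zorder P z = (\<Sum>a\<in>Z. zorder (\<lambda>z. (z - a) powi zorder F a) z)"
      unfolding P_def by (rule zorder_prod) (use Pev in \<open>auto intro!: meromorphic_intros simp: P_def\<close>)
    also have "\<dots> = (\<Sum>a\<in>Z. if z = a then zorder F a else 0)"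
    proof (rule sum.cong)
      fix a
      have "\<forall>\<^sub>F w in at z. w \<noteq> a" by (simp add: eventually_neq_at_within)
      then have "\<exists>\<^sub>F w in at z. w - a \<noteq> 0" by (simp add: eventually_frequently)
      then have "zorder (\<lambda>z. (z - a) powi zorder F a) z = zorder F a * zorder (\<lambda>z. z - a) z"
        by (intro zorder_power_int) (auto intro!: meromorphic_intros)
      then show "zorder (\<lambda>z. (z - a) powi zorder F a) z = (if z = a then zorder F a else 0)"
        by (simp add: zorder_linear)
    qed simp
    finally show ?thesis using Z by simp
  qed
  define G where "G = (\<lambda>z. F z / P z)"
  have G: "nz_meromorphic G" unfolding G_def by (rule nz_meromorphic_divide[OF F Pnz])
  have zG: "zorder G z = zorder F z - zorder P z" for z
    unfolding G_def by (rule zorder_divide) (use F Pnz nz_meromorphic_mero nz_meromorphic_freq in auto)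
  define W where "W = {z \<in> cball 0 (R + 1). zorder G z \<noteq> 0}"
  have W: "finite W" unfolding W_def by (rule finite_zorder_nonzero[OF G])
  have WR: "cmod w > R" if "w \<in> W" for w
    using that by (auto simp: W_def zG zP Z_def not_le[symmetric] split: if_splits)
  \<comment> \<open>W holds the zeros and poles of G up to radius R + 1, all of modulus above R; the
    entry R + 1 covers the case of empty W.\<close>
  define R' where "R' = Min (insert (R + 1) (cmod ` W))"
  have R': "R < R'" "R' \<le> R + 1" using W WR by (auto simp: R'_def)
  have W': "z \<notin> W" if "z \<in> ball 0 R'" for z
    using that W by (auto simp: R'_def)
  define h where "h = remove_sings G"
  have zG0: "zorder G z = 0" if "z \<in> ball 0 R'" for z
    using W'[OF that] that R' by (auto simp: W_def)
  have iso: "isolated_singularity_at G z" "not_essential G z" for z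
    using nz_meromorphic_mero[OF G, of UNIV] by (auto simp: meromorphic_on_altdef)
  have ana: "h analytic_on {z}" if "z \<in> ball 0 R'" for z
  proof -
    have "\<not> is_pole G z" using zG0[OF that] isolated_pole_imp_neg_zorder iso by fastforce
    then obtain c where "G \<midarrow>z\<rightarrow> c" using iso(2) by (auto simp: not_essential_def)
    then show ?thesis unfolding h_def using remove_sings_analytic_at iso by blast
  qed
  have hz: "h z \<noteq> 0" if "z \<in> ball 0 R'" for z
  proof -
    have "zorder h z = 0" unfolding h_def using zG0[OF that] iso by simp
    moreover have "\<exists>\<^sub>F w in at z. h w \<noteq> 0"
    proof -
      have "\<forall>\<^sub>F w in at z. h w \<noteq> 0"
        using eventually_remove_sings_eq_at[OF iso(1)[of z]] nz_meromorphic_ev[OF G, of z]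
        by eventually_elim (auto simp: h_def)
      then show ?thesis by (simp add: eventually_frequently)
    qed
    ultimately show ?thesis using zorder_eq_0_iff[OF ana[OF that]] by simp
  qed
  define X where "X = Z \<union> {z \<in> cball 0 R'. \<not> h z = G z}"
  have X: "finite X"
    unfolding X_def h_def using Z finite_cosparse_exceptions[OF eventually_remove_sings_eq[OF nz_meromorphic_mero[OF G]]]
    by blast
  show ?thesis
  proof (rule that[of R' h X])
    show "h holomorphic_on ball 0 R'" using ana analytic_imp_holomorphic analytic_on_analytic_at by blast
    show "F z = h z * (\<Prod>a\<in>Z. (z - a) powi zorder F a)" if "z \<in> ball 0 R'" "z \<notin> X" for z
      using that Pn[of z] unfolding X_def by (auto simp: G_def P_def)
  qed (use R' hz X in \<open>auto simp: X_def\<close>)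
qed

lemma ln_powi: "x > 0 \<Longrightarrow> ln (x powi k) = of_int k * ln (x::real)"
  using ln_powr[of x "of_int k"] by (simp add: powr_real_of_int')

lemma ln_norm_prod_powi:
  assumes "finite Z" "z \<notin> Z" "h \<noteq> 0"
  shows "ln (cmod (h * (\<Prod>a\<in>Z. (z - a) powi k a))) = ln (cmod h) + (\<Sum>a\<in>Z. of_int (k a) * ln (cmod (z - a)))"
proof -
  have "ln (cmod (h * (\<Prod>a\<in>Z. (z - a) powi k a))) = ln (cmod h) + ln (\<Prod>a\<in>Z. cmod (z - a) powi k a)"
    using assms by (subst norm_mult, subst ln_mult) (auto simp: norm_power_int simp flip: prod_norm)
  also have "ln (\<Prod>a\<in>Z. cmod (z - a) powi k a) = (\<Sum>a\<in>Z. ln (cmod (z - a) powi k a))"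
    using assms by (intro ln_prod) auto
  also have "\<dots> = (\<Sum>a\<in>Z. of_int (k a) * ln (cmod (z - a)))"
    using assms by (intro sum.cong refl ln_powi) auto
  finally show ?thesis .
qed

text \<open>Nevanlinna's N(r) in closed form, for real weights. Signs are allowed, so that a divisor
  of zeros minus poles and inequalities between weights are handled by linearity and
  monotonicity.\<close>

definition log_count :: "(complex \<Rightarrow> real) \<Rightarrow> real \<Rightarrow> real" where
  "log_count w r = (\<Sum>a\<in>{a. a \<noteq> 0 \<and> w a \<noteq> 0 \<and> cmod a \<le> r}. w a * ln (r / cmod a)) + w 0 * ln r"

text \<open>The modulus of the leading Laurent coefficient at the origin, which is the constant in
  Jensen's formula.\<close>

definition leading_modulus :: "(complex \<Rightarrow> complex) \<Rightarrow> real" where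
  "leading_modulus F = Lim (at 0) (\<lambda>z. cmod (F z / z powi zorder F 0))"

text \<open>In the factorization every linear factor has mean \<open>ln R\<close>, its zero lying in
  the closed disc, and the zero-free factor has mean \<open>ln (cmod (h 0))\<close>. Expressing h 0
  through the leading coefficient trades \<open>ln R\<close> for \<open>ln (R / cmod a)\<close>.
  Zeros and poles on the circle are permitted, so no radius is exceptional.\<close>

theorem jensen:
  assumes F: "nz_meromorphic F" and R: "R > 0"
  shows "circle_integrable R (\<lambda>z. ln (cmod (F z)))"
    "circle_mean R (\<lambda>z. ln (cmod (F z))) = log_count (\<lambda>a. of_int (zorder F a)) R + ln (leading_modulus F)"
proof -
  define Z where "Z = {a \<in> cball 0 R. zorder F a \<noteq> 0}"
  define k where "k = zorder F"
  have Z: "finite Z" unfolding Z_def by (rule finite_zorder_nonzero[OF F])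
  obtain h R' X where h: "R < R'" "h holomorphic_on ball 0 R'" "\<And>z. z \<in> ball 0 R' \<Longrightarrow> h z \<noteq> 0"
    "finite X" "Z \<subseteq> X"
    "\<And>z. z \<in> ball 0 R' \<Longrightarrow> z \<notin> X \<Longrightarrow> F z = h z * (\<Prod>a\<in>Z. (z - a) powi k a)"
    by (rule nz_meromorphic_factorization[OF F R, folded Z_def k_def]) (rule that)
  have fact: "ln (cmod (F z)) = ln (cmod (h z)) + (\<Sum>a\<in>Z. of_int (k a) * ln (cmod (z - a)))"
    if "z \<in> ball 0 R'" "z \<notin> X" for z
    using h(6)[OF that] ln_norm_prod_powi[of Z z "h z" k] h(3,5) that Z by auto
  note lnh = circle_mean_ln_nonvanishing(1,2)[OF h(2,3) R h(1)]
  note lnd = circle_mean_ln_diff[OF R]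
  have int: "circle_integrable R (\<lambda>z. \<Sum>a\<in>Z. of_int (k a) * ln (cmod (z - a)))"
    by (rule circle_integrable_sum) (use lnd in auto)
  have "circle_mean R (\<lambda>z. \<Sum>a\<in>Z. of_int (k a) * ln (cmod (z - a))) =
      (\<Sum>a\<in>Z. circle_mean R (\<lambda>z. of_int (k a) * ln (cmod (z - a))))"
    by (rule circle_mean_sum) (use lnd in auto)
  then have ms: "circle_mean R (\<lambda>z. \<Sum>a\<in>Z. of_int (k a) * ln (cmod (z - a))) = (\<Sum>a\<in>Z. of_int (k a) * ln (max R (cmod a)))"
    by (simp only: circle_mean_cmult lnd)
  have sph: "z \<in> ball 0 R'" if "cmod z = R" for z using that h(1) by auto
  show "circle_integrable R (\<lambda>z. ln (cmod (F z)))"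
    by (rule circle_integrable_spike[OF circle_integrable_add[OF lnh(2) int] R h(4)]) (use fact sph in auto)
  have "circle_mean R (\<lambda>z. ln (cmod (F z))) = circle_mean R (\<lambda>z. ln (cmod (h z)) + (\<Sum>a\<in>Z. of_int (k a) * ln (cmod (z - a))))"
    by (rule circle_mean_spike[OF R h(4)]) (use fact sph in auto)
  also have "\<dots> = ln (cmod (h 0)) + (\<Sum>a\<in>Z. of_int (k a) * ln (max R (cmod a)))"
    using circle_mean_add[OF lnh(2) int] lnh(1) ms by simp
  also have "(\<Sum>a\<in>Z. of_int (k a) * ln (max R (cmod a))) = (\<Sum>a\<in>Z. of_int (k a) * ln R)"
    by (rule sum.cong) (auto simp: Z_def max_def)
  finally have 1: "circle_mean R (\<lambda>z. ln (cmod (F z))) = ln (cmod (h 0)) + (\<Sum>a\<in>Z. of_int (k a) * ln R)" .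

  have lim: "((\<lambda>z. cmod (F z / z powi k 0)) \<longlongrightarrow> cmod (h 0 * (\<Prod>a\<in>Z-{0}. (0 - a) powi k a))) (at 0)"
  proof (rule tendsto_norm, rule Lim_transform_eventually)
    have "isCont h 0" using h(1,2) R
      by (metis centre_in_ball continuous_on_eq_continuous_at dual_order.strict_trans holomorphic_on_imp_continuous_on open_ball)
    then have h0: "(h \<longlongrightarrow> h 0) (at 0)" by (simp add: isCont_def)
    show "((\<lambda>z. h z * (\<Prod>a\<in>Z-{0}. (z - a) powi k a)) \<longlongrightarrow> h 0 * (\<Prod>a\<in>Z-{0}. (0 - a) powi k a)) (at 0)"
      by (intro tendsto_intros h0) auto
    have "\<forall>\<^sub>F z in at 0. z \<notin> X" by (rule eventually_notin_finite[OF h(4)])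
    moreover have "\<forall>\<^sub>F z in at 0. z \<in> ball 0 R' - {0}" using h(1) R by (intro eventually_at_in_open) auto
    ultimately show "\<forall>\<^sub>F z in at 0. h z * (\<Prod>a\<in>Z-{0}. (z - a) powi k a) = F z / z powi k 0"
    proof eventually_elim
      case (elim z)
      have "(\<Prod>a\<in>Z. (z - a) powi k a) = z powi k 0 * (\<Prod>a\<in>Z-{0}. (z - a) powi k a)"
      proof (cases "0 \<in> Z")
        case True
        then show ?thesis using prod.remove[OF Z True, of "\<lambda>a. (z - a) powi k a"] by simp
      next
        case False
        then show ?thesis using R by (simp add: Z_def k_def)
      qed
      then show ?case using h(6)[of z] elim by simp
    qed
  qed
  have "leading_modulus F = cmod (h 0 * (\<Prod>a\<in>Z-{0}. (0 - a) powi k a))"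
    unfolding leading_modulus_def using tendsto_Lim[OF _ lim] by (simp add: k_def)
  then have 2: "ln (leading_modulus F) = ln (cmod (h 0)) + (\<Sum>a\<in>Z-{0}. of_int (k a) * ln (cmod a))"
    using ln_norm_prod_powi[of "Z-{0}" 0 "h 0" k] h(1,3) R Z by simp
  have set: "{a. a \<noteq> 0 \<and> real_of_int (k a) \<noteq> 0 \<and> cmod a \<le> R} = Z - {0}"
    by (auto simp: Z_def k_def)
  have "log_count (\<lambda>a. of_int (k a)) R = (\<Sum>a\<in>Z-{0}. of_int (k a) * ln (R / cmod a)) + of_int (k 0) * ln R"
    unfolding log_count_def set ..
  also have "(\<Sum>a\<in>Z-{0}. of_int (k a) * ln (R / cmod a)) =
     (\<Sum>a\<in>Z-{0}. of_int (k a) * ln R - of_int (k a) * ln (cmod a))"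
    using R by (intro sum.cong) (auto simp: ln_div algebra_simps)
  also have "\<dots> = (\<Sum>a\<in>Z-{0}. of_int (k a) * ln R) - (\<Sum>a\<in>Z-{0}. of_int (k a) * ln (cmod a))"
    by (rule sum_subtractf)
  also have "\<dots> + of_int (k 0) * ln R = (\<Sum>a\<in>Z. of_int (k a) * ln R) - (\<Sum>a\<in>Z-{0}. of_int (k a) * ln (cmod a))"
  proof (cases "0 \<in> Z")
    case True
    then show ?thesis using sum.remove[OF Z True, of "\<lambda>a. of_int (k a) * ln R"] by simp
  next
    case False
    then show ?thesis using R by (simp add: Z_def k_def)
  qed
  finally show "circle_mean R (\<lambda>z. ln (cmod (F z))) = log_count (\<lambda>a. of_int (zorder F a)) R + ln (leading_modulus F)"
    using 1 2 by (simp add: k_def)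
qed

subsection \<open>Integrated counting functions\<close>

text \<open>At a pole of g the order of g - b is negative and is clipped to 0. Poles thus drop out
  of the finite values without the explicit exclusion made in \<open>value_points\<close>, and the
  weight depends on germs alone.\<close>

definition value_weight :: "(complex \<Rightarrow> complex) \<Rightarrow> ext_complex \<Rightarrow> complex \<Rightarrow> real" where
  "value_weight g a z = (case a of Some b \<Rightarrow> real (nat (zorder (\<lambda>w. g w - b) z)) | None \<Rightarrow> real (nat (- zorder g z)))"

text \<open>Guards against the default value 0 of a sum over an infinite set, which would destroy
  the additivity of \<open>log_count\<close>.\<close>

definition locally_finite_supp :: "(complex \<Rightarrow> real) \<Rightarrow> bool" where
  "locally_finite_supp w \<longleftrightarrow> (\<forall>r. finite {z \<in> cball 0 r. w z \<noteq> 0})"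

lemma log_count_zero [simp]: "log_count (\<lambda>_. 0) r = 0" by (simp add: log_count_def)
lemma locally_finite_supp_zero [simp]: "locally_finite_supp (\<lambda>_. 0)" by (simp add: locally_finite_supp_def)

lemma locally_finite_supp_zorder: "nz_meromorphic F \<Longrightarrow> f 0 = 0 \<Longrightarrow> locally_finite_supp (\<lambda>z. f (zorder F z))"
  unfolding locally_finite_supp_def
  by (auto intro!: finite_subset[OF _ finite_zorder_nonzero[of F]])

lemma log_count_alt:
  assumes "finite B" "{a. a \<noteq> 0 \<and> w a \<noteq> 0 \<and> cmod a \<le> r} \<subseteq> B" "\<And>a. a \<in> B \<Longrightarrow> a \<noteq> 0 \<and> cmod a \<le> r"
  shows "log_count w r = (\<Sum>a\<in>B. w a * ln (r / cmod a)) + w 0 * ln r"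
  unfolding log_count_def using assms by (auto intro!: sum.mono_neutral_left)

lemma log_count_split:
  assumes "locally_finite_supp w" "locally_finite_supp v"
  obtains B where "finite B" "\<And>a. a \<in> B \<Longrightarrow> a \<noteq> 0 \<and> cmod a \<le> r"
    "log_count w r = (\<Sum>a\<in>B. w a * ln (r / cmod a)) + w 0 * ln r"
    "log_count v r = (\<Sum>a\<in>B. v a * ln (r / cmod a)) + v 0 * ln r"
    "B = {z \<in> cball 0 r. w z \<noteq> 0 \<or> v z \<noteq> 0} - {0}"
proof -
  define B where "B = {z \<in> cball 0 r. w z \<noteq> 0 \<or> v z \<noteq> 0} - {0}"
  have "finite ({z \<in> cball 0 r. w z \<noteq> 0} \<union> {z \<in> cball 0 r. v z \<noteq> 0})"
    using assms unfolding locally_finite_supp_def by blast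
  then have "finite B" by (rule finite_subset[rotated]) (auto simp: B_def)
  then have B: "finite B" "\<And>a. a \<in> B \<Longrightarrow> a \<noteq> 0 \<and> cmod a \<le> r"
    "{a. a \<noteq> 0 \<and> w a \<noteq> 0 \<and> cmod a \<le> r} \<subseteq> B" "{a. a \<noteq> 0 \<and> v a \<noteq> 0 \<and> cmod a \<le> r} \<subseteq> B"
    by (auto simp: B_def)
  show ?thesis
    by (rule that[OF B(1,2) log_count_alt[OF B(1,3,2)] log_count_alt[OF B(1,4,2)] B_def])
qed

lemma locally_finite_supp_add: "locally_finite_supp w \<Longrightarrow> locally_finite_supp v \<Longrightarrow> locally_finite_supp (\<lambda>z. w z + v z)"
  unfolding locally_finite_supp_def
proof
  fix r assume "\<forall>r. finite {z \<in> cball 0 r. w z \<noteq> 0}" "\<forall>r. finite {z \<in> cball 0 r. v z \<noteq> 0}"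
  then have "finite ({z \<in> cball 0 r. w z \<noteq> 0} \<union> {z \<in> cball 0 r. v z \<noteq> 0})" by blast
  then show "finite {z \<in> cball 0 r. w z + v z \<noteq> 0}" by (rule finite_subset[rotated]) auto
qed

lemma locally_finite_supp_uminus: "locally_finite_supp w \<Longrightarrow> locally_finite_supp (\<lambda>z. - w z)"
  unfolding locally_finite_supp_def by simp

lemma locally_finite_supp_diff: "locally_finite_supp w \<Longrightarrow> locally_finite_supp v \<Longrightarrow> locally_finite_supp (\<lambda>z. w z - v z)"
  using locally_finite_supp_add[OF _ locally_finite_supp_uminus] by simp

lemma locally_finite_supp_sum: "(\<And>i. i \<in> I \<Longrightarrow> locally_finite_supp (w i)) \<Longrightarrow> locally_finite_supp (\<lambda>z. \<Sum>i\<in>I. w i z)"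
  by (induction I rule: infinite_finite_induct) (auto simp: locally_finite_supp_add)

lemma log_count_add: assumes "locally_finite_supp w" "locally_finite_supp v" shows "log_count (\<lambda>z. w z + v z) r = log_count w r + log_count v r"
proof -
  obtain B where B: "finite B" "\<And>a. a \<in> B \<Longrightarrow> a \<noteq> 0 \<and> cmod a \<le> r"
    "log_count w r = (\<Sum>a\<in>B. w a * ln (r / cmod a)) + w 0 * ln r"
    "log_count v r = (\<Sum>a\<in>B. v a * ln (r / cmod a)) + v 0 * ln r"
    "B = {z \<in> cball 0 r. w z \<noteq> 0 \<or> v z \<noteq> 0} - {0}"
    by (rule log_count_split[OF assms, where r=r]) (rule that)
  have sub: "{a. a \<noteq> 0 \<and> w a + v a \<noteq> 0 \<and> cmod a \<le> r} \<subseteq> B" unfolding B(5) by auto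
  have "log_count (\<lambda>z. w z + v z) r = (\<Sum>a\<in>B. (w a + v a) * ln (r / cmod a)) + (w 0 + v 0) * ln r"
    by (rule log_count_alt[OF B(1) sub B(2)])
  then show ?thesis using B(3,4) by (simp add: algebra_simps sum.distrib)
qed

lemma log_count_uminus: "log_count (\<lambda>z. - w z) r = - log_count w r"
  unfolding log_count_def by (simp add: sum_negf)

lemma log_count_diff: "locally_finite_supp w \<Longrightarrow> locally_finite_supp v \<Longrightarrow> log_count (\<lambda>z. w z - v z) r = log_count w r - log_count v r"
  using log_count_add[of w "\<lambda>z. - v z" r] by (simp add: locally_finite_supp_uminus log_count_uminus)

lemma log_count_sum: "(\<And>i. i \<in> I \<Longrightarrow> locally_finite_supp (w i)) \<Longrightarrow> log_count (\<lambda>z. \<Sum>i\<in>I. w i z) r = (\<Sum>i\<in>I. log_count (w i) r)"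
  by (induction I rule: infinite_finite_induct) (auto simp: log_count_add locally_finite_supp_sum)

lemma log_count_mono:
  assumes "locally_finite_supp w" "locally_finite_supp v" "r \<ge> 1" "\<And>z. w z \<le> v z"
  shows "log_count w r \<le> log_count v r"
proof -
  obtain B where B: "finite B" "\<And>a. a \<in> B \<Longrightarrow> a \<noteq> 0 \<and> cmod a \<le> r"
    "log_count w r = (\<Sum>a\<in>B. w a * ln (r / cmod a)) + w 0 * ln r"
    "log_count v r = (\<Sum>a\<in>B. v a * ln (r / cmod a)) + v 0 * ln r"
    "B = {z \<in> cball 0 r. w z \<noteq> 0 \<or> v z \<noteq> 0} - {0}"
    by (rule log_count_split[OF assms(1,2), where r=r]) (rule that)
  have "(\<Sum>a\<in>B. w a * ln (r / cmod a)) \<le> (\<Sum>a\<in>B. v a * ln (r / cmod a))"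
  proof (intro sum_mono mult_right_mono)
    fix a assume "a \<in> B"
    then have "a \<noteq> 0" "cmod a \<le> r" using B(2) by auto
    then show "0 \<le> ln (r / cmod a)" by simp
  qed (rule assms(4))
  \<comment> \<open>The origin is weighted with \<open>ln r\<close>, which is nonnegative only from
    r = 1 on.\<close>
  moreover have "w 0 * ln r \<le> v 0 * ln r" using assms by (intro mult_right_mono) auto
  ultimately show ?thesis using B(3,4) by simp
qed

lemma log_count_nonneg: "locally_finite_supp w \<Longrightarrow> r \<ge> 1 \<Longrightarrow> (\<And>z. 0 \<le> w z) \<Longrightarrow> 0 \<le> log_count w r"
  using log_count_mono[of "\<lambda>_. 0" w r] by simp

text \<open>Interchange the finite sum with the integral: a point z off the origin contributes u z
  times the integral of 1/t from \<open>cmod z\<close> to r. Subtracting n 0 removes the origin,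
  which returns in the term with \<open>ln r\<close>.\<close>

lemma integrated_count_eq_log_count:
  fixes u :: "complex \<Rightarrow> nat"
  assumes fin: "\<And>t. finite {z \<in> V. cmod z \<le> t}" and "r > 0"
  shows "integrated_count (\<lambda>t. \<Sum>z\<in>{z \<in> V. cmod z \<le> t}. u z) r = log_count (\<lambda>z. if z \<in> V then real (u z) else 0) r"
proof -
  define n where "n = (\<lambda>t. \<Sum>z\<in>{z \<in> V. cmod z \<le> t}. u z)"
  define B where "B = {z \<in> V. cmod z \<le> r} - {0}"
  have B: "finite B" using fin by (simp add: B_def)
  have n0: "real (n 0) = (if 0 \<in> V then real (u 0) else 0)"
  proof -
    have "{z \<in> V. cmod z \<le> 0} = (if 0 \<in> V then {0} else {})" by auto
    then show ?thesis by (simp add: n_def)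
  qed
  have diff: "real (n t) - real (n 0) = (\<Sum>z\<in>B. if cmod z \<le> t then real (u z) else 0)" if "t \<in> {0..r}" for t
  proof -
    have "real (n t) = (\<Sum>z\<in>{z \<in> V. cmod z \<le> t}. real (u z))" by (simp add: n_def)
    also have "\<dots> = (\<Sum>z\<in>{z \<in> V. cmod z \<le> t} - {0}. real (u z)) + real (n 0)"
    proof (cases "0 \<in> V")
      case True
      then show ?thesis using that fin by (subst sum.remove[of _ 0]) (auto simp: n0)
    next
      case False
      then have "{z \<in> V. cmod z \<le> t} - {0} = {z \<in> V. cmod z \<le> t}" by auto
      then show ?thesis using False by (simp add: n0)
    qed
    also have "(\<Sum>z\<in>{z \<in> V. cmod z \<le> t} - {0}. real (u z)) = (\<Sum>z\<in>B. if cmod z \<le> t then real (u z) else 0)"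
      using B that by (subst sum.inter_filter[symmetric]) (auto simp: B_def intro!: sum.cong)
    finally show ?thesis by simp
  qed
  have one: "((\<lambda>t. if t \<in> {cmod z..r} then real (u z) / t else 0) has_integral (real (u z) * ln (r / cmod z))) {0..r}"
    if "z \<in> B" for z
  proof -
    have z: "0 < cmod z" "cmod z \<le> r" using that by (auto simp: B_def)
    have "((\<lambda>t. real (u z) / t) has_integral (real (u z) * ln r - real (u z) * ln (cmod z))) {cmod z..r}"
    proof (rule fundamental_theorem_of_calculus)
      show "((\<lambda>t. real (u z) * ln t) has_vector_derivative real (u z) / t) (at t within {cmod z..r})"
        if "t \<in> {cmod z..r}" for t
      proof -
        have "t > 0" using that z(1) unfolding atLeastAtMost_iff by linarith
        then have "((\<lambda>t. real (u z) * ln t) has_real_derivative real (u z) / t) (at t within {cmod z..r})"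
          by (auto intro!: derivative_eq_intros)
        then show ?thesis by (simp add: has_real_derivative_iff_has_vector_derivative)
      qed
    qed (use z in auto)
    then have "((\<lambda>t. real (u z) / t) has_integral (real (u z) * ln (r / cmod z))) {cmod z..r}"
      using z by (simp add: ln_div algebra_simps)
    then show ?thesis by (subst has_integral_restrict) auto
  qed
  have "((\<lambda>t. \<Sum>z\<in>B. if t \<in> {cmod z..r} then real (u z) / t else 0) has_integral (\<Sum>z\<in>B. real (u z) * ln (r / cmod z))) {0..r}"
    by (rule has_integral_sum[OF B one])
  then have "((\<lambda>t. (real (n t) - real (n 0)) / t) has_integral (\<Sum>z\<in>B. real (u z) * ln (r / cmod z))) {0..r}"
  proof (rule has_integral_eq[rotated])
    fix t assume t: "t \<in> {0..r}"
    show "(\<Sum>z\<in>B. if t \<in> {cmod z..r} then real (u z) / t else 0) = (real (n t) - real (n 0)) / t"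
      unfolding diff[OF t] sum_divide_distrib using t by (intro sum.cong) auto
  qed
  then have "integrated_count n r = (\<Sum>z\<in>B. real (u z) * ln (r / cmod z)) + real (n 0) * ln r"
    unfolding integrated_count_def by (simp add: integral_unique)
  also have "\<dots> = log_count (\<lambda>z. if z \<in> V then real (u z) else 0) r"
    by (subst log_count_alt[OF B]) (auto simp: B_def n0 split: if_splits intro!: sum.cong)
  finally show ?thesis by (simp add: n_def)
qed

section \<open>The positive logarithm and proximity functions\<close>

lemma ln_plus_nonneg: "0 \<le> ln_plus x" by (simp add: ln_plus_def)
lemma ln_le_ln_plus: "ln x \<le> ln_plus x" by (simp add: ln_plus_def)

lemma ln_plus_mono: "0 \<le> x \<Longrightarrow> x \<le> y \<Longrightarrow> ln_plus x \<le> ln_plus y"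
  unfolding ln_plus_def using ln_mono[of x y] by (cases "x = 0") (auto simp: max_def)

lemma ln_plus_mult: "0 \<le> x \<Longrightarrow> 0 \<le> y \<Longrightarrow> ln_plus (x * y) \<le> ln_plus x + ln_plus y"
  by (cases "x = 0 \<or> y = 0") (auto simp: ln_plus_def ln_mult)

lemma ln_plus_add: "0 \<le> x \<Longrightarrow> 0 \<le> y \<Longrightarrow> ln_plus (x + y) \<le> ln_plus x + ln_plus y + ln 2"
proof -
  assume x: "0 \<le> x" "0 \<le> y"
  have "ln_plus (x + y) \<le> ln_plus (2 * max x y)" using x by (intro ln_plus_mono) auto
  also have "\<dots> \<le> ln_plus 2 + ln_plus (max x y)" using x by (intro ln_plus_mult) auto
  also have "ln_plus (max x y) \<le> ln_plus x + ln_plus y"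
    using ln_plus_nonneg by (auto simp: max_def add_increasing add_increasing2)
  finally show ?thesis by (simp add: ln_plus_def)
qed

text \<open>True even at x = 0, where \<open>inverse 0 = 0\<close> and \<open>ln 0 = 0\<close>;
  Jensen's formula therefore passes to proximity functions without exceptional points.\<close>

lemma ln_plus_diff_inverse: "0 \<le> x \<Longrightarrow> ln_plus x - ln_plus (inverse x) = ln x"
  by (cases "x = 0") (auto simp: ln_plus_def ln_inverse max_def)

lemma circle_integrable_ln_plus: "nz_meromorphic F \<Longrightarrow> r > 0 \<Longrightarrow> circle_integrable r (\<lambda>z. ln_plus (cmod (F z)))"
  unfolding ln_plus_def using jensen(1) by auto

lemma proximity_eq: "proximity F r = circle_mean r (\<lambda>z. ln_plus (cmod (F z)))"
  by (simp add: proximity_def circle_mean_def)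

lemma proximity_nonneg: "0 \<le> proximity F r"
  unfolding proximity_eq by (intro circle_mean_nonneg ln_plus_nonneg)

lemma jensen_proximity:
  assumes "nz_meromorphic F" "r > 0"
  shows "proximity F r - proximity (\<lambda>z. inverse (F z)) r = log_count (\<lambda>a. of_int (zorder F a)) r + ln (leading_modulus F)"
proof -
  have "proximity F r - proximity (\<lambda>z. inverse (F z)) r =
     circle_mean r (\<lambda>z. ln_plus (cmod (F z)) - ln_plus (cmod (inverse (F z))))"
    unfolding proximity_eq
    by (rule circle_mean_diff[symmetric]) (intro circle_integrable_ln_plus assms nz_meromorphic_inverse)+
  also have "(\<lambda>z. ln_plus (cmod (F z)) - ln_plus (cmod (inverse (F z)))) = (\<lambda>z. ln (cmod (F z)))"
    by (simp add: norm_inverse ln_plus_diff_inverse)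
  finally show ?thesis using jensen(2)[OF assms] by simp
qed

section \<open>Counting functions of a nonconstant meromorphic function as weighted sums\<close>

locale nonconst_mero =
  fixes g :: "complex \<Rightarrow> complex"
  assumes nice: "g nicely_meromorphic_on UNIV" and nconst: "\<not> g constant_on UNIV"
begin

lemma mero: "g meromorphic_on A"
  using nice meromorphic_on_subset unfolding nicely_meromorphic_on_def by blast

lemma nz_diff: "nz_meromorphic (\<lambda>z. g z - a)"
proof -
  have "\<not> (\<forall>x\<in>UNIV. g x = a)" using nconst unfolding constant_on_def by auto
  then have "\<forall>\<^sub>\<approx>x\<in>UNIV. g x \<noteq> a" using nicely_meromorphic_imp_constant_or_avoid[OF nice, of a] by auto
  then have "\<forall>z. \<forall>\<^sub>F w in at z. g w - a \<noteq> 0" by (simp add: eventually_cosparse_open_eq)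
  then show ?thesis using mero unfolding nz_meromorphic_def by (auto intro!: meromorphic_intros)
qed

lemma nz: "nz_meromorphic g" using nz_diff[of 0] by simp

lemma pole_iff: "is_pole g z \<longleftrightarrow> zorder g z < 0"
  using isolated_pole_imp_neg_zorder[of g z] zorder_neg_imp_is_pole[OF mero nz_meromorphic_ev[OF nz]] mero[of UNIV]
  by (auto simp: meromorphic_on_altdef)

lemma zorder_diff_pole: "zorder g z < 0 \<Longrightarrow> zorder (\<lambda>w. g w - a) z = zorder g z"
proof (cases "a = 0")
  case False
  assume "zorder g z < 0"
  then show ?thesis using False
    by (intro zorder_diff1) (auto intro!: mero nz_meromorphic_freq nz)
qed simp

lemma analytic: "\<not> is_pole g z \<Longrightarrow> g analytic_on {z}"
  using nicely_meromorphic_on_imp_analytic_at[OF nice] by auto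

lemma zorder_diff_nonpole:
  assumes "\<not> is_pole g z"
  shows "zorder (\<lambda>w. g w - a) z \<ge> 0" "zorder (\<lambda>w. g w - a) z > 0 \<longleftrightarrow> g z = a"
proof -
  have "(\<lambda>w. g w - a) analytic_on {z}" by (intro analytic_intros analytic[OF assms])
  then show "zorder (\<lambda>w. g w - a) z \<ge> 0" "zorder (\<lambda>w. g w - a) z > 0 \<longleftrightarrow> g z = a"
    using zorder_ge_0 zorder_pos_iff'[of "\<lambda>w. g w - a" z] nz_meromorphic_freq[OF nz_diff] by auto
qed

lemma zorder_diff_neg_iff: "zorder (\<lambda>w. g w - a) z < 0 \<longleftrightarrow> is_pole g z"
  using zorder_diff_pole[of z a] zorder_diff_nonpole(1)[of z a] pole_iff by force

lemma value_mult_eq: "z \<in> value_points g a \<Longrightarrow> real (value_mult g a z) = value_weight g a z"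
  by (cases a) (auto simp: value_weight_def zero_mult_def pole_mult_def)

lemma value_weight_nonzero_iff: "value_weight g a z \<noteq> 0 \<longleftrightarrow> z \<in> value_points g a"
proof (cases a)
  case None
  then show ?thesis by (simp add: value_weight_def pole_iff not_le)
next
  case (Some b)
  have "value_weight g a z \<noteq> 0 \<longleftrightarrow> zorder (\<lambda>w. g w - b) z > 0" by (simp add: value_weight_def Some not_le)
  also have "\<dots> \<longleftrightarrow> z \<in> value_points g a"
  proof (cases "is_pole g z")
    case True
    then have "zorder (\<lambda>w. g w - b) z < 0" by (simp only: zorder_diff_neg_iff)
    then show ?thesis using True by (simp add: Some)
  next
    case False
    then show ?thesis using zorder_diff_nonpole(2)[OF False, of b] by (simp add: Some)
  qed
  finally show ?thesis .
qed

lemma value_weight_nonneg: "0 \<le> value_weight g a z" by (cases a) (auto simp: value_weight_def)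

lemma locally_finite_supp_value_weight: "locally_finite_supp (value_weight g a)"
proof (cases a)
  case None
  then show ?thesis using locally_finite_supp_zorder[OF nz, of "\<lambda>k. real (nat (- k))"] by (simp add: value_weight_def[abs_def])
next
  case (Some b)
  then show ?thesis using locally_finite_supp_zorder[OF nz_diff, of "\<lambda>k. real (nat k)"] by (simp add: value_weight_def[abs_def])
qed

lemma finite_value_points: "finite {z \<in> value_points g a. cmod z \<le> t}"
proof -
  have "{z \<in> value_points g a. cmod z \<le> t} = {z \<in> cball 0 t. value_weight g a z \<noteq> 0}"
    by (auto simp: value_weight_nonzero_iff)
  then show ?thesis using locally_finite_supp_value_weight unfolding locally_finite_supp_def by simp
qed

lemma count_N_eq: "r > 0 \<Longrightarrow> count_N g a r = log_count (value_weight g a) r"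
proof -
  assume "r > 0"
  have "(\<lambda>z. if z \<in> value_points g a then real (value_mult g a z) else 0) = value_weight g a"
  proof
    fix z
    show "(if z \<in> value_points g a then real (value_mult g a z) else 0) = value_weight g a z"
      using value_weight_nonzero_iff[of a z] by (auto simp: value_mult_eq)
  qed
  then show ?thesis
    unfolding count_N_def count_n_def[abs_def]
    using integrated_count_eq_log_count[OF finite_value_points \<open>r > 0\<close>, of "value_mult g a" a] by simp
qed

definition hahn_weight :: "complex \<Rightarrow> complex \<Rightarrow> ext_complex \<Rightarrow> complex \<Rightarrow> real" where
  "hahn_weight q c a z = value_weight g a z - min (value_weight g a z) (real (hahn_mult q c g a z))"

lemma hahn_weight_bounds: "0 \<le> hahn_weight q c a z" "hahn_weight q c a z \<le> value_weight g a z"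
  using value_weight_nonneg[of a z] by (auto simp: hahn_weight_def)

lemma locally_finite_supp_hahn_weight: "locally_finite_supp (hahn_weight q c a)"
  unfolding locally_finite_supp_def
proof
  fix r
  have "{z \<in> cball 0 r. hahn_weight q c a z \<noteq> 0} \<subseteq> {z \<in> cball 0 r. value_weight g a z \<noteq> 0}"
    by (auto simp: hahn_weight_def)
  then show "finite {z \<in> cball 0 r. hahn_weight q c a z \<noteq> 0}"
    using locally_finite_supp_value_weight[of a] unfolding locally_finite_supp_def by (meson finite_subset)
qed

lemma hahn_count_N_eq: "r > 0 \<Longrightarrow> hahn_count_N q c g a r = log_count (hahn_weight q c a) r"
proof -
  assume "r > 0"
  have "(\<lambda>z. if z \<in> value_points g a then
        real (value_mult g a z - min (value_mult g a z) (hahn_mult q c g a z)) else 0) = hahn_weight q c a"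
  proof
    fix z
    show "(if z \<in> value_points g a then
        real (value_mult g a z - min (value_mult g a z) (hahn_mult q c g a z)) else 0) = hahn_weight q c a z"
    proof (cases "z \<in> value_points g a")
      case True
      then show ?thesis
        by (simp add: hahn_weight_def value_mult_eq[symmetric] of_nat_diff of_nat_min)
    next
      case False
      then show ?thesis using value_weight_nonzero_iff[of a z] by (simp add: hahn_weight_def)
    qed
  qed
  then show ?thesis
    unfolding hahn_count_N_def hahn_count_n_def[abs_def]
    using integrated_count_eq_log_count[OF finite_value_points \<open>r > 0\<close>,
        of "\<lambda>z. value_mult g a z - min (value_mult g a z) (hahn_mult q c g a z)" a] by simp
qed

lemma count_N_nonneg: "r \<ge> 1 \<Longrightarrow> 0 \<le> count_N g a r"
  using log_count_nonneg[OF locally_finite_supp_value_weight _ value_weight_nonneg] by (simp add: count_N_eq)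

lemma hahn_count_N_bounds:
  assumes "r \<ge> 1"
  shows "0 \<le> hahn_count_N q c g a r" "hahn_count_N q c g a r \<le> count_N g a r"
  using log_count_nonneg[OF locally_finite_supp_hahn_weight assms hahn_weight_bounds(1)] log_count_mono[OF locally_finite_supp_hahn_weight locally_finite_supp_value_weight assms hahn_weight_bounds(2)] assms
  by (auto simp: count_N_eq hahn_count_N_eq)

subsection \<open>The first main theorem\<close>

lemma proximity_shift:
  assumes "r > 0"
  shows "\<bar>proximity (\<lambda>z. g z - a) r - proximity g r\<bar> \<le> ln_plus (cmod a) + ln 2"
proof -
  have i: "circle_integrable r (\<lambda>z. ln_plus (cmod (g z - a)))" "circle_integrable r (\<lambda>z. ln_plus (cmod (g z)))"
    using circle_integrable_ln_plus[OF nz_diff assms] circle_integrable_ln_plus[OF nz assms] by auto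
  have 1: "ln_plus (cmod (g z - a)) \<le> ln_plus (cmod (g z)) + (ln_plus (cmod a) + ln 2)" for z
    using ln_plus_mono[OF _ norm_triangle_ineq4[of "g z" a]] ln_plus_add[of "cmod (g z)" "cmod a"] by auto
  have 2: "ln_plus (cmod (g z)) \<le> ln_plus (cmod (g z - a)) + (ln_plus (cmod a) + ln 2)" for z
    using ln_plus_mono[OF _ norm_triangle_ineq[of "g z - a" a]] ln_plus_add[of "cmod (g z - a)" "cmod a"] by auto
  have "proximity (\<lambda>z. g z - a) r \<le> proximity g r + (ln_plus (cmod a) + ln 2)"
    unfolding proximity_eq using circle_mean_mono[OF i(1) circle_integrable_add[OF i(2) circle_integrable_const] assms, of "{}"] 1
    by (simp add: circle_mean_add[OF i(2) circle_integrable_const])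
  moreover have "proximity g r \<le> proximity (\<lambda>z. g z - a) r + (ln_plus (cmod a) + ln 2)"
    unfolding proximity_eq using circle_mean_mono[OF i(2) circle_integrable_add[OF i(1) circle_integrable_const] assms, of "{}"] 2
    by (simp add: circle_mean_add[OF i(1) circle_integrable_const])
  ultimately show ?thesis by linarith
qed

lemma log_count_zorder_diff:
  "log_count (\<lambda>z. of_int (zorder (\<lambda>w. g w - a) z)) r = log_count (value_weight g (Some a)) r - log_count (value_weight g None) r"
proof -
  have "(\<lambda>z. of_int (zorder (\<lambda>w. g w - a) z)) = (\<lambda>z. value_weight g (Some a) z - value_weight g None z)"
  proof
    fix z
    show "of_int (zorder (\<lambda>w. g w - a) z) = value_weight g (Some a) z - value_weight g None z"
      using zorder_diff_pole[of z a] zorder_diff_neg_iff[of a z] pole_iff[of z]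
      by (cases "is_pole g z") (auto simp: value_weight_def)
  qed
  then show ?thesis by (simp add: log_count_diff locally_finite_supp_value_weight)
qed

text \<open>Jensen's formula for g - a, whose poles have the same orders as those of g; passing from
  the proximity function of g - a to that of g costs at most
  \<open>ln_plus (cmod a) + ln 2\<close>.\<close>

theorem first_main:
  obtains C where "\<And>r. r > 0 \<Longrightarrow> \<bar>proximity (\<lambda>z. inverse (g z - a)) r + count_N g (Some a) r - nev_char g r\<bar> \<le> C"
proof -
  have "\<bar>proximity (\<lambda>z. inverse (g z - a)) r + count_N g (Some a) r - nev_char g r\<bar>
      \<le> ln_plus (cmod a) + ln 2 + \<bar>ln (leading_modulus (\<lambda>w. g w - a))\<bar>" if r: "r > 0" for r
    using jensen_proximity[OF nz_diff r, of a] proximity_shift[OF r, of a] log_count_zorder_diff[of a r]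
      count_N_eq[OF r, of "Some a"] count_N_eq[OF r, of None]
    unfolding nev_char_def by linarith
  then show ?thesis using that by blast
qed

lemma nev_char_nonneg: "r \<ge> 1 \<Longrightarrow> 0 \<le> nev_char g r"
  unfolding nev_char_def using proximity_nonneg count_N_nonneg by (simp add: add_nonneg_nonneg)

text \<open>One attained value a = g z1 suffices: the point z1 alone contributes \<open>ln r\<close>
  up to a constant to N(r, g = a), and the first main theorem passes this on to T. Bounded errors
  can therefore be absorbed into \<epsilon> T later.\<close>

lemma nev_char_at_top: "filterlim (nev_char g) at_top at_top"
proof -
  obtain z1 where z1: "\<not> is_pole g z1"
  proof -
    have "\<forall>\<^sub>F z in at 0. \<not> is_pole g z"
      using meromorphic_on_imp_not_pole_cosparse[OF mero, of UNIV] by (simp add: eventually_cosparse_open_eq)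
    then show ?thesis using that eventually_happens[of _ "at (0::complex)"] at_neq_bot by blast
  qed
  define a where "a = g z1"
  have w1: "value_weight g (Some a) z1 \<ge> 1"
    using value_weight_nonzero_iff[of "Some a" z1] z1 by (auto simp: a_def value_weight_def)
  obtain C where C: "\<And>r. r > 0 \<Longrightarrow> \<bar>proximity (\<lambda>z. inverse (g z - a)) r + count_N g (Some a) r - nev_char g r\<bar> \<le> C"
    using first_main by blast
  define v where "v = (\<lambda>z. if z = z1 then 1 else 0 :: real)"
  have lv: "locally_finite_supp v" unfolding locally_finite_supp_def v_def by auto
  \<comment> \<open>The origin contributes \<open>ln r\<close> in place of
    \<open>ln (r / cmod z1)\<close>.\<close>
  define d where "d = (if z1 = 0 then 1 else cmod z1)"
  have d: "d > 0" by (simp add: d_def)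
  have lower: "ln (r / d) - C \<le> nev_char g r" if r: "r \<ge> max 1 (cmod z1)" for r
  proof -
    have "log_count v r \<le> log_count (value_weight g (Some a)) r"
      by (rule log_count_mono[OF lv locally_finite_supp_value_weight]) (use r w1 value_weight_nonneg in \<open>auto simp: v_def\<close>)
    moreover have "log_count v r = ln (r / d)"
    proof (cases "z1 = 0")
      case False
      have "{a. a \<noteq> 0 \<and> v a \<noteq> 0 \<and> cmod a \<le> r} = {z1}" using False r by (auto simp: v_def)
      then show ?thesis using False by (simp add: log_count_def d_def v_def)
    next
      case True
      have "{a. a \<noteq> 0 \<and> v a \<noteq> 0 \<and> cmod a \<le> r} = {}" using True r by (auto simp: v_def)
      then show ?thesis using True by (simp add: log_count_def d_def v_def)
    qed
    ultimately show ?thesis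
      using C[of r] count_N_eq[of r "Some a"] r proximity_nonneg[of "\<lambda>z. inverse (g z - a)" r] by auto
  qed
  have "filterlim (\<lambda>r. (- ln d - C) + ln r) at_top at_top"
    by (rule filterlim_tendsto_add_at_top[OF tendsto_const ln_at_top])
  then have "filterlim (\<lambda>r. ln (r / d) - C) at_top at_top"
  proof (rule filterlim_at_top_mono)
    show "\<forall>\<^sub>F r in at_top. (- ln d - C) + ln r \<le> ln (r / d) - C"
      using eventually_gt_at_top[of 0] by eventually_elim (use d in \<open>auto simp: ln_div\<close>)
  qed
  then show ?thesis
  proof (rule filterlim_at_top_mono)
    show "\<forall>\<^sub>F r in at_top. ln (r / d) - C \<le> nev_char g r"
      using eventually_ge_at_top[of "max 1 (cmod z1)"] by eventually_elim (use lower in auto)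
  qed
qed

end

subsection \<open>The Schwarz integral and the difference quotient\<close>

text \<open>Cauchy's formula for H at z is added to the conjugate of the mean value formula for
  H(w) R\<open>\<^sup>2\<close>/(R\<open>\<^sup>2\<close> - cnj z w): on the circle both kernels reduce to w/(w - z), up to conjugation.\<close>

lemma schwarz_integral:
  assumes H: "H holomorphic_on cball 0 R" and z: "cmod z < R"
  shows "((\<lambda>t. 2 * of_real (Re (H (of_real R * cis t))) * (of_real R * cis t / (of_real R * cis t - z)))
     has_integral (2 * of_real pi * (H z + cnj (H 0)))) {0..2*pi}"
proof -
  have R: "R > 0" using z by (smt (verit) norm_ge_zero)
  define G where "G = (\<lambda>w. H w * (of_real (R^2) / (of_real (R^2) - cnj z * w)))"
  have nz: "of_real (R^2) - cnj z * w \<noteq> 0" if "cmod w \<le> R" for w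
  proof
    assume "of_real (R^2) - cnj z * w = 0"
    then have "cmod (complex_of_real (R^2)) = cmod (cnj z * w)" by simp
    then have "R^2 = cmod z * cmod w" by (simp add: norm_mult norm_power)
    also have "\<dots> \<le> cmod z * R" using that by (intro mult_left_mono) auto
    also have "\<dots> < R * R" using z R by simp
    finally show False by (simp add: power2_eq_square)
  qed
  have "G holomorphic_on cball 0 R"
    unfolding G_def using nz by (intro holomorphic_intros H) auto
  from cauchy_circle_integral[OF this, of 0] R
  have "((\<lambda>t. G (of_real R * cis t)) has_integral (2 * of_real pi * H 0)) {0..2*pi}"
    by (simp add: G_def)
  from has_integral_cnj[THEN iffD2, OF this]
  have 1: "((\<lambda>t. cnj (G (of_real R * cis t))) has_integral (2 * of_real pi * cnj (H 0))) {0..2*pi}"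
    by (simp add: o_def)
  have eq: "cnj (G w) = cnj (H w) * (w / (w - z))" if "cmod w = R" for w
  proof -
    have ww: "complex_of_real (R^2) = w * cnj w" using that complex_norm_square[of w] by simp
    have w0: "w \<noteq> 0" "w \<noteq> z" using that R z by auto
    have "cnj (G w) = cnj (H w) * ((cnj w * w) / (cnj w * w - z * cnj w))"
      unfolding G_def ww by simp
    also have "(cnj w * w) / (cnj w * w - z * cnj w) = w / (w - z)"
      using w0 by (simp add: field_simps)
    finally show ?thesis .
  qed
  have "((\<lambda>t. H (of_real R * cis t) * (of_real R * cis t) / (of_real R * cis t - z) + cnj (G (of_real R * cis t)))
     has_integral (2 * of_real pi * H z + 2 * of_real pi * cnj (H 0))) {0..2*pi}"
    by (rule has_integral_add[OF cauchy_circle_integral[OF H z] 1])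
  then have "((\<lambda>t. 2 * of_real (Re (H (of_real R * cis t))) * (of_real R * cis t / (of_real R * cis t - z)))
     has_integral (2 * of_real pi * H z + 2 * of_real pi * cnj (H 0))) {0..2*pi}"
  proof (rule has_integral_eq[rotated])
    fix t
    define w where "w = complex_of_real R * cis t"
    have "H w * w / (w - z) + cnj (G w) = (H w + cnj (H w)) * (w / (w - z))"
      using eq[of w] R by (simp add: w_def norm_mult algebra_simps)
    then show "H (of_real R * cis t) * (of_real R * cis t) / (of_real R * cis t - z) + cnj (G (of_real R * cis t))
      = 2 * of_real (Re (H (of_real R * cis t))) * (of_real R * cis t / (of_real R * cis t - z))"
      by (simp add: complex_add_cnj w_def)
  qed
  then show ?thesis by (simp add: distrib_left)
qed

text \<open>In the difference of two Schwarz integrals the constant \<open>cnj (H 0)\<close>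
  cancels, and the kernels differ by w (z1 - z2) / ((w - z1) (w - z2)), of modulus at most 2K/(K -
  1)^2 on the outer circle. The decay like 1/K is the gain from integrating over a distant
  circle.\<close>

lemma holomorphic_diff_bound:
  assumes H: "H holomorphic_on cball 0 (K * r)" and r: "r > 0" "K > 1"
    and z: "cmod z1 \<le> r" "cmod z2 \<le> r"
  shows "cmod (H z1 - H z2) \<le> 4 * K / (K - 1)^2 * circle_mean (K * r) (\<lambda>z. \<bar>Re (H z)\<bar>)"
proof -
  define R where "R = K * r"
  have R: "r < R" using r by (simp add: R_def)
  define w where "w = (\<lambda>t. complex_of_real R * cis t)"
  have H': "H holomorphic_on cball 0 R" using H by (simp add: R_def)
  define D where "D = 4 * K / (K - 1)^2"
  define k where "k = (\<lambda>t. 2 * of_real (Re (H (w t))) * (w t / (w t - z1)) - 2 * of_real (Re (H (w t))) * (w t / (w t - z2)))"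
  have I: "(k has_integral (2 * of_real pi * (H z1 - H z2))) {0..2*pi}"
    using has_integral_diff[OF schwarz_integral[OF H', of z1] schwarz_integral[OF H', of z2]] z R
    by (simp add: k_def w_def algebra_simps)
  have ci: "circle_integrable R (\<lambda>z. \<bar>Re (H z)\<bar>)" using circle_mean_Re_holomorphic(2)[OF H'] R r by auto
  have "cmod (integral {0..2*pi} k) \<le> integral {0..2*pi} (\<lambda>t. D * \<bar>Re (H (w t))\<bar>)"
  proof (rule integral_norm_bound_integral)
    show "k integrable_on {0..2*pi}" using I by blast
    show "(\<lambda>t. D * \<bar>Re (H (w t))\<bar>) integrable_on {0..2*pi}"
      using circle_integrable_imp_integrable[OF circle_integrable_cmult[OF ci, of D]] by (simp add: w_def)
    fix t
    have mw: "cmod (w t) = R" using R r by (simp add: w_def norm_mult)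
    have d: "cmod (w t - z) \<ge> R - r" if "cmod z \<le> r" for z
      using norm_triangle_ineq2[of "w t" z] mw that by linarith
    have nz: "w t - z1 \<noteq> 0" "w t - z2 \<noteq> 0" using d[OF z(1)] d[OF z(2)] R by auto
    have "k t = 2 * of_real (Re (H (w t))) * (w t * (z1 - z2) / ((w t - z1) * (w t - z2)))"
      unfolding k_def using nz by (simp add: field_simps)
    then have "cmod (k t) = 2 * \<bar>Re (H (w t))\<bar> * (R * cmod (z1 - z2) / (cmod (w t - z1) * cmod (w t - z2)))"
      by (simp add: norm_mult norm_divide mw)
    also have "R * cmod (z1 - z2) / (cmod (w t - z1) * cmod (w t - z2)) \<le> R * (2 * r) / ((R - r) * (R - r))"
    proof (intro frac_le mult_left_mono mult_mono d z)
      show "cmod (z1 - z2) \<le> 2 * r" using norm_triangle_ineq4[of z1 z2] z by linarith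
    qed (use R r in auto)
    also have "R * (2 * r) / ((R - r) * (R - r)) = D / 2"
    proof -
      have "R * (2 * r) = (r * r) * (2 * K)" "(R - r) * (R - r) = (r * r) * (K - 1)^2"
        by (simp_all add: R_def power2_eq_square algebra_simps)
      then have "R * (2 * r) / ((R - r) * (R - r)) = (2 * K) / (K - 1)^2"
        using r by simp
      then show ?thesis by (simp add: D_def)
    qed
    finally have "cmod (k t) \<le> 2 * \<bar>Re (H (w t))\<bar> * (D / 2)" by (simp add: mult_left_mono)
    then show "cmod (k t) \<le> D * \<bar>Re (H (w t))\<bar>" by (simp add: mult.commute)
  qed
  also have "integral {0..2*pi} (\<lambda>t. D * \<bar>Re (H (w t))\<bar>) = 2 * pi * (D * circle_mean R (\<lambda>z. \<bar>Re (H z)\<bar>))"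
    by (simp add: circle_mean_def w_def)
  finally have "2 * pi * cmod (H z1 - H z2) \<le> 2 * pi * (D * circle_mean R (\<lambda>z. \<bar>Re (H z)\<bar>))"
    using integral_unique[OF I] by (simp add: norm_mult)
  then have "cmod (H z1 - H z2) \<le> D * circle_mean R (\<lambda>z. \<bar>Re (H z)\<bar>)"
    by (rule mult_left_le_imp_le) simp
  then show ?thesis by (simp add: R_def D_def)
qed

section \<open>Contribution of zeros and poles to the affine difference quotient\<close>

lemma abs_ln_eq: "0 \<le> x \<Longrightarrow> \<bar>ln x\<bar> = ln_plus x + ln_plus (inverse x)"
  by (cases "x = 0") (auto simp: ln_plus_def ln_inverse)

text \<open>The unintegrated count n(R, F = 0) + n(R, F = \<infinity>), with multiplicity.\<close>

definition order_mass :: "(complex \<Rightarrow> complex) \<Rightarrow> real \<Rightarrow> real" where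
  "order_mass F R = (\<Sum>a\<in>{a \<in> cball 0 R. zorder F a \<noteq> 0}. \<bar>of_int (zorder F a)\<bar>)"

lemma order_mass_nonneg: "0 \<le> order_mass F R" by (simp add: order_mass_def sum_nonneg)

lemma circle_mean_ln_affine:
  assumes "r > 0" "q \<noteq> 0"
  shows "circle_integrable r (\<lambda>z. ln (cmod (q * z + c - a)))"
    "circle_mean r (\<lambda>z. ln (cmod (q * z + c - a))) = ln (max (cmod q * r) (cmod (a - c)))"
proof -
  define b where "b = (a - c) / q"
  have e: "q * z + c - a = q * (z - b)" for z using assms by (simp add: b_def field_simps)
  have eq: "ln (cmod (q * z + c - a)) = ln (cmod q) + ln (cmod (z - b))" if "z \<notin> {b}" for z
    unfolding e using assms that by (simp add: norm_mult ln_mult)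
  note L = circle_mean_ln_diff[OF assms(1), of b]
  show "circle_integrable r (\<lambda>z. ln (cmod (q * z + c - a)))"
    by (rule circle_integrable_spike[OF circle_integrable_add[OF circle_integrable_const L(1)] assms(1), of "{b}"]) (use eq in auto)
  have "circle_mean r (\<lambda>z. ln (cmod (q * z + c - a))) = circle_mean r (\<lambda>z. ln (cmod q) + ln (cmod (z - b)))"
    by (rule circle_mean_spike[OF assms(1), of "{b}"]) (use eq in auto)
  also have "\<dots> = ln (cmod q) + ln (max r (cmod b))"
    using circle_mean_add[OF circle_integrable_const L(1)] L(2) by simp
  also have "\<dots> = ln (cmod q * max r (cmod b))" using assms by (subst ln_mult) auto
  also have "cmod q * max r (cmod b) = max (cmod q * r) (cmod (a - c))"
    using assms by (simp add: max_mult_distrib_left b_def norm_divide)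
  finally show "circle_mean r (\<lambda>z. ln (cmod (q * z + c - a))) = ln (max (cmod q * r) (cmod (a - c)))" .
qed

text \<open>On the circle both parentheses of V are nonnegative, so V dominates the logarithm of
  (qz + c - a)/(z - a) as well as that of its inverse: zeros and poles are treated alike.\<close>

lemma circle_mean_defect_bound:
  assumes r: "r > 0" and q: "0 < cmod q" "cmod q < 1" and c: "2 * cmod c \<le> r"
  defines "V \<equiv> \<lambda>a z. (ln (r + cmod a) - ln (cmod (z - a))) + (ln (r + cmod a) - ln (cmod (q * z + c - a)))"
  shows "circle_integrable r (V a)" "circle_mean r (V a) \<le> ln (8 / cmod q)"
proof -
  have q0: "q \<noteq> 0" using q by auto
  note L1 = circle_mean_ln_diff[OF r, of a] and L2 = circle_mean_ln_affine[OF r q0, of c a]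
  have i: "circle_integrable r (\<lambda>z. ln (r + cmod a) - ln (cmod (z - a)))" "circle_integrable r (\<lambda>z. ln (r + cmod a) - ln (cmod (q * z + c - a)))"
    using L1(1) L2(1) by auto
  show "circle_integrable r (V a)" unfolding V_def by (rule circle_integrable_add[OF i])
  have "circle_mean r (V a) = (ln (r + cmod a) - ln (max r (cmod a))) + (ln (r + cmod a) - ln (max (cmod q * r) (cmod (a - c))))"
    unfolding V_def using circle_mean_add[OF i] circle_mean_diff[OF circle_integrable_const L1(1)] circle_mean_diff[OF circle_integrable_const L2(1)]
    by (simp add: L1(2) L2(2))
  also have "\<dots> \<le> ln 2 + ln (4 / cmod q)"
  proof (rule add_mono)
    have "ln (r + cmod a) \<le> ln (2 * max r (cmod a))" using r by (intro ln_mono) (auto simp: add_pos_nonneg)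
    also have "\<dots> = ln 2 + ln (max r (cmod a))" using r by (subst ln_mult) auto
    finally show "ln (r + cmod a) - ln (max r (cmod a)) \<le> ln 2" by simp
    \<comment> \<open>Either a lies in the disc and r is compared with \<open>cmod q * r\<close>, or
      \<open>cmod c \<le> r / 2 < cmod a / 2\<close> gives
      \<open>cmod (a - c) \<ge> cmod a / 2\<close>. The constant 4 serves both cases.\<close>
    have "r + cmod a \<le> 4 / cmod q * max (cmod q * r) (cmod (a - c))"
    proof (cases "cmod a \<le> r")
      case True
      have "4 * r = 4 / cmod q * (cmod q * r)" using q by simp
      also have "\<dots> \<le> 4 / cmod q * max (cmod q * r) (cmod (a - c))"
        using q by (intro mult_left_mono) auto
      finally show ?thesis using True r by linarith
    next
      case False
      have 1: "cmod (a - c) \<ge> cmod a / 2"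
        using norm_triangle_ineq2[of a c] c False by linarith
      have "r + cmod a \<le> 4 * cmod (a - c)" using 1 False by linarith
      also have "\<dots> \<le> 4 / cmod q * cmod (a - c)"
        using q by (intro mult_right_mono) (auto simp: field_simps)
      also have "\<dots> \<le> 4 / cmod q * max (cmod q * r) (cmod (a - c))"
        using q by (intro mult_left_mono) auto
      finally show ?thesis .
    qed
    then have "ln (r + cmod a) \<le> ln (4 / cmod q * max (cmod q * r) (cmod (a - c)))"
      using r by (intro ln_mono) (auto simp: add_pos_nonneg)
    also have "\<dots> = ln (4 / cmod q) + ln (max (cmod q * r) (cmod (a - c)))"
    proof (rule ln_mult_pos)
      show "0 < 4 / cmod q" "0 < max (cmod q * r) (cmod (a - c))" using q r by (auto simp: less_max_iff_disj)
    qed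
    finally show "ln (r + cmod a) - ln (max (cmod q * r) (cmod (a - c))) \<le> ln (4 / cmod q)" by simp
  qed
  also have "\<dots> = ln (2 * (4 / cmod q))" using q by (subst ln_mult) auto
  finally show "circle_mean r (V a) \<le> ln (8 / cmod q)" by simp
qed

lemma nz_meromorphic_affine:
  assumes "nz_meromorphic F" "q \<noteq> 0"
  shows "nz_meromorphic (\<lambda>z. F (q * z + c))"
  unfolding nz_meromorphic_def
proof (intro conjI allI)
  show "(\<lambda>z. F (q * z + c)) meromorphic_on UNIV"
    by (rule meromorphic_on_compose[OF nz_meromorphic_mero[OF assms(1), of UNIV]]) (auto intro!: analytic_intros)
  fix z
  have "filterlim (\<lambda>z. q * z + c) (at (q * z + c)) (at z)"
  proof (rule filterlim_atI)
    show "((\<lambda>z. q * z + c) \<longlongrightarrow> q * z + c) (at z)" by (intro tendsto_intros)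
    have "\<forall>\<^sub>F w in at z. w \<noteq> z" by (simp add: eventually_neq_at_within)
    then show "\<forall>\<^sub>F w in at z. q * w + c \<noteq> q * z + c" by eventually_elim (use assms in auto)
  qed
  from eventually_compose_filterlim[OF nz_meromorphic_ev[OF assms(1)] this]
  show "\<forall>\<^sub>F w in at z. F (q * w + c) \<noteq> 0" .
qed

lemma affine_preimage_finite: "finite X \<Longrightarrow> q \<noteq> 0 \<Longrightarrow> finite {z. q * z + c \<in> (X :: complex set)}"
  using finite_vimageI[of X "\<lambda>z. q * z + c"] by (simp add: inj_on_def vimage_def)

text \<open>The two conditions on c have separate purposes:
  \<open>cmod c \<le> (1 - cmod q) * r\<close> keeps qz + c in the disc of radius r, where
  differences of H are controlled, and \<open>2 * cmod c \<le> r\<close> keeps a - c comparable with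
  a for zeros and poles beyond radius r. The first summand of the bound comes from H, the second
  from the factors z - a.\<close>

theorem difference_quotient_estimate:
  assumes F: "nz_meromorphic F" and q: "0 < cmod q" "cmod q < 1"
    and r: "r > 0" "2 * cmod c \<le> r" "cmod c \<le> (1 - cmod q) * r" and K: "K > 1"
  shows "proximity (\<lambda>z. F (q * z + c) / F z) r \<le>
     4 * K / (K - 1)^2 * (proximity F (K * r) + proximity (\<lambda>z. inverse (F z)) (K * r) + 2 * ln 2 * order_mass F (K * r))
     + ln (8 / cmod q) * order_mass F (K * r)"
proof -
  define R where "R = K * r"
  have R: "R > 0" "r < R" using r K by (auto simp: R_def)
  have q0: "q \<noteq> 0" using q by auto
  define Z where "Z = {a \<in> cball 0 R. zorder F a \<noteq> 0}"
  define k where "k = zorder F"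
  define l where "l = (\<lambda>a. real_of_int (k a))"
  have Z: "finite Z" unfolding Z_def by (rule finite_zorder_nonzero[OF F])
  have zs: "order_mass F R = (\<Sum>a\<in>Z. \<bar>l a\<bar>)" by (simp add: order_mass_def Z_def k_def l_def)
  obtain h R' X where h: "R < R'" "h holomorphic_on ball 0 R'" "\<And>z. z \<in> ball 0 R' \<Longrightarrow> h z \<noteq> 0"
    "finite X" "Z \<subseteq> X"
    "\<And>z. z \<in> ball 0 R' \<Longrightarrow> z \<notin> X \<Longrightarrow> F z = h z * (\<Prod>a\<in>Z. (z - a) powi k a)"
    by (rule nz_meromorphic_factorization[OF F R(1), folded Z_def k_def]) (rule that)
  obtain H where H: "H holomorphic_on cball 0 R" "\<And>z. z \<in> cball 0 R \<Longrightarrow> ln (cmod (h z)) = Re (H z)"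
    using circle_mean_ln_nonvanishing(3)[OF h(2,3) R(1) h(1)] by blast
  have inb: "z \<in> ball 0 R'" "z \<in> cball 0 R" if "cmod z \<le> R" for z using that h(1) by auto
  have fact: "ln (cmod (F z)) = Re (H z) + (\<Sum>a\<in>Z. l a * ln (cmod (z - a)))" "F z \<noteq> 0"
    if "cmod z \<le> R" "z \<notin> X" for z
  proof -
    note F1 = h(6)[OF inb(1)[OF that(1)] that(2)]
    have zZ: "z \<notin> Z" using that h(5) by auto
    show "ln (cmod (F z)) = Re (H z) + (\<Sum>a\<in>Z. l a * ln (cmod (z - a)))"
      unfolding F1 l_def using ln_norm_prod_powi[OF Z zZ h(3)[OF inb(1)[OF that(1)]], of k] H(2)[OF inb(2)[OF that(1)]]
      by simp
    show "F z \<noteq> 0" unfolding F1 using h(3)[OF inb(1)[OF that(1)]] Z zZ by auto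
  qed
  \<comment> \<open>Differences of H do not see an added constant. This one rescales every factor z
    - a to (z - a)/R, so that the mean of the modulus of Re H1 involves no multiple of
    \<open>ln R\<close>.\<close>
  define s where "s = (\<Sum>a\<in>Z. l a) * ln R"
  define H1 where "H1 = (\<lambda>z. H z + of_real s)"
  have H1: "H1 holomorphic_on cball 0 R" unfolding H1_def by (intro holomorphic_intros H(1))
  define M where "M = circle_mean R (\<lambda>z. \<bar>Re (H1 z)\<bar>)"
  have M: "M \<le> proximity F R + proximity (\<lambda>z. inverse (F z)) R + 2 * ln 2 * order_mass F R"
  proof -
    note cl = circle_integrable_ln_plus[OF F R(1)] circle_integrable_ln_plus[OF nz_meromorphic_inverse[OF F] R(1)]
    \<comment> \<open>As x = ln (cmod (w - a) / R) is at most ln 2, its modulus is at most 2 ln 2 -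
      x. The mean of x over the circle is 0, so only 2 ln 2 per zero or pole survives.\<close>
    define U where "U = (\<lambda>a w. \<bar>l a\<bar> * (2 * ln 2 + ln R - ln (cmod (w - a))))"
    have cU: "circle_integrable R (U a)" for a
      unfolding U_def by (intro circle_integrable_cmult circle_integrable_diff circle_integrable_const circle_mean_ln_diff R)
    have "M \<le> circle_mean R (\<lambda>w. (ln_plus (cmod (F w)) + ln_plus (cmod (inverse (F w)))) + (\<Sum>a\<in>Z. U a w))"
      unfolding M_def
    proof (rule circle_mean_mono[OF _ _ R(1) h(4)])
      show "circle_integrable R (\<lambda>z. \<bar>Re (H1 z)\<bar>)" using circle_mean_Re_holomorphic(2)[OF H1 R(1)] by (rule circle_integrable_abs)
      show "circle_integrable R (\<lambda>w. (ln_plus (cmod (F w)) + ln_plus (cmod (inverse (F w)))) + (\<Sum>a\<in>Z. U a w))"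
        by (intro circle_integrable_add circle_integrable_sum cl cU)
      fix w assume w: "cmod w = R" "w \<notin> X"
      have "Re (H1 w) = ln (cmod (F w)) - (\<Sum>a\<in>Z. l a * (ln (cmod (w - a)) - ln R))"
        using fact(1)[of w] w by (simp add: H1_def s_def sum_subtractf sum_distrib_right right_diff_distrib)
      then have "\<bar>Re (H1 w)\<bar> \<le> \<bar>ln (cmod (F w))\<bar> + \<bar>\<Sum>a\<in>Z. l a * (ln (cmod (w - a)) - ln R)\<bar>"
        by linarith
      also have "\<bar>\<Sum>a\<in>Z. l a * (ln (cmod (w - a)) - ln R)\<bar> \<le> (\<Sum>a\<in>Z. \<bar>l a * (ln (cmod (w - a)) - ln R)\<bar>)"
        by (rule sum_abs)
      also have "\<dots> \<le> (\<Sum>a\<in>Z. U a w)"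
      proof (rule sum_mono)
        fix a assume a: "a \<in> Z"
        then have "w \<noteq> a" using w h(5) by auto
        have "cmod (w - a) \<le> 2 * R" using norm_triangle_ineq4[of w a] w a by (simp add: Z_def)
        then have "ln (cmod (w - a)) \<le> ln (2 * R)" using \<open>w \<noteq> a\<close> by (intro ln_mono) auto
        also have "\<dots> = ln 2 + ln R" using R by (subst ln_mult) auto
        finally have "\<bar>ln (cmod (w - a)) - ln R\<bar> \<le> 2 * ln 2 + ln R - ln (cmod (w - a))"
          using ln_ge_zero[of 2] by (auto simp: abs_if)
        then show "\<bar>l a * (ln (cmod (w - a)) - ln R)\<bar> \<le> U a w"
          unfolding U_def abs_mult by (intro mult_left_mono) auto
      qed
      finally show "\<bar>Re (H1 w)\<bar> \<le> (ln_plus (cmod (F w)) + ln_plus (cmod (inverse (F w)))) + (\<Sum>a\<in>Z. U a w)"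
        by (simp add: abs_ln_eq norm_inverse)
    qed
    also have "\<dots> = proximity F R + proximity (\<lambda>z. inverse (F z)) R + (\<Sum>a\<in>Z. circle_mean R (U a))"
      unfolding proximity_eq
      by (subst circle_mean_add[OF circle_integrable_add[OF cl] circle_integrable_sum[OF cU]], subst circle_mean_add[OF cl], subst circle_mean_sum[OF cU]) simp
    also have "(\<Sum>a\<in>Z. circle_mean R (U a)) = (\<Sum>a\<in>Z. \<bar>l a\<bar> * (2 * ln 2))"
    proof (rule sum.cong[OF refl])
      fix a assume "a \<in> Z"
      then have "max R (cmod a) = R" by (auto simp: Z_def)
      then show "circle_mean R (U a) = \<bar>l a\<bar> * (2 * ln 2)"
        unfolding U_def circle_mean_cmult using circle_mean_diff[OF circle_integrable_const circle_mean_ln_diff(1)[OF R(1), of a]] circle_mean_ln_diff(2)[OF R(1), of a]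
        by simp
    qed
    also have "\<dots> = 2 * ln 2 * order_mass F R" by (simp add: zs sum_distrib_right[symmetric])
    finally show ?thesis .
  qed
  define D where "D = 4 * K / (K - 1)^2"
  have D: "D \<ge> 0" using K by (simp add: D_def)
  have phi: "cmod (q * z + c) \<le> r" if "cmod z = r" for z
    using norm_triangle_ineq[of "q * z" c] that r(3) by (simp add: norm_mult algebra_simps)
  have Hd: "cmod (H (q * z + c) - H z) \<le> D * M" if "cmod z = r" for z
    using holomorphic_diff_bound[OF H1[unfolded R_def] r(1) K phi[OF that], of z] that
    by (simp add: H1_def D_def M_def R_def)
  define V where "V = (\<lambda>a z. (ln (r + cmod a) - ln (cmod (z - a))) + (ln (r + cmod a) - ln (cmod (q * z + c - a))))"
  have Vb: "circle_integrable r (V a)" "circle_mean r (V a) \<le> ln (8 / cmod q)" for a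
    using circle_mean_defect_bound[OF r(1) q r(2), of a] by (simp_all add: V_def)
  have cV: "circle_integrable r (\<lambda>z. \<bar>l a\<bar> * V a z)" for a using Vb(1) by (intro circle_integrable_cmult) 
  define Y where "Y = X \<union> {z. q * z + c \<in> X}"
  have Y: "finite Y" unfolding Y_def using h(4) affine_preimage_finite[OF h(4) q0] by simp
  have "proximity (\<lambda>z. F (q * z + c) / F z) r \<le> circle_mean r (\<lambda>z. D * M + (\<Sum>a\<in>Z. \<bar>l a\<bar> * V a z))"
    unfolding proximity_eq
  proof (rule circle_mean_mono[OF _ _ r(1) Y])
    show "circle_integrable r (\<lambda>z. ln_plus (cmod (F (q * z + c) / F z)))"
      by (intro circle_integrable_ln_plus nz_meromorphic_divide nz_meromorphic_affine F q0 r)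
    show "circle_integrable r (\<lambda>z. D * M + (\<Sum>a\<in>Z. \<bar>l a\<bar> * V a z))"
      by (intro circle_integrable_add circle_integrable_const circle_integrable_sum cV)
    fix z assume z: "cmod z = r" "z \<notin> Y"
    have zX: "z \<notin> X" "q * z + c \<notin> X" using z by (auto simp: Y_def)
    have le: "cmod z \<le> R" "cmod (q * z + c) \<le> R" using z phi[OF z(1)] R by auto
    have Vnn: "0 \<le> V a z" and lv: "\<bar>ln (cmod (q * z + c - a)) - ln (cmod (z - a))\<bar> \<le> V a z" if a: "a \<in> Z" for a
    proof -
      have ne: "z \<noteq> a" "q * z + c \<noteq> a" using zX a h(5) by auto
      have "cmod (z - a) \<le> r + cmod a" using norm_triangle_ineq4[of z a] z by simp
      then have 1: "ln (cmod (z - a)) \<le> ln (r + cmod a)" using ne by (intro ln_mono) auto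
      have "cmod (q * z + c - a) \<le> r + cmod a" using norm_triangle_ineq4[of "q * z + c" a] phi[OF z(1)] by simp
      then have 2: "ln (cmod (q * z + c - a)) \<le> ln (r + cmod a)" using ne by (intro ln_mono) auto
      show "0 \<le> V a z" "\<bar>ln (cmod (q * z + c - a)) - ln (cmod (z - a))\<bar> \<le> V a z"
        unfolding V_def using 1 2 by auto
    qed
    have "ln (cmod (F (q * z + c) / F z)) = ln (cmod (F (q * z + c))) - ln (cmod (F z))"
      using fact(2)[OF le(1) zX(1)] fact(2)[OF le(2) zX(2)] by (simp add: norm_divide ln_div)
    also have "\<dots> = Re (H (q * z + c) - H z) + (\<Sum>a\<in>Z. l a * (ln (cmod (q * z + c - a)) - ln (cmod (z - a))))"
      using fact(1)[OF le(1) zX(1)] fact(1)[OF le(2) zX(2)] by (simp add: sum_subtractf right_diff_distrib)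
    also have "\<dots> \<le> D * M + (\<Sum>a\<in>Z. \<bar>l a\<bar> * V a z)"
    proof (rule add_mono)
      show "Re (H (q * z + c) - H z) \<le> D * M"
        using complex_Re_le_cmod[of "H (q * z + c) - H z"] Hd[OF z(1)] by linarith
      show "(\<Sum>a\<in>Z. l a * (ln (cmod (q * z + c - a)) - ln (cmod (z - a)))) \<le> (\<Sum>a\<in>Z. \<bar>l a\<bar> * V a z)"
      proof (rule sum_mono)
        fix a assume a: "a \<in> Z"
        have "l a * (ln (cmod (q * z + c - a)) - ln (cmod (z - a))) \<le>
           \<bar>l a\<bar> * \<bar>ln (cmod (q * z + c - a)) - ln (cmod (z - a))\<bar>"
          by (metis abs_ge_self abs_mult)
        also have "\<dots> \<le> \<bar>l a\<bar> * V a z" using lv[OF a] by (intro mult_left_mono) auto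
        finally show "l a * (ln (cmod (q * z + c - a)) - ln (cmod (z - a))) \<le> \<bar>l a\<bar> * V a z" .
      qed
    qed
    finally have 1: "ln (cmod (F (q * z + c) / F z)) \<le> D * M + (\<Sum>a\<in>Z. \<bar>l a\<bar> * V a z)" .
    \<comment> \<open>\<open>ln_plus\<close> takes the maximum with 0, so the majorant has to be
      nonnegative as well.\<close>
    have "0 \<le> D * M" using Hd[OF z(1)] norm_ge_zero[of "H (q * z + c) - H z"] by linarith
    moreover have "0 \<le> (\<Sum>a\<in>Z. \<bar>l a\<bar> * V a z)" using Vnn by (intro sum_nonneg) auto
    ultimately show "ln_plus (cmod (F (q * z + c) / F z)) \<le> D * M + (\<Sum>a\<in>Z. \<bar>l a\<bar> * V a z)"
      using 1 by (simp add: ln_plus_def)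
  qed
  also have "\<dots> = D * M + (\<Sum>a\<in>Z. \<bar>l a\<bar> * circle_mean r (V a))"
    using circle_mean_add[OF circle_integrable_const circle_integrable_sum[of Z, OF cV], of "D * M"] circle_mean_sum[of Z, OF cV]
    by (simp add: circle_mean_cmult)
  also have "(\<Sum>a\<in>Z. \<bar>l a\<bar> * circle_mean r (V a)) \<le> (\<Sum>a\<in>Z. \<bar>l a\<bar> * ln (8 / cmod q))"
    using Vb(2) by (intro sum_mono mult_left_mono) auto
  also have "(\<Sum>a\<in>Z. \<bar>l a\<bar> * ln (8 / cmod q)) = ln (8 / cmod q) * order_mass F R"
    unfolding zs sum_distrib_right[symmetric] by (rule mult.commute)
  also have "D * M \<le> D * (proximity F R + proximity (\<lambda>z. inverse (F z)) R + 2 * ln 2 * order_mass F R)"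
    using M D by (rule mult_left_mono)
  finally show ?thesis unfolding R_def D_def by simp
qed

text \<open>A zero or pole in the disc of radius R is counted throughout the annulus from R to KR,
  hence enters the integrated count with a factor of at least \<open>ln K\<close>. For the origin
  this factor is \<open>ln (K * R)\<close>, and \<open>R \<ge> 1\<close> makes it large
  enough.\<close>

lemma order_mass_le_log_count:
  assumes F: "nz_meromorphic F" and R: "R \<ge> 1" and K: "K \<ge> 1"
  shows "order_mass F R * ln K \<le> log_count (\<lambda>a. \<bar>of_int (zorder F a)\<bar>) (K * R)"
proof -
  define w where "w = (\<lambda>a. \<bar>real_of_int (zorder F a)\<bar>)"
  define Z where "Z = {a \<in> cball 0 R. zorder F a \<noteq> 0}"
  define B where "B = {a \<in> cball 0 (K * R). zorder F a \<noteq> 0} - {0}"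
  have KR: "R \<le> K * R" using R K by (simp add: mult_le_cancel_right1)
  have Z: "finite Z" and B: "finite B" unfolding Z_def B_def using finite_zorder_nonzero[OF F] by auto
  have sub: "Z - {0} \<subseteq> B" using KR by (auto simp: Z_def B_def)
  have "log_count w (K * R) = (\<Sum>a\<in>B. w a * ln (K * R / cmod a)) + w 0 * ln (K * R)"
    by (rule log_count_alt[OF B]) (auto simp: B_def w_def)
  moreover have "(\<Sum>a\<in>Z-{0}. w a * ln K) \<le> (\<Sum>a\<in>B. w a * ln (K * R / cmod a))"
  proof (rule order_trans[OF sum_mono sum_mono2[OF B sub]])
    fix a assume "a \<in> Z - {0}"
    then have a: "a \<noteq> 0" "cmod a \<le> R" by (auto simp: Z_def)
    have "K \<le> K * R / cmod a" using a K by (simp add: field_simps)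
    then have "ln K \<le> ln (K * R / cmod a)" using K by (intro ln_mono) auto
    then show "w a * ln K \<le> w a * ln (K * R / cmod a)" by (intro mult_left_mono) (auto simp: w_def)
  next
    fix a assume "a \<in> B - (Z - {0})"
    then have "a \<noteq> 0" "cmod a \<le> K * R" by (auto simp: B_def)
    then show "0 \<le> w a * ln (K * R / cmod a)" by (simp add: w_def)
  qed
  moreover have "w 0 * ln K \<le> w 0 * ln (K * R)"
    using K R KR by (intro mult_left_mono ln_mono) (auto simp: w_def mult_le_cancel_left1)
  moreover have "order_mass F R * ln K = (\<Sum>a\<in>Z-{0}. w a * ln K) + w 0 * ln K"
  proof -
    have "order_mass F R = (\<Sum>a\<in>Z. w a)" by (simp add: order_mass_def w_def Z_def)
    also have "\<dots> = (\<Sum>a\<in>Z-{0}. w a) + w 0"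
    proof (cases "0 \<in> Z")
      case True
      then show ?thesis using sum.remove[OF Z True, of w] by simp
    next
      case False
      then show ?thesis using R by (simp add: Z_def w_def)
    qed
    finally show ?thesis by (simp add: distrib_right sum_distrib_right)
  qed
  ultimately show ?thesis unfolding w_def by linarith
qed

subsection \<open>Orders of the Hahn difference\<close>

lemma zorder_affine:
  assumes F: "nz_meromorphic F" and "q \<noteq> 0"
  shows "zorder (\<lambda>z. F (q * z + c)) z = zorder F (q * z + c)"
proof -
  have mer: "isolated_singularity_at F w" "not_essential F w" for w
    using nz_meromorphic_mero[OF F, of UNIV] by (auto simp: meromorphic_on_altdef)
  have "zorder (F \<circ> (\<lambda>z. q * z + c)) z = zorder F (q * z + c) * int (subdegree (fps_const q * fps_X))"
  proof (rule zorder_compose)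
    have "(\<lambda>x. q * x) has_fps_expansion fps_const q * fps_X" by (intro fps_expansion_intros)
    then show "(\<lambda>x. q * (z + x) + c - (q * z + c)) has_fps_expansion fps_const q * fps_X"
      by (simp add: algebra_simps)
    show "fps_const q * fps_X \<noteq> 0" using assms by simp
    show "isolated_singularity_at F (q * z + c)" "not_essential F (q * z + c)" by (rule mer)+
    show "\<forall>\<^sub>F w in at (q * z + c). F w \<noteq> 0" by (rule nz_meromorphic_ev[OF F])
  qed
  also have "subdegree (fps_const q * fps_X) = 1" using assms by simp
  finally show ?thesis by (simp add: o_def)
qed

text \<open>Write F = u (z - p)^n near p with u p \<noteq> 0. Invariance gives u(qz + c) q^n = u(z),
  and z tending to p yields q^n = 1, which \<open>cmod q < 1\<close> forbids unless n = 0. This is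
  what keeps the Hahn difference from vanishing identically.\<close>

lemma zorder_fixpoint_zero:
  assumes F: "nz_meromorphic F" and q: "0 < cmod q" "cmod q < 1" and fxd: "q * p + c = p"
    and ev: "\<forall>\<^sub>F z in at p. F (q * z + c) = F z"
  shows "zorder F p = 0"
proof (rule ccontr)
  assume n0: "zorder F p \<noteq> 0"
  define n where "n = zorder F p"
  define u where "u = zor_poly F p"
  have mer: "isolated_singularity_at F p" "not_essential F p"
    using nz_meromorphic_mero[OF F, of UNIV] by (auto simp: meromorphic_on_altdef)
  have q0: "q \<noteq> 0" using q by auto
  obtain r where r: "u p \<noteq> 0" "r > 0" "u holomorphic_on cball p r"
     "\<And>w. w \<in> cball p r - {p} \<Longrightarrow> F w = u w * (w - p) powi n \<and> u w \<noteq> 0"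
    using zorder_exist[OF mer nz_meromorphic_freq[OF F]] unfolding n_def u_def by blast
  have "isCont u p"
    by (rule continuous_on_interior[OF holomorphic_on_imp_continuous_on[OF r(3)]]) (use r(2) in auto)
  then have lu: "(u \<longlongrightarrow> u p) (at p)" by (simp add: isCont_def)
  have "((\<lambda>z. q * z + c) \<longlongrightarrow> q * p + c) (at p)" by (intro tendsto_intros)
  then have lphi: "((\<lambda>z. q * z + c) \<longlongrightarrow> p) (at p)" by (simp add: fxd)
  have nep: "\<forall>\<^sub>F w in at p. w \<noteq> p" by (simp add: eventually_neq_at_within)
  have phine: "q * w + c \<noteq> p" if "w \<noteq> p" for w
    using that q0 fxd by (metis add_right_cancel mult_left_cancel)
  have "\<forall>\<^sub>F w in at p. q * w + c \<noteq> p" using nep by eventually_elim (rule phine)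
  with lphi have "filterlim (\<lambda>z. q * z + c) (at p) (at p)" by (rule filterlim_atI)
  then have luphi: "((\<lambda>z. u (q * z + c)) \<longlongrightarrow> u p) (at p)" by (rule filterlim_compose[OF lu])
  have "((\<lambda>z. u (q * z + c) / u z) \<longlongrightarrow> u p / u p) (at p)" by (intro tendsto_divide luphi lu r(1))
  then have l1: "((\<lambda>z. u (q * z + c) / u z) \<longlongrightarrow> 1) (at p)" using r(1) by simp
  have inball: "\<forall>\<^sub>F w in at p. w \<in> ball p r - {p}" using r(2) by (intro eventually_at_in_open) auto
  have "\<forall>\<^sub>F z in at p. u (q * z + c) / u z = inverse (q powi n)"
    using ev inball
  proof eventually_elim
    case (elim z)
    have zp: "z \<noteq> p" using elim by auto
    have e: "q * z + c - p = q * (z - p)" using fxd by (metis add_diff_cancel_right right_diff_distrib)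
    have "cmod (q * z + c - p) \<le> cmod (z - p)"
      unfolding e norm_mult using q by (simp add: mult_left_le_one_le)
    then have in2: "q * z + c \<in> cball p r - {p}"
      using elim phine[OF zp] by (auto simp: dist_norm norm_minus_commute)
    have in1: "z \<in> cball p r - {p}" using elim by auto
    have "u (q * z + c) * (q * (z - p)) powi n = u z * (z - p) powi n"
      using r(4)[OF in1] r(4)[OF in2] elim(1) e by simp
    then have "u (q * z + c) * q powi n = u z" using zp by (simp add: power_int_mult_distrib)
    then show ?case using r(4)[OF in1] q0 by (simp add: field_simps)
  qed
  then have "((\<lambda>z. u (q * z + c) / u z) \<longlongrightarrow> inverse (q powi n)) (at p)" by (rule tendsto_eventually)
  with l1 have "inverse (q powi n) = 1" using tendsto_unique[OF _ _ l1] by (metis at_neq_bot)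
  then have "q powi n = 1" by (metis inverse_1 inverse_inverse_eq)
  then have "cmod q powi n = 1" by (metis norm_one norm_power_int)
  moreover have "ln (cmod q powi n) = of_int n * ln (cmod q)" using q by (intro ln_powi) auto
  ultimately have "of_int n * ln (cmod q) = 0" by simp
  then show False using n0 q by (simp add: n_def)
qed

lemma nz_meromorphic_affine_diff:
  assumes F: "nz_meromorphic F" and q: "0 < cmod q" "cmod q < 1" and fxd: "q * p + c = p" and n: "zorder F p \<noteq> 0"
  shows "nz_meromorphic (\<lambda>z. F (q * z + c) - F z)"
proof -
  have "\<exists>\<^sub>F w in at p. F (q * w + c) - F w \<noteq> 0"
    using zorder_fixpoint_zero[OF F q fxd] n by (auto simp: frequently_def)
  moreover have "(\<lambda>z. F (q * z + c) - F z) meromorphic_on UNIV"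
    by (intro meromorphic_intros nz_meromorphic_mero[OF F] nz_meromorphic_mero[OF nz_meromorphic_affine[OF F]]) (use q in auto)
  ultimately show ?thesis by (intro nz_meromorphicI)
qed

text \<open>Because ln 0 = 0, the origin needs no separate treatment in this form.\<close>

lemma log_count_unify: "log_count w r = (\<Sum>a\<in>{a. w a \<noteq> 0 \<and> cmod a \<le> r}. w a * (ln r - ln (cmod a)))"
  if "locally_finite_supp w" "r > 0"
proof -
  define S where "S = {a. w a \<noteq> 0 \<and> cmod a \<le> r}"
  have S: "finite S" using that(1) unfolding locally_finite_supp_def S_def by (auto simp: conj_commute)
  have "log_count w r = (\<Sum>a\<in>S-{0}. w a * ln (r / cmod a)) + w 0 * ln r"
    unfolding log_count_def S_def by (rule arg_cong2[of _ _ _ _ "(+)"]) (auto intro!: sum.cong)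
  also have "(\<Sum>a\<in>S-{0}. w a * ln (r / cmod a)) = (\<Sum>a\<in>S-{0}. w a * (ln r - ln (cmod a)))"
    using that(2) by (intro sum.cong) (auto simp: ln_div)
  also have "\<dots> + w 0 * ln r = (\<Sum>a\<in>S. w a * (ln r - ln (cmod a)))"
  proof (cases "0 \<in> S")
    case True
    then show ?thesis using sum.remove[OF S True, of "\<lambda>a. w a * (ln r - ln (cmod a))"] by simp
  next
    case False
    then show ?thesis using that(2) by (simp add: S_def)
  qed
  finally show ?thesis by (simp add: S_def)
qed

section \<open>Counting functions under the contraction\<close>

lemma locally_finite_supp_affine:
  assumes w: "locally_finite_supp w" and q: "q \<noteq> 0"
  shows "locally_finite_supp (\<lambda>z. w (q * z + c))"
  unfolding locally_finite_supp_def
proof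
  fix r
  have "{z \<in> cball 0 r. w (q * z + c) \<noteq> 0} \<subseteq> {z. q * z + c \<in> {a \<in> cball 0 (cmod q * r + cmod c). w a \<noteq> 0}}"
  proof
    fix z assume "z \<in> {z \<in> cball 0 r. w (q * z + c) \<noteq> 0}"
    then have z: "cmod z \<le> r" "w (q * z + c) \<noteq> 0" by auto
    have "cmod (q * z + c) \<le> cmod q * cmod z + cmod c"
      using norm_triangle_ineq[of "q * z" c] by (simp add: norm_mult)
    also have "\<dots> \<le> cmod q * r + cmod c" using z by (simp add: mult_left_mono)
    finally show "z \<in> {z. q * z + c \<in> {a \<in> cball 0 (cmod q * r + cmod c). w a \<noteq> 0}}" using z by simp
  qed
  then show "finite {z \<in> cball 0 r. w (q * z + c) \<noteq> 0}"
    by (rule finite_subset) (intro affine_preimage_finite q w[unfolded locally_finite_supp_def, rule_format])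
qed

text \<open>Beyond radius \<rho> the preimage (a - c)/q is at least as large as a in modulus, so
  moving the weight from a to its preimage can only lower its logarithmic factor. Only the finitely
  many points of B may go the other way, and their total C does not depend on r.\<close>

lemma log_count_affine_le:
  assumes w: "locally_finite_supp w" "\<And>a. 0 \<le> w a" and q: "0 < cmod q" "cmod q < 1"
  obtains C where "\<And>r. r \<ge> 1 \<Longrightarrow> cmod c \<le> (1 - cmod q) * r \<Longrightarrow> log_count (\<lambda>z. w (q * z + c)) r \<le> log_count w r + C"
proof -
  define \<rho> where "\<rho> = cmod c / (1 - cmod q)"
  define B where "B = {a \<in> cball 0 \<rho>. w a \<noteq> 0}"
  have B: "finite B" using w(1) unfolding locally_finite_supp_def B_def by blast
  \<comment> \<open>The weighted change of the logarithmic factor when a is replaced by its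
    preimage; nonpositive off B.\<close>
  define e where "e = (\<lambda>a. w a * (ln (cmod a) - ln (cmod ((a - c) / q))))"
  define C where "C = (\<Sum>a\<in>B. \<bar>e a\<bar>)"
  have q0: "q \<noteq> 0" using q by auto
  have "log_count (\<lambda>z. w (q * z + c)) r \<le> log_count w r + C" if r: "r \<ge> 1" "cmod c \<le> (1 - cmod q) * r" for r
  proof -
    define S1 where "S1 = {a. w a \<noteq> 0 \<and> cmod ((a - c) / q) \<le> r}"
    define S2 where "S2 = {a. w a \<noteq> 0 \<and> cmod a \<le> r}"
    have S2: "finite S2" using w(1) unfolding locally_finite_supp_def S2_def by (auto simp: conj_commute)
    have sub: "S1 \<subseteq> S2"
    proof
      fix a assume "a \<in> S1"
      then have a: "w a \<noteq> 0" "cmod (a - c) \<le> cmod q * r"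
        using q by (auto simp: S1_def norm_divide field_simps)
      have "cmod a \<le> cmod (a - c) + cmod c" using norm_triangle_ineq[of "a - c" c] by simp
      also have "\<dots> \<le> r" using a(2) r(2) by (simp add: algebra_simps)
      finally show "a \<in> S2" using a by (simp add: S2_def)
    qed
    then have S1: "finite S1" using S2 finite_subset by blast
    have "log_count (\<lambda>z. w (q * z + c)) r = (\<Sum>z\<in>{z. w (q * z + c) \<noteq> 0 \<and> cmod z \<le> r}. w (q * z + c) * (ln r - ln (cmod z)))"
      by (rule log_count_unify[OF locally_finite_supp_affine[OF w(1) q0]]) (use r in auto)
    also have "\<dots> = (\<Sum>a\<in>S1. w a * (ln r - ln (cmod ((a - c) / q))))"
      by (rule sum.reindex_bij_witness[of _ "\<lambda>a. (a - c) / q" "\<lambda>z. q * z + c"]) (use q0 in \<open>auto simp: S1_def\<close>)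
    also have "\<dots> = (\<Sum>a\<in>S1. w a * (ln r - ln (cmod a))) + (\<Sum>a\<in>S1. e a)"
      by (simp add: sum.distrib[symmetric] e_def algebra_simps)
    also have "(\<Sum>a\<in>S1. w a * (ln r - ln (cmod a))) \<le> (\<Sum>a\<in>S2. w a * (ln r - ln (cmod a)))"
    proof (rule sum_mono2[OF S2 sub])
      fix a assume "a \<in> S2 - S1"
      then have "cmod a \<le> r" by (simp add: S2_def)
      then have "ln (cmod a) \<le> ln r" using r by (cases "a = 0") (auto intro!: ln_mono)
      then show "0 \<le> w a * (ln r - ln (cmod a))" using w(2) by simp
    qed
    also have "\<dots> = log_count w r" unfolding S2_def by (rule log_count_unify[OF w(1), symmetric]) (use r in auto)
    also have "(\<Sum>a\<in>S1. e a) \<le> (\<Sum>a\<in>S1 \<inter> B. \<bar>e a\<bar>)"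
    proof -
      have "(\<Sum>a\<in>S1. e a) \<le> (\<Sum>a\<in>S1. if a \<in> B then \<bar>e a\<bar> else 0)"
      proof (rule sum_mono)
        fix a assume a: "a \<in> S1"
        show "e a \<le> (if a \<in> B then \<bar>e a\<bar> else 0)"
        proof (cases "a \<in> B")
          case False
          then have big: "cmod a > \<rho>" using a by (auto simp: B_def S1_def)
          then have "cmod c < (1 - cmod q) * cmod a" using q by (simp add: \<rho>_def field_simps)
          then have "cmod q * cmod a \<le> cmod (a - c)"
            using norm_triangle_ineq2[of a c] by (simp add: algebra_simps)
          then have le: "cmod a \<le> cmod ((a - c) / q)" using q by (simp add: norm_divide field_simps)
          have "cmod a > 0"
          proof -
            have "\<rho> \<ge> 0" using q by (simp add: \<rho>_def)
            then show ?thesis using big by linarith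
          qed
          then have "ln (cmod a) \<le> ln (cmod ((a - c) / q))" using le by (intro ln_mono) auto
          then show ?thesis using w(2)[of a] False by (simp add: e_def mult_nonneg_nonpos)
        qed auto
      qed
      also have "\<dots> = (\<Sum>a\<in>S1 \<inter> B. \<bar>e a\<bar>)" using S1 by (simp add: sum.inter_restrict)
      finally show ?thesis .
    qed
    also have "\<dots> \<le> C" unfolding C_def by (intro sum_mono2 B) auto
    finally show ?thesis by simp
  qed
  then show ?thesis using that by blast
qed

section \<open>The Hahn difference and its fixed point\<close>

locale hahn_setup = nonconst_mero g for g +
  fixes q c :: complex
  assumes q: "0 < cmod q" "cmod q < 1"
begin

abbreviation "\<phi> \<equiv> \<lambda>z. q * z + c"
definition "fixed_pt = c / (1 - q)"
abbreviation "D \<equiv> hahn_diff q c g"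

lemma q0: "q \<noteq> 0" "q \<noteq> 1" using q by auto

lemma fixp: "\<phi> fixed_pt = fixed_pt"
  using q0 by (simp add: fixed_pt_def field_simps)

lemma lin_eq: "(q - 1) * z + c = (q - 1) * (z - fixed_pt)"
  using q0 by (simp add: fixed_pt_def field_simps)

lemma nz_lin: "nz_meromorphic (\<lambda>z. (q - 1) * z + c)"
proof (rule nz_meromorphicI)
  show "(\<lambda>z. (q - 1) * z + c) meromorphic_on UNIV" by (intro meromorphic_intros)
  have "\<forall>\<^sub>F w in at fixed_pt. w \<noteq> fixed_pt" by (simp add: eventually_neq_at_within)
  then have "\<forall>\<^sub>F w in at fixed_pt. (q - 1) * w + c \<noteq> 0" by eventually_elim (use q0 in \<open>simp add: lin_eq\<close>)
  then show "\<exists>\<^sub>F w in at fixed_pt. (q - 1) * w + c \<noteq> 0" by (simp add: eventually_frequently)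
qed

lemma zorder_lin: "zorder (\<lambda>z. (q - 1) * z + c) z = (if z = fixed_pt then 1 else 0)"
proof -
  have "zorder (\<lambda>z. (q - 1) * (z - fixed_pt)) z = zorder (\<lambda>z. z - fixed_pt) z"
    by (rule zorder_cmult) (use q0 in auto)
  then show ?thesis by (simp add: lin_eq zorder_linear)
qed

lemma nz_phi: "nz_meromorphic (\<lambda>z. g (\<phi> z))" by (rule nz_meromorphic_affine[OF nz q0(1)])
lemma zorder_phi: "zorder (\<lambda>z. g (\<phi> z)) z = zorder g (\<phi> z)" by (rule zorder_affine[OF nz q0(1)])

text \<open>At the fixed point either g has a pole or g - g(fixed_pt) has a zero. Both are nonzero
  orders there, and subtracting a constant from g does not change the difference, so the criterion
  at the fixed point always applies.\<close>

lemma nz_delta: "nz_meromorphic (\<lambda>z. g (\<phi> z) - g z)"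
proof (cases "is_pole g fixed_pt")
  case True
  then have "zorder g fixed_pt \<noteq> 0" using pole_iff[of fixed_pt] by auto
  then show ?thesis by (rule nz_meromorphic_affine_diff[OF nz q fixp])
next
  case False
  then have "zorder (\<lambda>w. g w - g fixed_pt) fixed_pt \<noteq> 0" using zorder_diff_nonpole(2)[OF False, of "g fixed_pt"] by auto
  from nz_meromorphic_affine_diff[OF nz_diff q fixp this] show ?thesis by simp
qed

lemma nz_D: "nz_meromorphic D"
  unfolding hahn_diff_def[abs_def] by (rule nz_meromorphic_divide[OF nz_delta nz_lin])

lemma zorder_hahn:
  assumes "nz_meromorphic (\<lambda>z. f (\<phi> z) - f z)"
  shows "zorder (hahn_diff q c f) z = zorder (\<lambda>z. f (\<phi> z) - f z) z - (if z = fixed_pt then 1 else 0)"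
  unfolding hahn_diff_def[abs_def] zorder_lin[symmetric]
  by (rule zorder_divide[OF nz_meromorphic_mero[OF assms] nz_meromorphic_freq[OF assms] nz_meromorphic_mero[OF nz_lin] nz_meromorphic_freq[OF nz_lin]])

lemma zorder_affine_diff_ge:
  assumes F: "nz_meromorphic F" "nz_meromorphic (\<lambda>z. F (\<phi> z) - F z)" "zorder F (\<phi> z) \<ge> k" "zorder F z \<ge> k"
  shows "zorder (\<lambda>z. F (\<phi> z) - F z) z \<ge> k"
proof (rule zorder_diff_ge)
  note F' = nz_meromorphic_affine[OF F(1) q0(1), of c]
  show "(\<lambda>z. F (\<phi> z)) meromorphic_on {z}" "F meromorphic_on {z}"
    by (rule nz_meromorphic_mero[OF F'], rule nz_meromorphic_mero[OF F(1)])
  show "\<exists>\<^sub>F z in at z. F (\<phi> z) \<noteq> 0" "\<exists>\<^sub>F z in at z. F z \<noteq> 0"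
    by (rule nz_meromorphic_freq[OF F'], rule nz_meromorphic_freq[OF F(1)])
  show "\<exists>\<^sub>F z in at z. F (\<phi> z) \<noteq> F z" using nz_meromorphic_freq[OF F(2), of z] by simp
  show "k \<le> zorder (\<lambda>z. F (\<phi> z)) z" using F(3) by (simp add: zorder_affine[OF F(1) q0(1)])
qed (rule F(4))

text \<open>Where g has no pole, a pole of D can come only from g(qz + c). The simple zero of the
  denominator at the fixed point does no harm, because both terms of the numerator take the value
  g(fixed_pt) there.\<close>

lemma hahn_order_nonpole:
  assumes "\<not> is_pole g z"
  shows "of_int (zorder D z) \<ge> - value_weight g None (\<phi> z)"
proof (cases "z = fixed_pt")
  case True
  have fixed_pt: "zorder (\<lambda>w. g w - g fixed_pt) fixed_pt \<ge> 1" using zorder_diff_nonpole(2)[of fixed_pt "g fixed_pt"] assms True by auto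
  have nd: "nz_meromorphic (\<lambda>z. (g (\<phi> z) - g fixed_pt) - (g z - g fixed_pt))" using nz_delta by simp
  have fixed_pt': "zorder (\<lambda>w. g w - g fixed_pt) (\<phi> fixed_pt) \<ge> 1" using fixed_pt by (simp only: fixp)
  have "zorder (\<lambda>z. (g (\<phi> z) - g fixed_pt) - (g z - g fixed_pt)) fixed_pt \<ge> 1"
    by (rule zorder_affine_diff_ge[OF nz_diff nd fixed_pt' fixed_pt])
  then have "zorder (\<lambda>z. g (\<phi> z) - g z) fixed_pt \<ge> 1" by simp
  then have "zorder D z \<ge> 0" using zorder_hahn[OF nz_delta, of z] True by simp
  then have "real_of_int (zorder D z) \<ge> 0" by simp
  then show ?thesis using value_weight_nonneg[of None "\<phi> z"] by linarith
next
  case False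
  define k where "k = - int (nat (- zorder g (\<phi> z)))"
  have "zorder g z \<ge> 0" using pole_iff[of z] assms by auto
  then have "zorder g z \<ge> k" "zorder g (\<phi> z) \<ge> k" by (auto simp: k_def)
  then have "zorder (\<lambda>z. g (\<phi> z) - g z) z \<ge> k" by (intro zorder_affine_diff_ge nz nz_delta)
  then have "zorder D z \<ge> k" using zorder_hahn[OF nz_delta, of z] False by simp
  then have "real_of_int (zorder D z) \<ge> real_of_int k" by simp
  then show ?thesis unfolding k_def value_weight_def option.case by (simp only: of_int_minus of_int_of_nat_eq)
qed

lemma nz_inv: "nz_meromorphic (\<lambda>z. 1 / g z)" using nz_meromorphic_inverse[OF nz] by (simp add: inverse_eq_divide)

lemma hahn_inverse_eq:
  assumes "g z \<noteq> 0" "g (\<phi> z) \<noteq> 0"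
  shows "hahn_diff q c (\<lambda>w. 1 / g w) z = - (D z / (g (\<phi> z) * g z))"
proof -
  have "1 / g (\<phi> z) - 1 / g z = - ((g (\<phi> z) - g z) / (g (\<phi> z) * g z))"
    using assms by (simp add: field_simps)
  then show ?thesis unfolding hahn_diff_def by (simp add: divide_divide_eq_left mult.commute)
qed

lemma zorder_hahn_inverse:
  "zorder (hahn_diff q c (\<lambda>w. 1 / g w)) z = zorder D z - zorder g (\<phi> z) - zorder g z"
    "\<exists>\<^sub>F w in at z. hahn_diff q c (\<lambda>w. 1 / g w) w \<noteq> 0"
proof -
  have ev: "\<forall>\<^sub>F w in at z. hahn_diff q c (\<lambda>w. 1 / g w) w = - (D w / (g (\<phi> w) * g w))"
    using nz_meromorphic_ev[OF nz, of z] nz_meromorphic_ev[OF nz_phi, of z] by eventually_elim (rule hahn_inverse_eq)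
  have m: "nz_meromorphic (\<lambda>w. g (\<phi> w) * g w)" by (rule nz_meromorphic_mult[OF nz_phi nz])
  have "zorder (hahn_diff q c (\<lambda>w. 1 / g w)) z = zorder (\<lambda>w. - (D w / (g (\<phi> w) * g w))) z"
    using ev by (intro zorder_cong) auto
  also have "\<dots> = zorder (\<lambda>w. D w / (g (\<phi> w) * g w)) z" by simp
  also have "\<dots> = zorder D z - zorder (\<lambda>w. g (\<phi> w) * g w) z"
    by (rule zorder_divide[OF nz_meromorphic_mero[OF nz_D] nz_meromorphic_freq[OF nz_D] nz_meromorphic_mero[OF m] nz_meromorphic_freq[OF m]])
  also have "zorder (\<lambda>w. g (\<phi> w) * g w) z = zorder g (\<phi> z) + zorder g z"
    unfolding zorder_phi[symmetric]
    by (rule zorder_mult[OF nz_meromorphic_mero[OF nz_phi] nz_meromorphic_freq[OF nz_phi] nz_meromorphic_mero[OF nz] nz_meromorphic_freq[OF nz]])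
  finally show "zorder (hahn_diff q c (\<lambda>w. 1 / g w)) z = zorder D z - zorder g (\<phi> z) - zorder g z" by simp
  have "\<forall>\<^sub>F w in at z. hahn_diff q c (\<lambda>w. 1 / g w) w \<noteq> 0"
    using ev nz_meromorphic_ev[OF nz_D, of z] nz_meromorphic_ev[OF m, of z] by eventually_elim auto
  then show "\<exists>\<^sub>F w in at z. hahn_diff q c (\<lambda>w. 1 / g w) w \<noteq> 0" by (simp add: eventually_frequently)
qed

text \<open>With n the pole order of g at z, k the order of g at qz + c, d that of D and M that of
  the Hahn difference of 1/g, one has M = d - k + n. The rest is integer arithmetic from d \<ge> -n
  if k \<ge> 0, and M \<ge> 0 if k < 0. In the latter case 1/g vanishes at z and at qz + c, which
  also pays for the denominator at the fixed point.\<close>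

lemma hahn_order_pole:
  assumes "is_pole g z"
  shows "- of_int (zorder D z) \<le> hahn_weight q c None z + value_weight g None (\<phi> z)"
proof -
  define n where "n = - zorder g z"
  define k where "k = zorder g (\<phi> z)"
  define d where "d = zorder D z"
  define M where "M = zorder (hahn_diff q c (\<lambda>w. 1 / g w)) z"
  have n: "n \<ge> 1" using assms pole_iff[of z] by (simp add: n_def)
  have M: "M = d - k + n" unfolding M_def zorder_hahn_inverse(1) by (simp add: d_def k_def n_def)
  have wh: "hahn_weight q c None z = of_int (n - min n (int (nat M)))"
    using n by (simp add: hahn_weight_def value_weight_def zero_mult_def M_def n_def min_def)
  have wv: "value_weight g None (\<phi> z) = of_int (int (nat (- k)))" by (simp add: value_weight_def k_def)
  have "- d \<le> n - min n (int (nat M)) + int (nat (- k))"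
  proof (cases "k \<ge> 0")
    case True
    have "z \<noteq> fixed_pt" using assms pole_iff[of z] True by (auto simp: k_def fixp)
    moreover have "zorder (\<lambda>z. g (\<phi> z) - g z) z \<ge> - n"
      using True n by (intro zorder_affine_diff_ge nz nz_delta) (auto simp: n_def k_def)
    ultimately have "d \<ge> - n" using zorder_hahn[OF nz_delta, of z] by (simp add: d_def)
    then show ?thesis using M True n by (auto simp: min_def)
  next
    case False
    have zi: "zorder (\<lambda>z. 1 / g z) w = - zorder g w" for w
    proof -
      have "zorder (\<lambda>z. 1 / g z) w = zorder (\<lambda>_. 1) w - zorder g w"
        by (rule zorder_divide) (auto intro!: nz_meromorphic_mero[OF nz] nz_meromorphic_freq[OF nz] simp: frequently_const_iff)
      then show ?thesis by simp
    qed
    have "\<exists>\<^sub>F w in at z. hahn_diff q c (\<lambda>w. 1 / g w) w \<noteq> 0" by (rule zorder_hahn_inverse(2))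
    then have "\<exists>\<^sub>F w in at z. 1 / g (\<phi> w) - 1 / g w \<noteq> 0"
      by (rule frequently_elim1) (auto simp: hahn_diff_def)
    moreover have "(\<lambda>w. 1 / g (\<phi> w) - 1 / g w) meromorphic_on UNIV"
      by (intro meromorphic_intros nz_meromorphic_mero[OF nz] nz_meromorphic_mero[OF nz_phi])
    ultimately have nd: "nz_meromorphic (\<lambda>w. 1 / g (\<phi> w) - 1 / g w)" by (intro nz_meromorphicI)
    have "zorder (\<lambda>w. 1 / g (\<phi> w) - 1 / g w) z \<ge> 1"
      using zorder_affine_diff_ge[OF nz_inv nd, of 1 z] zi[of z] zi[of "\<phi> z"] False n
      by (simp add: k_def n_def)
    then have "M \<ge> 0" using zorder_hahn[OF nd, of z] by (simp add: M_def split: if_splits)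
    then show ?thesis using M False n by (auto simp: min_def)
  qed
  then have "real_of_int (- d) \<le> real_of_int (n - min n (int (nat M)) + int (nat (- k)))"
    by (simp only: of_int_le_iff)
  then show ?thesis unfolding wh wv d_def by simp
qed

text \<open>The second main theorem at a single point. If z is not a pole, only a = g z contributes,
  its weight is reduced by at most the zero order of D, and a negative order of D is a pole
  inherited from g(qz + c). If z is a pole, all finite weights vanish and
  \<open>hahn_order_pole\<close> is what remains.\<close>

lemma weight_inequality:
  assumes A: "finite A"
  shows "(\<Sum>a\<in>A. value_weight g (Some a) z) - of_int (zorder D z) \<le>
     (\<Sum>a\<in>A. hahn_weight q c (Some a) z) + hahn_weight q c None z + value_weight g None (\<phi> z)"
proof (cases "is_pole g z")
  case True
  have "value_weight g (Some a) z = 0" for a using True value_weight_nonzero_iff[of "Some a" z] by auto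
  then have "(\<Sum>a\<in>A. value_weight g (Some a) z) = 0" by simp
  moreover have "0 \<le> (\<Sum>a\<in>A. hahn_weight q c (Some a) z)" by (intro sum_nonneg hahn_weight_bounds)
  ultimately show ?thesis using hahn_order_pole[OF True] by linarith
next
  case False
  define d where "d = zorder D z"
  define m where "m = (\<lambda>a. min (value_weight g (Some a) z) (real (nat d)))"
  have "(\<Sum>a\<in>A. value_weight g (Some a) z) - (\<Sum>a\<in>A. hahn_weight q c (Some a) z) = (\<Sum>a\<in>A. m a)"
    unfolding sum_subtractf[symmetric] by (intro sum.cong) (auto simp: hahn_weight_def m_def d_def zero_mult_def)
  also have "\<dots> \<le> real (nat d)"
  proof -
    have "m a = 0" if "a \<noteq> g z" for a
      using value_weight_nonzero_iff[of "Some a" z] that by (auto simp: m_def)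
    then have "(\<Sum>a\<in>A. m a) = (\<Sum>a\<in>A. if a = g z then m (g z) else 0)" by (intro sum.cong) auto
    also have "\<dots> \<le> real (nat d)" using A by (auto simp: m_def)
    finally show ?thesis .
  qed
  finally have 1: "(\<Sum>a\<in>A. value_weight g (Some a) z) - (\<Sum>a\<in>A. hahn_weight q c (Some a) z) \<le> real (nat d)" .
  have 2: "real (nat d) - of_int d \<le> value_weight g None (\<phi> z)"
    using hahn_order_nonpole[OF False] value_weight_nonneg[of None "\<phi> z"] by (cases "d \<ge> 0") (auto simp: d_def)
  have "0 \<le> hahn_weight q c None z" by (rule hahn_weight_bounds)
  then show ?thesis using 1 2 unfolding d_def by linarith
qed

lemma log_count_weight_inequality:
  assumes A: "finite A"
  obtains C where "\<And>r. r \<ge> 1 \<Longrightarrow> cmod c \<le> (1 - cmod q) * r \<Longrightarrow>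
    (\<Sum>a\<in>A. count_N g (Some a) r) - log_count (\<lambda>z. of_int (zorder D z)) r \<le>
     (\<Sum>a\<in>A. hahn_count_N q c g (Some a) r) + hahn_count_N q c g None r + count_N g None r + C"
proof -
  obtain C where C: "\<And>r. r \<ge> 1 \<Longrightarrow> cmod c \<le> (1 - cmod q) * r \<Longrightarrow>
      log_count (\<lambda>z. value_weight g None (\<phi> z)) r \<le> log_count (value_weight g None) r + C"
    using log_count_affine_le[OF locally_finite_supp_value_weight[of None] value_weight_nonneg q, of c] by blast
  show ?thesis
  proof (rule that[of C])
    fix r assume r: "r \<ge> 1" "cmod c \<le> (1 - cmod q) * r"
    note lf = locally_finite_supp_sum[of A "\<lambda>a. value_weight g (Some a)", OF locally_finite_supp_value_weight] locally_finite_supp_zorder[OF nz_D, of real_of_int]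
      locally_finite_supp_sum[of A "\<lambda>a. hahn_weight q c (Some a)", OF locally_finite_supp_hahn_weight] locally_finite_supp_hahn_weight[of q c None]
      locally_finite_supp_affine[OF locally_finite_supp_value_weight[of None] q0(1), of c]
    have lf2: "locally_finite_supp (\<lambda>z. of_int (zorder D z))" using lf(2) by simp
    note lf34 = locally_finite_supp_add[OF lf(3,4)]
    have "log_count (\<lambda>z. (\<Sum>a\<in>A. value_weight g (Some a) z) - of_int (zorder D z)) r \<le>
       log_count (\<lambda>z. (\<Sum>a\<in>A. hahn_weight q c (Some a) z) + hahn_weight q c None z + value_weight g None (\<phi> z)) r"
      by (rule log_count_mono[OF locally_finite_supp_diff[OF lf(1) lf2] locally_finite_supp_add[OF lf34 lf(5)] r(1) weight_inequality[OF A]])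
    then have "(\<Sum>a\<in>A. log_count (value_weight g (Some a)) r) - log_count (\<lambda>z. of_int (zorder D z)) r \<le>
        (\<Sum>a\<in>A. log_count (hahn_weight q c (Some a)) r) + log_count (hahn_weight q c None) r + log_count (\<lambda>z. value_weight g None (\<phi> z)) r"
      unfolding log_count_diff[OF lf(1) lf2] log_count_add[OF lf34 lf(5)] log_count_add[OF lf(3,4)]
        log_count_sum[of A "\<lambda>a. value_weight g (Some a)", OF locally_finite_supp_value_weight] log_count_sum[of A "\<lambda>a. hahn_weight q c (Some a)", OF locally_finite_supp_hahn_weight] .
    then show "(\<Sum>a\<in>A. count_N g (Some a) r) - log_count (\<lambda>z. of_int (zorder D z)) r \<le>
     (\<Sum>a\<in>A. hahn_count_N q c g (Some a) r) + hahn_count_N q c g None r + count_N g None r + C"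
      using C[OF r] r by (simp add: count_N_eq hahn_count_N_eq)
  qed
qed

end

subsection \<open>The second main theorem\<close>

text \<open>Points of A are at least 2\<delta> apart, so w is \<delta>-close to at most one of them
  and the other terms are bounded by L. A close term equals \<open>- ln (cmod (w - b))\<close>,
  which \<open>ln (cmod d)\<close> completes to the logarithm of d/(w - b). If w is close to none,
  \<open>ln (cmod d)\<close> is split at an arbitrary b0, at the price of
  \<open>ln_plus (cmod w)\<close>.\<close>

lemma log_sum_pointwise:
  fixes A :: "complex set"
  assumes A: "finite A" "A \<noteq> {}"
  obtains C where "\<And>w d. w \<notin> A \<Longrightarrow> d \<noteq> 0 \<Longrightarrow>
    (\<Sum>a\<in>A. ln_plus (cmod (inverse (w - a)))) + ln (cmod d) \<le>
      ln_plus (cmod w) + (\<Sum>a\<in>A. ln_plus (cmod (d / (w - a)))) + C"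
proof -
  define P where "P = {x \<in> A \<times> A. fst x \<noteq> snd x}"
  \<comment> \<open>The inserted 1 ensures \<delta> \<le> 1, so that a close point has
    \<open>ln (cmod (w - b)) \<le> 0\<close>, and covers a set A with a single point.\<close>
  define \<delta> where "\<delta> = Min (insert 1 ((\<lambda>x. cmod (fst x - snd x) / 2) ` P))"
  have P: "finite P" using A by (simp add: P_def)
  have d0: "\<delta> > 0" unfolding \<delta>_def using P by (subst Min_gr_iff) (auto simp: P_def)
  have d1: "\<delta> \<le> 1" unfolding \<delta>_def using P by (intro Min_le) auto
  have d2: "2 * \<delta> \<le> cmod (a - b)" if "a \<in> A" "b \<in> A" "a \<noteq> b" for a b
  proof -
    have "\<delta> \<le> cmod (fst (a, b) - snd (a, b)) / 2" unfolding \<delta>_def using P that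
      by (intro Min_le) (auto simp: P_def intro!: image_eqI[of _ _ "(a, b)"])
    then show ?thesis by simp
  qed
  define L where "L = ln (1 / \<delta>)"
  have L0: "L \<ge> 0" using d0 d1 by (simp add: L_def)
  obtain b0 where b0: "b0 \<in> A" using A by blast
  define C where "C = real (card A) * L + ln_plus (cmod b0) + ln 2"
  have far: "ln_plus (cmod (inverse (w - a))) \<le> L" if "cmod (w - a) \<ge> \<delta>" for w a
  proof -
    have "cmod (inverse (w - a)) \<le> 1 / \<delta>" using le_imp_inverse_le[OF that d0] unfolding norm_inverse[symmetric] by (simp only: inverse_eq_divide[of \<delta>])
    then have "ln_plus (cmod (inverse (w - a))) \<le> ln_plus (1 / \<delta>)" by (intro ln_plus_mono) auto
    also have "ln_plus (1 / \<delta>) = L" using L0 by (simp add: ln_plus_def L_def)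
    finally show ?thesis .
  qed
  have main: "(\<Sum>a\<in>A. ln_plus (cmod (inverse (w - a)))) + ln (cmod d) \<le>
      ln_plus (cmod w) + (\<Sum>a\<in>A. ln_plus (cmod (d / (w - a)))) + C" if w: "w \<notin> A" and d: "d \<noteq> 0" for w d
  proof -
    have trm: "ln (cmod d) - ln (cmod (w - b)) \<le> (\<Sum>a\<in>A. ln_plus (cmod (d / (w - a))))" if "b \<in> A" for b
    proof -
      have "w - b \<noteq> 0" using w that by auto
      then have "ln (cmod d) - ln (cmod (w - b)) = ln (cmod (d / (w - b)))"
        using d by (simp add: norm_divide ln_div)
      also have "\<dots> \<le> ln_plus (cmod (d / (w - b)))" by (rule ln_le_ln_plus)
      also have "\<dots> \<le> (\<Sum>a\<in>A. ln_plus (cmod (d / (w - a))))"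
        by (rule member_le_sum[OF that]) (use A ln_plus_nonneg in auto)
      finally show ?thesis .
    qed
    have bp: "0 \<le> ln_plus (cmod b0)" "0 \<le> ln_plus (cmod w)" by (rule ln_plus_nonneg)+
    have ln2: "0 \<le> ln (2::real)" by simp
    show ?thesis
    proof (cases "\<exists>b\<in>A. cmod (w - b) < \<delta>")
      case True
      then obtain b where b: "b \<in> A" "cmod (w - b) < \<delta>" by blast
      have "cmod (w - a) \<ge> \<delta>" if "a \<in> A - {b}" for a
        using d2[of a b] that b norm_triangle_ineq4[of "w - b" "w - a"] by auto
      then have "(\<Sum>a\<in>A-{b}. ln_plus (cmod (inverse (w - a)))) \<le> (\<Sum>a\<in>A-{b}. L)"
        by (intro sum_mono far)
      also have "\<dots> \<le> (\<Sum>a\<in>A. L)" using A L0 by (intro sum_mono2) auto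
      finally have 1: "(\<Sum>a\<in>A-{b}. ln_plus (cmod (inverse (w - a)))) \<le> real (card A) * L" by simp
      have wb: "0 < cmod (w - b)" using w b(1) by auto
      have "ln (cmod (w - b)) \<le> 0" using wb b(2) d1 by (simp add: ln_le_zero_iff)
      then have 2: "ln_plus (cmod (inverse (w - b))) = - ln (cmod (w - b))"
        using wb by (simp add: ln_plus_def norm_inverse ln_inverse)
      show ?thesis
        using sum.remove[OF A(1) b(1), of "\<lambda>a. ln_plus (cmod (inverse (w - a)))"] 1 2 trm[OF b(1)] bp ln2
        unfolding C_def by linarith
    next
      case False
      then have "(\<Sum>a\<in>A. ln_plus (cmod (inverse (w - a)))) \<le> (\<Sum>a\<in>A. L)"
        by (intro sum_mono far) auto
      then have 1: "(\<Sum>a\<in>A. ln_plus (cmod (inverse (w - a)))) \<le> real (card A) * L" by simp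
      have "ln (cmod (w - b0)) \<le> ln_plus (cmod (w - b0))" by (rule ln_le_ln_plus)
      also have "\<dots> \<le> ln_plus (cmod w + cmod b0)" by (intro ln_plus_mono norm_triangle_ineq4) auto
      also have "\<dots> \<le> ln_plus (cmod w) + ln_plus (cmod b0) + ln 2" by (intro ln_plus_add) auto
      finally show ?thesis using 1 trm[OF b0] by (simp add: C_def)
    qed
  qed
  show ?thesis by (rule that[of C]) (rule main)
qed

text \<open>If for every large r one of the inequalities failed, T would double within each factor
  K^2 and so reach 2^n at a radius of at most R K^(2n). That is growth of exponent at least ln 2 /
  (2 ln K), against order zero.\<close>

lemma slow_growth:
  fixes T :: "real \<Rightarrow> real"
  assumes T: "filterlim T at_top at_top" and ord: "Limsup at_top (\<lambda>r. ereal (ln_plus (T r) / ln r)) = 0"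
    and K: "K > 1"
  shows "\<exists>\<^sub>F r in at_top. T (K * r) \<le> 2 * T r \<and> T (K * (K * r)) \<le> 2 * T r"
proof (rule ccontr)
  assume "\<not> ?thesis"
  then have "\<forall>\<^sub>F r in at_top. \<not> (T (K * r) \<le> 2 * T r \<and> T (K * (K * r)) \<le> 2 * T r)"
    by (simp add: frequently_def)
  \<comment> \<open>Half of the exponent ln 2 / (2 ln K) that repeated doubling would force.\<close>
  moreover define \<sigma> where "\<sigma> = ln 2 / (4 * ln K)"
  have \<sigma>: "\<sigma> > 0" using K by (simp add: \<sigma>_def)
  have "Limsup at_top (\<lambda>r. ereal (ln_plus (T r) / ln r)) < ereal \<sigma>" using ord \<sigma> by simp
  then have "\<forall>\<^sub>F r in at_top. ereal (ln_plus (T r) / ln r) < ereal \<sigma>" by (rule Limsup_lessD)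
  moreover have "\<forall>\<^sub>F r in at_top. T r \<ge> 1" using T by (simp add: filterlim_at_top)
  moreover have "\<forall>\<^sub>F r in at_top. r \<ge> (2::real)" by (rule eventually_ge_at_top)
  ultimately have "\<forall>\<^sub>F r in at_top. \<not> (T (K * r) \<le> 2 * T r \<and> T (K * (K * r)) \<le> 2 * T r) \<and>
      ln_plus (T r) / ln r < \<sigma> \<and> T r \<ge> 1 \<and> r \<ge> 2"
    by eventually_elim auto
  then obtain R where R: "\<And>r. r \<ge> R \<Longrightarrow> \<not> (T (K * r) \<le> 2 * T r \<and> T (K * (K * r)) \<le> 2 * T r)"
      "\<And>r. r \<ge> R \<Longrightarrow> ln_plus (T r) / ln r < \<sigma>" "\<And>r. r \<ge> R \<Longrightarrow> T r \<ge> 1" "\<And>r. r \<ge> R \<Longrightarrow> r \<ge> 2"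
    unfolding eventually_at_top_linorder by blast
  have R2: "R \<ge> 2" using R(4)[of R] by simp
  have step: "\<exists>r. R \<le> r \<and> r \<le> R * K ^ (2 * n) \<and> 2 ^ n \<le> T r" for n
  proof (induction n)
    case 0
    then show ?case using R(3)[of R] by auto
  next
    case (Suc n)
    then obtain r where r: "R \<le> r" "r \<le> R * K ^ (2 * n)" "2 ^ n \<le> T r" by blast
    have r0: "r > 0" using r R2 by linarith
    have le: "r \<le> K * r" "K * r \<le> K * (K * r)" using K r0 by auto
    have up: "K * (K * r) \<le> R * K ^ (2 * Suc n)"
      using mult_left_mono[OF r(2), of "K * K"] K by (simp add: algebra_simps)
    from R(1)[OF r(1)] consider "T (K * r) > 2 * T r" | "T (K * (K * r)) > 2 * T r" by linarith
    then show ?case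
    proof cases
      case 1
      then show ?thesis using r le up by (intro exI[of _ "K * r"]) auto
    next
      case 2
      then show ?thesis using r le up by (intro exI[of _ "K * (K * r)"]) auto
    qed
  qed
  have bound: "real n * ln 2 \<le> 2 * \<sigma> * ln R" for n
  proof -
    obtain r where r: "R \<le> r" "r \<le> R * K ^ (2 * n)" "2 ^ n \<le> T r" using step by blast
    have lr: "ln r > 0" "r > 0" using r R2 by auto
    have "real n * ln 2 = ln (2 ^ n)" by (simp add: ln_realpow)
    also have "\<dots> \<le> ln (T r)" using r(3) R(3)[OF r(1)] by (intro ln_mono) auto
    also have "\<dots> \<le> ln_plus (T r)" by (rule ln_le_ln_plus)
    also have "\<dots> \<le> \<sigma> * ln r" using R(2)[OF r(1)] lr by (simp add: field_simps)
    also have "ln r \<le> ln (R * K ^ (2 * n))" using r lr R2 by (intro ln_mono) auto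
    also have "\<dots> = ln R + real (2 * n) * ln K"
      using R2 K by (subst ln_mult_pos) (auto simp: ln_realpow)
    finally have "real n * ln 2 \<le> \<sigma> * (ln R + real (2 * n) * ln K)" using \<sigma> by (simp add: mult_left_mono)
    also have "\<dots> = \<sigma> * ln R + real n * ln 2 / 2" using K by (simp add: \<sigma>_def field_simps)
    finally show ?thesis by simp
  qed
  obtain n where "2 * \<sigma> * ln R / ln 2 < real n" using reals_Archimedean2 by blast
  then have "2 * \<sigma> * ln R < real n * ln 2" by (simp add: field_simps)
  then show False using bound[of n] by linarith
qed

context nonconst_mero
begin

lemma count_N_le:
  obtains C where "C \<ge> 0" "\<And>r. r \<ge> 1 \<Longrightarrow> count_N g a r \<le> nev_char g r + C"
proof (cases a)
  case None
  have "count_N g a r \<le> nev_char g r + 0" for r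
    using proximity_nonneg[of g r] by (simp add: None nev_char_def)
  then show ?thesis using that[of 0] by blast
next
  case (Some b)
  obtain C where C: "\<And>r. r > 0 \<Longrightarrow> \<bar>proximity (\<lambda>z. inverse (g z - b)) r + count_N g (Some b) r - nev_char g r\<bar> \<le> C"
    by (rule first_main[of b]) (rule that)
  have "count_N g a r \<le> nev_char g r + C" if "r \<ge> 1" for r
    using C[of r] that proximity_nonneg[of "\<lambda>z. inverse (g z - b)" r] by (auto simp: Some)
  moreover have "C \<ge> 0" using C[of 1] by linarith
  ultimately show ?thesis using that by blast
qed

lemma log_count_abs_zorder_diff:
  "log_count (\<lambda>z. \<bar>of_int (zorder (\<lambda>w. g w - a) z)\<bar>) r = log_count (value_weight g (Some a)) r + log_count (value_weight g None) r"
proof -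
  have "(\<lambda>z. \<bar>of_int (zorder (\<lambda>w. g w - a) z)\<bar>) = (\<lambda>z. value_weight g (Some a) z + value_weight g None z)"
  proof
    fix z
    show "\<bar>of_int (zorder (\<lambda>w. g w - a) z)\<bar> = value_weight g (Some a) z + value_weight g None z"
      using zorder_diff_pole[of z a] zorder_diff_neg_iff[of a z] pole_iff[of z]
      by (cases "is_pole g z") (auto simp: value_weight_def)
  qed
  then show ?thesis by (simp add: log_count_add locally_finite_supp_value_weight)
qed

end

section \<open>The Hahn counterpart of the lemma on the logarithmic derivative\<close>

context hahn_setup
begin

text \<open>The condition on r gives the denominator (q - 1)z + c modulus at least 1 on the circle,
  and the numerator divided by g z - a is the quotient on the right minus 1.\<close>

lemma proximity_hahn_le:
  assumes r: "r > 0" "cmod (1 - q) * r \<ge> cmod c + 1"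
  shows "proximity (\<lambda>z. D z / (g z - a)) r \<le> proximity (\<lambda>z. (g (\<phi> z) - a) / (g z - a)) r + ln 2"
proof -
  have n1: "nz_meromorphic (\<lambda>z. D z / (g z - a))" by (rule nz_meromorphic_divide[OF nz_D nz_diff])
  have n2: "nz_meromorphic (\<lambda>z. (g (\<phi> z) - a) / (g z - a))"
    by (rule nz_meromorphic_divide[OF nz_meromorphic_affine[OF nz_diff q0(1)] nz_diff])
  note i = circle_integrable_ln_plus[OF n1 r(1)] circle_integrable_ln_plus[OF n2 r(1)]
  have fin: "finite {z \<in> cball 0 r. \<not> g z - a \<noteq> 0}"
    by (rule finite_cosparse_exceptions) (use nz_meromorphic_ev[OF nz_diff] in \<open>simp add: eventually_cosparse_open_eq\<close>)
  have "proximity (\<lambda>z. D z / (g z - a)) r \<le> circle_mean r (\<lambda>z. ln_plus (cmod ((g (\<phi> z) - a) / (g z - a))) + ln 2)"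
    unfolding proximity_eq
  proof (rule circle_mean_mono[OF i(1) circle_integrable_add[OF i(2) circle_integrable_const] r(1) fin])
    fix z assume z: "cmod z = r" "z \<notin> {z \<in> cball 0 r. \<not> g z - a \<noteq> 0}"
    then have nz: "g z - a \<noteq> 0" by auto
    have "cmod (1 - q) * r \<le> cmod ((q - 1) * z + c) + cmod c"
      using norm_triangle_ineq4[of "(q - 1) * z + c" c] z by (simp add: norm_mult norm_minus_commute)
    then have den: "cmod ((q - 1) * z + c) \<ge> 1" using r(2) by linarith
    define x where "x = (g (\<phi> z) - a) / (g z - a)"
    have "D z / (g z - a) = (x - 1) / ((q - 1) * z + c)"
      using nz by (simp add: hahn_diff_def x_def field_simps)
    then have "cmod (D z / (g z - a)) = cmod (x - 1) / cmod ((q - 1) * z + c)" by (simp add: norm_divide)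
    also have "\<dots> \<le> cmod (x - 1)" using den by (simp add: divide_le_eq mult_le_cancel_left1)
    also have "\<dots> \<le> cmod x + 1" using norm_triangle_ineq4[of x 1] by simp
    finally have "ln_plus (cmod (D z / (g z - a))) \<le> ln_plus (cmod x + 1)" by (intro ln_plus_mono) auto
    also have "\<dots> \<le> ln_plus (cmod x) + ln_plus 1 + ln 2" by (rule ln_plus_add) auto
    finally show "ln_plus (cmod (D z / (g z - a))) \<le> ln_plus (cmod ((g (\<phi> z) - a) / (g z - a))) + ln 2"
      by (simp add: x_def ln_plus_def)
  qed
  also have "\<dots> = proximity (\<lambda>z. (g (\<phi> z) - a) / (g z - a)) r + ln 2"
    unfolding proximity_eq circle_mean_add[OF i(2) circle_integrable_const] by simp
  finally show ?thesis .
qed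

text \<open>The order of quantifiers matters: the radii of slow growth are attached to K, and the
  same radii must serve all target values, so only C and r0 may depend on a.\<close>

lemma hahn_logarithmic_difference:
  assumes "\<epsilon> > 0"
  obtains K where "K > 1" "\<And>a. \<exists>C r0. \<forall>r\<ge>r0. nev_char g (K * r) \<le> 2 * nev_char g r \<longrightarrow>
     nev_char g (K * (K * r)) \<le> 2 * nev_char g r \<longrightarrow>
     proximity (\<lambda>z. D z / (g z - a)) r \<le> \<epsilon> * nev_char g r + C"
proof -
  define B where "B = ln (8 / cmod q)"
  have B: "B \<ge> 0" using q by (simp add: B_def)
  \<comment> \<open>Both errors decay like 1/L with L = ln K. The bracket multiplied by A amounts to
    12 T, of which 4 T stems from proximity functions and 8 T from zeros and poles; with A \<le>
    16/L this makes 192. The summand 4 B comes from the count of zeros and poles, at most 4 T /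
    L.\<close>
  define L where "L = max 1 ((192 + 4 * B) / \<epsilon>)"
  have L: "L \<ge> 1" "(192 + 4 * B) / L \<le> \<epsilon>"
  proof -
    show L1: "L \<ge> 1" by (simp add: L_def)
    have "(192 + 4 * B) / \<epsilon> \<le> L" by (simp add: L_def)
    then show "(192 + 4 * B) / L \<le> \<epsilon>" using assms L1 by (simp add: field_simps)
  qed
  define K where "K = exp L"
  have lnK: "ln K = L" by (simp add: K_def)
  \<comment> \<open>Allows 1/K to be weakened to 1/L, leaving L as the only parameter of the
    error.\<close>
  have KL: "1 + L \<le> K" unfolding K_def by (rule exp_ge_add_one_self)
  have K: "K > 1" "K \<ge> 2" using KL L by auto
  define A where "A = 4 * K / (K - 1)^2"
  have A: "0 \<le> A" "A \<le> 16 / L"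
  proof -
    show "0 \<le> A" using K by (simp add: A_def)
    have "K / 2 \<le> K - 1" using K by simp
    then have "(K / 2)^2 \<le> (K - 1)^2" using K by (intro power_mono) auto
    then have "A \<le> 4 * K / (K / 2)^2" unfolding A_def using K by (intro divide_left_mono) auto
    also have "\<dots> = 16 / K" using K by (simp add: power2_eq_square field_simps)
    also have "\<dots> \<le> 16 / L" using KL L by (intro divide_left_mono) auto
    finally show "A \<le> 16 / L" .
  qed
  have "\<exists>C r0. \<forall>r\<ge>r0. nev_char g (K * r) \<le> 2 * nev_char g r \<longrightarrow>
     nev_char g (K * (K * r)) \<le> 2 * nev_char g r \<longrightarrow>
     proximity (\<lambda>z. D z / (g z - a)) r \<le> \<epsilon> * nev_char g r + C" for a
  proof -
    define f where "f = (\<lambda>z. g z - a)"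
    have f: "nz_meromorphic f" unfolding f_def by (rule nz_diff)
    obtain C1 where C1': "\<And>r. r > 0 \<Longrightarrow> \<bar>proximity (\<lambda>z. inverse (g z - a)) r + count_N g (Some a) r - nev_char g r\<bar> \<le> C1"
      by (rule first_main[of a]) (rule that)
    have C1: "\<bar>proximity (\<lambda>z. inverse (f z)) r + count_N g (Some a) r - nev_char g r\<bar> \<le> C1" if "r > 0" for r
      using C1'[OF that] by (simp only: f_def)
    have C10: "C1 \<ge> 0" using C1[of 1] by linarith
    define C2 where "C2 = ln_plus (cmod a) + ln 2"
    have C20: "C2 \<ge> 0" unfolding C2_def using ln_plus_nonneg[of "cmod a"] by simp
    define r0 where "r0 = Max {1, 2 * cmod c, cmod c / (1 - cmod q), (cmod c + 1) / cmod (1 - q)}"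
    define C where "C = (16 * (C1 + C2) + 32 * C1 + B * C1) + ln 2"
    show ?thesis
    proof (rule exI[of _ C], rule exI[of _ r0], intro allI impI)
      fix r assume r: "r \<ge> r0" and T1: "nev_char g (K * r) \<le> 2 * nev_char g r"
        and T2: "nev_char g (K * (K * r)) \<le> 2 * nev_char g r"
      define T where "T = nev_char g r"
      have r1: "1 \<le> r" "2 * cmod c \<le> r" "cmod c / (1 - cmod q) \<le> r" "(cmod c + 1) / cmod (1 - q) \<le> r"
        using r by (auto simp: r0_def)
      have rc: "cmod c \<le> (1 - cmod q) * r" using r1(3) q by (simp add: field_simps)
      have rq: "cmod (1 - q) * r \<ge> cmod c + 1" using r1(4) q0 by (simp add: field_simps)
      have T0: "T \<ge> 0" unfolding T_def by (rule nev_char_nonneg[OF r1(1)])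
      have Kr: "1 \<le> K * r" using K r1 by (metis less_eq_real_def mult_le_cancel_left1 mult_mono' mult_1 zero_le_one order_trans)
      have KKr: "1 \<le> K * (K * r)" using K Kr by (metis mult_mono' mult_1 zero_le_one less_eq_real_def)
      have N0: "0 \<le> count_N g b R" if "R \<ge> 1" for b R by (rule count_N_nonneg[OF that])
      have p1: "proximity f (K * r) \<le> 2 * T + C2"
        using proximity_shift[of "K * r" a] Kr N0[OF Kr, of None] T1
        unfolding C2_def f_def T_def nev_char_def[of g "K * r"] by linarith
      have p2: "proximity (\<lambda>z. inverse (f z)) (K * r) \<le> 2 * T + C1"
        using C1[of "K * r"] Kr N0[OF Kr, of "Some a"] T1 unfolding T_def by linarith
      \<comment> \<open>Here the second growth condition is spent: a-points and poles contribute at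
        most 2 T each at radius K^2 r, up to a constant, and dividing by \<open>ln K\<close> leaves
        a small multiple of T.\<close>
      have "order_mass f (K * r) * ln K \<le> log_count (\<lambda>a. \<bar>of_int (zorder f a)\<bar>) (K * (K * r))"
        by (rule order_mass_le_log_count[OF f Kr]) (use K in auto)
      also have "\<dots> = count_N g (Some a) (K * (K * r)) + count_N g None (K * (K * r))"
        unfolding f_def log_count_abs_zorder_diff using KKr by (simp add: count_N_eq)
      also have "\<dots> \<le> 4 * T + C1"
        using C1[of "K * (K * r)"] KKr proximity_nonneg[of "\<lambda>z. inverse (f z)" "K * (K * r)"]
          proximity_nonneg[of g "K * (K * r)"] T2 unfolding T_def nev_char_def[of g "K * (K * r)"] by linarith
      finally have zs: "order_mass f (K * r) \<le> (4 * T + C1) / L" using L by (simp add: lnK field_simps)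
      define Y where "Y = order_mass f (K * r)"
      have Y0: "0 \<le> Y" unfolding Y_def by (rule order_mass_nonneg)
      \<comment> \<open>The Schwarz part already carries the small factor A, so there the count
        without its gain of 1/L is enough.\<close>
      have Y1: "Y \<le> 4 * T + C1"
      proof -
        have "(4 * T + C1) / L \<le> (4 * T + C1) / 1" using L T0 C10 by (intro divide_left_mono) auto
        then show ?thesis using zs by (simp add: Y_def)
      qed
      have ln2: "ln (2::real) \<le> 1" using ln_add_one_self_le_self[of 1] by simp
      have lY: "2 * ln 2 * Y \<le> 2 * Y" using ln2 Y0 by (simp add: mult_right_mono mult_le_cancel_right1)
      have "proximity (\<lambda>z. f (\<phi> z) / f z) r \<le>
         A * (proximity f (K * r) + proximity (\<lambda>z. inverse (f z)) (K * r) + 2 * ln 2 * Y) + B * Y"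
        unfolding A_def B_def Y_def
        by (rule difference_quotient_estimate[OF f q _ r1(2) rc K(1)]) (use r1 in auto)
      also have "\<dots> \<le> A * (4 * T + (C1 + C2) + 2 * (4 * T + C1)) + B * ((4 * T + C1) / L)"
      proof (intro add_mono[OF mult_left_mono mult_left_mono] A(1) B)
        show "proximity f (K * r) + proximity (\<lambda>z. inverse (f z)) (K * r) + 2 * ln 2 * Y \<le> 4 * T + (C1 + C2) + 2 * (4 * T + C1)"
          using add_mono[OF add_mono[OF p1 p2] order_trans[OF lY mult_left_mono[OF Y1, of 2]]]
          by (simp add: algebra_simps)
        show "Y \<le> (4 * T + C1) / L" using zs by (simp only: Y_def)
      qed
      also have "\<dots> \<le> 16 / L * (4 * T + (C1 + C2) + 2 * (4 * T + C1)) + B * ((4 * T + C1) / L)"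
        using A(2) T0 C10 C20 by (intro add_right_mono mult_right_mono) auto
      also have "\<dots> = (192 + 4 * B) / L * T + (16 * (C1 + C2) + 32 * C1 + B * C1) / L"
        using L by (simp add: field_simps)
      also have "\<dots> \<le> \<epsilon> * T + (16 * (C1 + C2) + 32 * C1 + B * C1) / 1"
        using L T0 B C10 C20 by (intro add_mono mult_right_mono divide_left_mono) auto
      finally have "proximity (\<lambda>z. f (\<phi> z) / f z) r \<le> \<epsilon> * T + (16 * (C1 + C2) + 32 * C1 + B * C1)" by simp
      moreover have "proximity (\<lambda>z. D z / (g z - a)) r \<le> proximity (\<lambda>z. f (\<phi> z) / f z) r + ln 2"
        unfolding f_def by (rule proximity_hahn_le) (use r1 rq in auto)
      ultimately show "proximity (\<lambda>z. D z / (g z - a)) r \<le> \<epsilon> * nev_char g r + C"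
        by (simp add: C_def T_def)
    qed
  qed
  then show ?thesis using that K(1) by blast
qed

text \<open>Combining the integrated pointwise bound with the comparison of counting functions
  cancels the logarithmic count of D. What is left on the right, m(r, g) and N(r, g), adds up to the
  one T that is lost in \<open>real (card A) - 1\<close>.\<close>

theorem second_main:
  assumes ord: "nev_order g = 0" and A: "finite A" "A \<noteq> {}" and "\<epsilon> > 0"
  shows "\<exists>\<^sub>F r in at_top. (real (card A) - 1) * nev_char g r \<le>
     (\<Sum>a\<in>A. hahn_count_N q c g (Some a) r) + hahn_count_N q c g None r + \<epsilon> * nev_char g r"
proof -
  define n where "n = real (card A)"
  have n: "n > 0" using A by (simp add: n_def card_gt_0_iff)
  \<comment> \<open>The n difference quotients use up \<epsilon>/2; the other half absorbs the
    constant C5, since T tends to infinity.\<close>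
  define \<epsilon>1 where "\<epsilon>1 = \<epsilon> / (2 * n)"
  have e1: "\<epsilon>1 > 0" using n assms(4) by (simp add: \<epsilon>1_def)
  obtain K where K: "K > 1" "\<And>a. \<exists>C r0. \<forall>r\<ge>r0. nev_char g (K * r) \<le> 2 * nev_char g r \<longrightarrow>
     nev_char g (K * (K * r)) \<le> 2 * nev_char g r \<longrightarrow>
     proximity (\<lambda>z. D z / (g z - a)) r \<le> \<epsilon>1 * nev_char g r + C"
    by (rule hahn_logarithmic_difference[OF e1]) (rule that)
  have "\<forall>a. \<exists>C r0. \<forall>r\<ge>r0. nev_char g (K * r) \<le> 2 * nev_char g r \<longrightarrow>
     nev_char g (K * (K * r)) \<le> 2 * nev_char g r \<longrightarrow>
     proximity (\<lambda>z. D z / (g z - a)) r \<le> \<epsilon>1 * nev_char g r + C" by (intro allI K(2))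
  from choice[OF this] obtain C3 where "\<forall>a. \<exists>r0. \<forall>r\<ge>r0. nev_char g (K * r) \<le> 2 * nev_char g r \<longrightarrow>
     nev_char g (K * (K * r)) \<le> 2 * nev_char g r \<longrightarrow>
     proximity (\<lambda>z. D z / (g z - a)) r \<le> \<epsilon>1 * nev_char g r + C3 a" by blast
  from choice[OF this] obtain r3 where C3: "\<And>a r. r \<ge> r3 a \<Longrightarrow> nev_char g (K * r) \<le> 2 * nev_char g r \<Longrightarrow>
     nev_char g (K * (K * r)) \<le> 2 * nev_char g r \<Longrightarrow>
     proximity (\<lambda>z. D z / (g z - a)) r \<le> \<epsilon>1 * nev_char g r + C3 a" by blast
  have "\<forall>a. \<exists>C. \<forall>r>0. \<bar>proximity (\<lambda>z. inverse (g z - a)) r + count_N g (Some a) r - nev_char g r\<bar> \<le> C"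
    using first_main by metis
  from choice[OF this] obtain C1 where
    C1: "\<And>a r. r > 0 \<Longrightarrow> \<bar>proximity (\<lambda>z. inverse (g z - a)) r + count_N g (Some a) r - nev_char g r\<bar> \<le> C1 a"
    by blast
  obtain C0 where C0: "\<And>w d. w \<notin> A \<Longrightarrow> d \<noteq> 0 \<Longrightarrow>
    (\<Sum>a\<in>A. ln_plus (cmod (inverse (w - a)))) + ln (cmod d) \<le>
      ln_plus (cmod w) + (\<Sum>a\<in>A. ln_plus (cmod (d / (w - a)))) + C0"
    by (rule log_sum_pointwise[OF A]) (rule that)
  obtain C4 where C4: "\<And>r. r \<ge> 1 \<Longrightarrow> cmod c \<le> (1 - cmod q) * r \<Longrightarrow>
    (\<Sum>a\<in>A. count_N g (Some a) r) - log_count (\<lambda>z. of_int (zorder D z)) r \<le>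
     (\<Sum>a\<in>A. hahn_count_N q c g (Some a) r) + hahn_count_N q c g None r + count_N g None r + C4"
    by (rule log_count_weight_inequality[OF A(1)]) (rule that)
  define C5 where "C5 = (\<Sum>a\<in>A. C1 a) + (\<Sum>a\<in>A. C3 a) + C0 - ln (leading_modulus D) + C4"
  \<comment> \<open>The pointwise bound for w = g z and d = D z, averaged over the circle; Jensen's
    formula evaluates the mean of the logarithm of the modulus of D.\<close>
  have S: "(\<Sum>a\<in>A. proximity (\<lambda>z. inverse (g z - a)) r) + (log_count (\<lambda>z. of_int (zorder D z)) r + ln (leading_modulus D)) \<le>
     proximity g r + (\<Sum>a\<in>A. proximity (\<lambda>z. D z / (g z - a)) r) + C0" if r: "r > 0" for r
  proof -
    note i1 = circle_integrable_ln_plus[OF nz_meromorphic_inverse[OF nz_diff] r]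
    note i2 = circle_integrable_ln_plus[OF nz_meromorphic_divide[OF nz_D nz_diff] r]
    note i3 = circle_integrable_ln_plus[OF nz r]
    note J = jensen[OF nz_D r]
    define X where "X = {z \<in> cball 0 r. \<not> D z \<noteq> 0} \<union> (\<Union>a\<in>A. {z \<in> cball 0 r. \<not> g z - a \<noteq> 0})"
    have fin: "finite {z \<in> cball 0 r. \<not> F z \<noteq> 0}" if "nz_meromorphic F" for F
      by (rule finite_cosparse_exceptions) (use nz_meromorphic_ev[OF that] in \<open>simp add: eventually_cosparse_open_eq\<close>)
    have X: "finite X" unfolding X_def using A by (intro finite_UnI finite_UN_I fin nz_D nz_diff)
    have "circle_mean r (\<lambda>z. (\<Sum>a\<in>A. ln_plus (cmod (inverse (g z - a)))) + ln (cmod (D z))) \<le>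
       circle_mean r (\<lambda>z. ln_plus (cmod (g z)) + (\<Sum>a\<in>A. ln_plus (cmod (D z / (g z - a)))) + C0)"
    proof (rule circle_mean_mono[OF _ _ r X])
      show "circle_integrable r (\<lambda>z. (\<Sum>a\<in>A. ln_plus (cmod (inverse (g z - a)))) + ln (cmod (D z)))"
        by (intro circle_integrable_add circle_integrable_sum i1 J(1))
      show "circle_integrable r (\<lambda>z. ln_plus (cmod (g z)) + (\<Sum>a\<in>A. ln_plus (cmod (D z / (g z - a)))) + C0)"
        by (intro circle_integrable_add circle_integrable_sum i2 i3 circle_integrable_const)
      fix z assume z: "cmod z = r" "z \<notin> X"
      then have "g z \<notin> A" "D z \<noteq> 0" by (auto simp: X_def)
      then show "(\<Sum>a\<in>A. ln_plus (cmod (inverse (g z - a)))) + ln (cmod (D z)) \<le>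
          ln_plus (cmod (g z)) + (\<Sum>a\<in>A. ln_plus (cmod (D z / (g z - a)))) + C0"
        by (rule C0)
    qed
    moreover have "circle_mean r (\<lambda>z. (\<Sum>a\<in>A. ln_plus (cmod (inverse (g z - a)))) + ln (cmod (D z))) =
        (\<Sum>a\<in>A. proximity (\<lambda>z. inverse (g z - a)) r) + (log_count (\<lambda>z. of_int (zorder D z)) r + ln (leading_modulus D))"
      unfolding proximity_eq J(2)[symmetric]
      using circle_mean_add[OF circle_integrable_sum[of A, OF i1] J(1)] circle_mean_sum[of A, OF i1] by simp
    moreover have "circle_mean r (\<lambda>z. ln_plus (cmod (g z)) + (\<Sum>a\<in>A. ln_plus (cmod (D z / (g z - a)))) + C0) =
        proximity g r + (\<Sum>a\<in>A. proximity (\<lambda>z. D z / (g z - a)) r) + C0"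
      unfolding proximity_eq
      using circle_mean_add[OF circle_integrable_add[OF i3 circle_integrable_sum[of A, OF i2]] circle_integrable_const] circle_mean_add[OF i3 circle_integrable_sum[of A, OF i2]]
        circle_mean_sum[of A, OF i2] by simp
    ultimately show ?thesis by simp
  qed
  have freq: "\<exists>\<^sub>F r in at_top. nev_char g (K * r) \<le> 2 * nev_char g r \<and> nev_char g (K * (K * r)) \<le> 2 * nev_char g r"
    by (rule slow_growth[OF nev_char_at_top _ K(1)]) (use ord in \<open>simp add: nev_order_def\<close>)
  have "\<forall>\<^sub>F r in at_top. \<forall>a\<in>A. r \<ge> r3 a"
    using A(1) by (intro eventually_ball_finite) (auto intro: eventually_ge_at_top)
  moreover have "\<forall>\<^sub>F r in at_top. r \<ge> max 1 (cmod c / (1 - cmod q))" by (rule eventually_ge_at_top)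
  moreover have "\<forall>\<^sub>F r in at_top. nev_char g r \<ge> 2 * C5 / \<epsilon>" using nev_char_at_top by (simp add: filterlim_at_top)
  ultimately have ev: "\<forall>\<^sub>F r in at_top. (\<forall>a\<in>A. r \<ge> r3 a) \<and> r \<ge> max 1 (cmod c / (1 - cmod q)) \<and> nev_char g r \<ge> 2 * C5 / \<epsilon>"
    by eventually_elim auto
  show ?thesis
  proof (rule frequently_rev_mp[OF freq eventually_mono[OF ev]], intro impI)
    fix r
    assume r: "(\<forall>a\<in>A. r \<ge> r3 a) \<and> r \<ge> max 1 (cmod c / (1 - cmod q)) \<and> nev_char g r \<ge> 2 * C5 / \<epsilon>"
      and K2: "nev_char g (K * r) \<le> 2 * nev_char g r \<and> nev_char g (K * (K * r)) \<le> 2 * nev_char g r"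
    define T where "T = nev_char g r"
    have r1: "r \<ge> 1" using r by auto
    have rc: "cmod c \<le> (1 - cmod q) * r" using r q by (auto simp: field_simps)
    have "(\<Sum>a\<in>A. proximity (\<lambda>z. D z / (g z - a)) r) \<le> (\<Sum>a\<in>A. \<epsilon>1 * T + C3 a)"
      unfolding T_def using r K2 by (intro sum_mono C3) auto
    also have "\<dots> = \<epsilon> / 2 * T + (\<Sum>a\<in>A. C3 a)"
      using n by (simp add: sum.distrib n_def[symmetric] \<epsilon>1_def)
    finally have e: "(\<Sum>a\<in>A. proximity (\<lambda>z. D z / (g z - a)) r) \<le> \<epsilon> / 2 * T + (\<Sum>a\<in>A. C3 a)" .
    have "(\<Sum>a\<in>A. T - count_N g (Some a) r - C1 a) \<le> (\<Sum>a\<in>A. proximity (\<lambda>z. inverse (g z - a)) r)"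
    proof (rule sum_mono)
      fix a
      show "T - count_N g (Some a) r - C1 a \<le> proximity (\<lambda>z. inverse (g z - a)) r"
        using C1[of r a] r1 unfolding T_def by linarith
    qed
    then have f: "n * T - (\<Sum>a\<in>A. count_N g (Some a) r) - (\<Sum>a\<in>A. C1 a) \<le>
        (\<Sum>a\<in>A. proximity (\<lambda>z. inverse (g z - a)) r)"
      by (simp add: sum_subtractf n_def)
    have c: "C5 \<le> \<epsilon> / 2 * T" using r assms(4) by (simp add: T_def field_simps)
    have t: "T = proximity g r + count_N g None r" by (simp add: T_def nev_char_def)
    have s: "(\<Sum>a\<in>A. proximity (\<lambda>z. inverse (g z - a)) r) + (log_count (\<lambda>z. of_int (zorder D z)) r + ln (leading_modulus D)) \<le>
     proximity g r + (\<Sum>a\<in>A. proximity (\<lambda>z. D z / (g z - a)) r) + C0" by (rule S) (use r1 in auto)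
    have "n * T - T \<le> (\<Sum>a\<in>A. hahn_count_N q c g (Some a) r) + hahn_count_N q c g None r + (\<epsilon> / 2 * T + \<epsilon> / 2 * T)"
      using e f c t s C4[OF r1 rc] unfolding C5_def by linarith
    then show "(real (card A) - 1) * nev_char g r \<le>
     (\<Sum>a\<in>A. hahn_count_N q c g (Some a) r) + hahn_count_N q c g None r + \<epsilon> * nev_char g r"
      by (simp add: T_def[symmetric] n_def[symmetric] algebra_simps)
  qed
qed

end

subsection \<open>Deficiencies\<close>

text \<open>Eventual real bounds make the upper limit a real number, so that deficiencies can be
  added and subtracted away from the infinite values of \<open>ereal\<close>.\<close>

lemma Limsup_real_between:
  assumes "\<forall>\<^sub>F r in at_top. a \<le> f r" "\<forall>\<^sub>F r in at_top. f r \<le> h r" "(h \<longlongrightarrow> b) (at_top :: real filter)"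
  obtains l where "Limsup at_top (\<lambda>r::real. ereal (f r)) = ereal l" "a \<le> l" "l \<le> b"
proof -
  let ?L = "Limsup at_top (\<lambda>r. ereal (f r))"
  have "Limsup at_top (\<lambda>_::real. ereal a) \<le> ?L"
    by (rule Limsup_mono) (use assms(1) in eventually_elim, simp)
  then have 1: "ereal a \<le> ?L" by (simp add: Limsup_const)
  have "?L \<le> Limsup at_top (\<lambda>r. ereal (h r))"
    by (rule Limsup_mono) (use assms(2) in eventually_elim, simp)
  also have "\<dots> = ereal b"
    by (rule lim_imp_Limsup) (use assms(3) in auto)
  finally have 2: "?L \<le> ereal b" .
  obtain l where l: "?L = ereal l" using 1 2 by (cases ?L) auto
  show ?thesis using that[OF l] 1 2 unfolding l by simp
qed

lemma Liminf_real_between: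
  assumes "\<forall>\<^sub>F r in at_top. a \<le> f r" "\<forall>\<^sub>F r in at_top. f r \<le> h r" "(h \<longlongrightarrow> b) (at_top :: real filter)"
  obtains l where "Liminf at_top (\<lambda>r::real. ereal (f r)) = ereal l" "a \<le> l"
proof -
  let ?L = "Liminf at_top (\<lambda>r. ereal (f r))"
  have 1: "ereal a \<le> ?L" by (rule Liminf_bounded) (use assms(1) in eventually_elim, simp)
  obtain l' where l': "Limsup at_top (\<lambda>r. ereal (f r)) = ereal l'"
    by (rule Limsup_real_between[OF assms]) (rule that)
  have 2: "?L \<le> ereal l'" unfolding l'[symmetric] by (rule Liminf_le_Limsup) simp
  obtain l where l: "?L = ereal l" using 1 2 by (cases ?L) auto
  show ?thesis using that[OF l] 1 unfolding l by simp
qed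

context hahn_setup
begin

abbreviation "T \<equiv> nev_char g"

lemma nev_char_ge: "\<forall>\<^sub>F r in at_top. T r \<ge> x"
  using nev_char_at_top by (simp add: filterlim_at_top)

lemma ratio_bounds:
  obtains h where "(h \<longlongrightarrow> 1) at_top"
    "\<forall>\<^sub>F r in at_top. 0 \<le> hahn_count_N q c g a r / T r \<and>
       hahn_count_N q c g a r / T r \<le> count_N g a r / T r \<and> count_N g a r / T r \<le> h r"
proof -
  obtain C where C: "C \<ge> 0" "\<And>r. r \<ge> 1 \<Longrightarrow> count_N g a r \<le> T r + C" by (rule count_N_le[of a]) (rule that)
  define h where "h = (\<lambda>r. 1 + C / T r)"
  have "((\<lambda>r. C / T r) \<longlongrightarrow> 0) at_top"
    by (rule real_tendsto_divide_at_top[OF tendsto_const nev_char_at_top])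
  then have "((\<lambda>r. 1 + C / T r) \<longlongrightarrow> 1 + 0) at_top" by (intro tendsto_intros)
  then have h: "(h \<longlongrightarrow> 1) at_top" by (simp add: h_def)
  have "\<forall>\<^sub>F r in at_top. 0 \<le> hahn_count_N q c g a r / T r \<and>
       hahn_count_N q c g a r / T r \<le> count_N g a r / T r \<and> count_N g a r / T r \<le> h r"
    using nev_char_ge[of 1] eventually_ge_at_top[of 1]
  proof eventually_elim
    case (elim r)
    have "count_N g a r / T r \<le> (T r + C) / T r" using C(2)[of r] elim by (intro divide_right_mono) auto
    also have "\<dots> = h r" using elim by (simp add: h_def add_divide_distrib)
    finally show ?case using hahn_count_N_bounds[OF elim(2), of q c a] elim by (auto intro!: divide_right_mono)
  qed
  then show ?thesis using that h by blast
qed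

lemma hahn_total_deficiency_real:
  obtains l where "0 \<le> l" "l \<le> 1" "Limsup at_top (\<lambda>r. ereal (hahn_count_N q c g a r / T r)) = ereal l"
    "hahn_total_deficiency q c a g = ereal (1 - l)"
proof -
  obtain h where h: "(h \<longlongrightarrow> 1) at_top"
    "\<forall>\<^sub>F r in at_top. 0 \<le> hahn_count_N q c g a r / T r \<and>
       hahn_count_N q c g a r / T r \<le> count_N g a r / T r \<and> count_N g a r / T r \<le> h r"
    by (rule ratio_bounds[of a]) (rule that)
  have e: "\<forall>\<^sub>F r in at_top. 0 \<le> hahn_count_N q c g a r / T r" "\<forall>\<^sub>F r in at_top. hahn_count_N q c g a r / T r \<le> h r"
    using h(2) by (eventually_elim, auto)+
  obtain l where l: "Limsup at_top (\<lambda>r. ereal (hahn_count_N q c g a r / T r)) = ereal l" "0 \<le> l" "l \<le> 1"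
    by (rule Limsup_real_between[OF e h(1)]) (rule that)
  then show ?thesis using that[of l] by (simp add: hahn_total_deficiency_def one_ereal_def)
qed

text \<open>The reduced ratio is the full ratio minus the ramification ratio, and the upper limit of
  a difference is at most the upper limit minus the lower limit. Nonnegativity follows from N \<le>
  T + O(1) and from the reduced count not exceeding the full one.\<close>

lemma deficiency_ramification_le:
  "0 \<le> deficiency a g + hahn_ramification q c a g"
  "deficiency a g + hahn_ramification q c a g \<le> hahn_total_deficiency q c a g"
proof -
  obtain h where h: "(h \<longlongrightarrow> 1) at_top"
    "\<forall>\<^sub>F r in at_top. 0 \<le> hahn_count_N q c g a r / T r \<and>
       hahn_count_N q c g a r / T r \<le> count_N g a r / T r \<and> count_N g a r / T r \<le> h r"
    by (rule ratio_bounds[of a]) (rule that)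
  have e: "\<forall>\<^sub>F r in at_top. 0 \<le> count_N g a r / T r" "\<forall>\<^sub>F r in at_top. count_N g a r / T r \<le> h r"
    "\<forall>\<^sub>F r in at_top. 0 \<le> (count_N g a r - hahn_count_N q c g a r) / T r"
    "\<forall>\<^sub>F r in at_top. (count_N g a r - hahn_count_N q c g a r) / T r \<le> h r"
    using h(2) by (eventually_elim, auto simp: diff_divide_distrib)+
  obtain x where x: "Limsup at_top (\<lambda>r. ereal (count_N g a r / T r)) = ereal x" "0 \<le> x" "x \<le> 1"
    by (rule Limsup_real_between[OF e(1,2) h(1)]) (rule that)
  obtain y where y: "Liminf at_top (\<lambda>r. ereal ((count_N g a r - hahn_count_N q c g a r) / T r)) = ereal y" "0 \<le> y"
    by (rule Liminf_real_between[OF e(3,4) h(1)]) (rule that)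
  obtain l where l: "0 \<le> l" "l \<le> 1" "Limsup at_top (\<lambda>r. ereal (hahn_count_N q c g a r / T r)) = ereal l"
    "hahn_total_deficiency q c a g = ereal (1 - l)"
    by (rule hahn_total_deficiency_real[of a]) (rule that)
  have d: "deficiency a g + hahn_ramification q c a g = ereal (1 - x + y)"
    by (simp add: deficiency_def hahn_ramification_def x y one_ereal_def)
  show "0 \<le> deficiency a g + hahn_ramification q c a g" unfolding d using x y by simp
  have "l \<le> x - y + e" if "e > 0" for e
  proof -
    have "Limsup at_top (\<lambda>r. ereal (count_N g a r / T r)) < ereal (x + e / 2)" using x that by simp
    from Limsup_lessD[OF this]
    have 1: "\<forall>\<^sub>F r in at_top. count_N g a r / T r < x + e / 2" by simp
    have "ereal (y - e / 2) < Liminf at_top (\<lambda>r. ereal ((count_N g a r - hahn_count_N q c g a r) / T r))"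
      using y that by simp
    from less_LiminfD[OF this]
    have 2: "\<forall>\<^sub>F r in at_top. y - e / 2 < (count_N g a r - hahn_count_N q c g a r) / T r" by simp
    have "Limsup at_top (\<lambda>r. ereal (hahn_count_N q c g a r / T r)) \<le> ereal (x - y + e)"
    proof (rule Limsup_bounded)
      show "\<forall>\<^sub>F r in at_top. ereal (hahn_count_N q c g a r / T r) \<le> ereal (x - y + e)"
        using 1 2
      proof eventually_elim
        case (elim r)
        then have "hahn_count_N q c g a r / T r \<le> x - y + e"
          unfolding diff_divide_distrib by linarith
        then show ?case by simp
      qed
    qed
    then show ?thesis by (simp add: l)
  qed
  then have "l \<le> x - y" by (rule field_le_epsilon)
  then show "deficiency a g + hahn_ramification q c a g \<le> hahn_total_deficiency q c a g"
    unfolding d l by simp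
qed

lemma hahn_total_deficiency_nonneg: "0 \<le> hahn_total_deficiency q c a g"
  using deficiency_ramification_le[of a] by (rule order_trans)

text \<open>Enlarging F to A together with infinity is harmless since all terms are nonnegative; the
  value 0 is added to make A nonempty. Over these n + 1 values the sum is n + 1 minus the sum of the
  limits l, which is at least n - 1.\<close>

lemma sum_hahn_total_deficiency_le:
  assumes ord: "nev_order g = 0" and F: "finite F"
  shows "(\<Sum>a\<in>F. hahn_total_deficiency q c a g) \<le> 2"
proof -
  define A where "A = insert 0 {a. Some a \<in> F}"
  have "finite (Some -` F)" by (rule finite_vimageI[OF F]) simp
  then have A: "finite A" "A \<noteq> {}" by (auto simp: A_def vimage_def)
  define n where "n = real (card A)"
  have sub: "F \<subseteq> insert None (Some ` A)"
  proof
    fix a assume "a \<in> F"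
    then show "a \<in> insert None (Some ` A)" by (cases a) (auto simp: A_def)
  qed
  have "\<forall>a. \<exists>l. Limsup at_top (\<lambda>r. ereal (hahn_count_N q c g a r / T r)) = ereal l \<and>
     hahn_total_deficiency q c a g = ereal (1 - l)"
  proof
    fix a
    show "\<exists>l. Limsup at_top (\<lambda>r. ereal (hahn_count_N q c g a r / T r)) = ereal l \<and>
     hahn_total_deficiency q c a g = ereal (1 - l)"
      by (rule hahn_total_deficiency_real[of a]) blast
  qed
  from choice[OF this] obtain l where l: "\<And>a. Limsup at_top (\<lambda>r. ereal (hahn_count_N q c g a r / T r)) = ereal (l a)"
     "\<And>a. hahn_total_deficiency q c a g = ereal (1 - l a)" by blast
  have main: "n - 1 \<le> (\<Sum>a\<in>A. l (Some a)) + l None" 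
  proof (rule field_le_epsilon)
    fix e :: real assume e: "e > 0"
    \<comment> \<open>The n finite values, infinity and the error of \<open>second_main\<close> each
      cost one \<epsilon>.\<close>
    define \<epsilon> where "\<epsilon> = e / (n + 2)"
    have n0: "n + 2 > 0" by (simp add: n_def add_nonneg_pos)
    have \<epsilon>: "\<epsilon> > 0" using e n0 by (simp add: \<epsilon>_def)
    have ev: "\<forall>\<^sub>F r in at_top. hahn_count_N q c g a r / T r < l a + \<epsilon>" for a
    proof -
      have "Limsup at_top (\<lambda>r. ereal (hahn_count_N q c g a r / T r)) < ereal (l a + \<epsilon>)" using \<epsilon> by (simp add: l)
      from Limsup_lessD[OF this] show ?thesis by simp
    qed
    have evA: "\<forall>\<^sub>F r in at_top. \<forall>a\<in>A. hahn_count_N q c g (Some a) r / T r < l (Some a) + \<epsilon>"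
      using A(1) by (intro eventually_ball_finite ballI ev)
    have "\<forall>\<^sub>F r in at_top. (\<forall>a\<in>A. hahn_count_N q c g (Some a) r / T r < l (Some a) + \<epsilon>) \<and>
       hahn_count_N q c g None r / T r < l None + \<epsilon> \<and> T r \<ge> 1"
      using evA ev[of None] nev_char_ge[of 1] by eventually_elim blast
    \<comment> \<open>One common radius is enough: the bounds from the upper limits hold eventually,
      the second main theorem on an unbounded set.\<close>
    from frequently_eventually_frequently[OF second_main[OF ord A \<epsilon>] this]
    obtain r where r: "(real (card A) - 1) * T r \<le>
       (\<Sum>a\<in>A. hahn_count_N q c g (Some a) r) + hahn_count_N q c g None r + \<epsilon> * T r"
      "\<And>a. a \<in> A \<Longrightarrow> hahn_count_N q c g (Some a) r / T r < l (Some a) + \<epsilon>"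
      "hahn_count_N q c g None r / T r < l None + \<epsilon>" "T r \<ge> 1"
      by (auto dest!: frequently_ex)
    have "n - 1 = ((n - 1) * T r) / T r" using r(4) by simp
    also have "\<dots> \<le> ((\<Sum>a\<in>A. hahn_count_N q c g (Some a) r) + hahn_count_N q c g None r + \<epsilon> * T r) / T r"
      using r(1,4) by (intro divide_right_mono) (auto simp: n_def)
    also have "\<dots> = (\<Sum>a\<in>A. hahn_count_N q c g (Some a) r / T r) + hahn_count_N q c g None r / T r + \<epsilon>"
      using r(4) by (simp add: add_divide_distrib sum_divide_distrib)
    also have "\<dots> \<le> (\<Sum>a\<in>A. l (Some a) + \<epsilon>) + (l None + \<epsilon>) + \<epsilon>"
      using r(2,3) by (intro add_mono sum_mono) (auto intro: less_imp_le)
    also have "\<dots> = (\<Sum>a\<in>A. l (Some a)) + l None + (n + 2) * \<epsilon>"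
      by (simp add: sum.distrib n_def algebra_simps)
    also have "(n + 2) * \<epsilon> = e" using n0 by (simp add: \<epsilon>_def)
    finally show "n - 1 \<le> (\<Sum>a\<in>A. l (Some a)) + l None + e" .
  qed
  have "(\<Sum>a\<in>F. hahn_total_deficiency q c a g) \<le> (\<Sum>a\<in>insert None (Some ` A). hahn_total_deficiency q c a g)"
    using A sub hahn_total_deficiency_nonneg by (intro sum_mono2) auto
  also have "\<dots> = ereal (\<Sum>a\<in>insert None (Some ` A). 1 - l a)" by (simp only: l(2) sum_ereal)
  also have "(\<Sum>a\<in>insert None (Some ` A). 1 - l a) = (1 - l None) + (\<Sum>a\<in>A. 1 - l (Some a))"
    using A(1) by (subst sum.insert) (auto simp: sum.reindex)
  also have "\<dots> = (1 - l None) + (n - (\<Sum>a\<in>A. l (Some a)))" by (simp add: sum_subtractf n_def)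
  also have "ereal \<dots> \<le> 2" using main by simp
  finally show ?thesis .
qed

end

theorem theorem6:
  fixes q c :: complex and g :: "complex \<Rightarrow> complex"
  assumes "0 < cmod q" and "cmod q < 1"
    and "g nicely_meromorphic_on UNIV"
    and "\<not> g constant_on UNIV"
    and "nev_order g = 0"
  shows "(\<lambda>a. deficiency a g + hahn_ramification q c a g) summable_on (UNIV :: ext_complex set)
    \<and> (\<lambda>a. hahn_total_deficiency q c a g) summable_on (UNIV :: ext_complex set)
    \<and> (\<Sum>\<^sub>\<infinity>a\<in>(UNIV :: ext_complex set). deficiency a g + hahn_ramification q c a g)
        \<le> (\<Sum>\<^sub>\<infinity>a\<in>(UNIV :: ext_complex set). hahn_total_deficiency q c a g)
    \<and> (\<Sum>\<^sub>\<infinity>a\<in>(UNIV :: ext_complex set). hahn_total_deficiency q c a g) \<le> 2"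
proof -
  interpret hahn_setup g q c by unfold_locales (use assms in auto)
  have s1: "(\<lambda>a. deficiency a g + hahn_ramification q c a g) summable_on (UNIV :: ext_complex set)"
    by (rule nonneg_summable_on_complete) (rule deficiency_ramification_le)
  have s2: "(\<lambda>a. hahn_total_deficiency q c a g) summable_on (UNIV :: ext_complex set)"
    by (rule nonneg_summable_on_complete) (rule hahn_total_deficiency_nonneg)
  have le: "(\<Sum>\<^sub>\<infinity>a\<in>(UNIV :: ext_complex set). deficiency a g + hahn_ramification q c a g)
        \<le> (\<Sum>\<^sub>\<infinity>a\<in>(UNIV :: ext_complex set). hahn_total_deficiency q c a g)"
    by (rule infsum_mono[OF s1 s2]) (rule deficiency_ramification_le)
  have "(\<Sum>\<^sub>\<infinity>a\<in>(UNIV :: ext_complex set). hahn_total_deficiency q c a g) =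
     (SUP F\<in>{F. finite F \<and> F \<subseteq> UNIV}. \<Sum>a\<in>F. hahn_total_deficiency q c a g)"
    by (rule nonneg_infsum_complete) (rule hahn_total_deficiency_nonneg)
  \<comment> \<open>For nonnegative extended reals the infinite sum is the supremum over finite
    subsets, so the bound for finite sets carries over.\<close>
  also have "\<dots> \<le> 2"
    by (rule SUP_least) (use sum_hahn_total_deficiency_le[OF assms(5)] in auto)
  finally show ?thesis using s1 s2 le by blast
qed

end
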